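(* Let $X$ be the complex manifold of flags of type $(d_1,\ldots,d_k)$ in $\mathbb{C}^N$, let $E\to X\times X$, $\eta$, $\gamma_{0,i}$ and $\gamma_{1,i}$ be as defined in the context, and let $i\in\{1,\ldots,k\}$. Then the section $G_i=G_i(z,\zeta):=\gamma_{0,i}+\gamma_{1,i}$ is a weight for the tautological vector bundle $H_i$.
   Context: Let $0<d_1<\cdots<d_k=N$ be integers. A flag of type $(d_1,\ldots,d_k)$ is a tuple $(V_1,\ldots,V_k)$ of linear subspaces $V_1\subset\cdots\subset V_k=\mathbb{C}^N$ with $\dim V_i=d_i$. $X$ is the complex manifold of all such flags, of dimension $n=\sum_{j=1}^{k-1}d_j(d_{j+1}-d_j)$; $\Delta\subset X\times X$ is the diagonal. For $i=1,\ldots,k$, $H_i=\{(\mathbf{F},v)\in X\times\mathbb{C}^N: v\in V_i\}$ is the tautological bundle, $F_i=(X\times\mathbb{C}^N)/H_i$ the quotient bundle with projection $q_i$, and $Q_i:F_i\to F_{i+1}$, $v+H_i\mapsto v+H_{i+1}$. Using the Euclidean metric on $\mathbb{C}^N$, let $\varphi_i:F_i\to H_i^\perp\subset X\times\mathbb{C}^N$ be the inverse of $q_i|_{H_i^\perp}$, and $\pi_{H_i}:X\times\mathbb{C}^N\to H_i$ the orthogonal projection. Points of $X\times X$ are written $(z,\zeta)$; a subscript $z$ (resp. $\zeta$) denotes pullback from the first (resp. second) factor. Let $\eta=\sum_{i=1}^{k-1}\eta_i$ be the holomorphic section of $\bigoplus_{i=1}^{k-1}\mathrm{Hom}(H_{i,\zeta},F_{i,z})=\bigoplus_{i=1}^{k-1}F_{i,z}\otimes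 H_{i,\zeta}^*$ with $\eta_i(z,\zeta)v=q_{i,z}(v)$ for $v\in H_{i,\zeta}\subset\mathbb{C}^N$. Let $E=\ker\Phi$, where $$\Phi:\bigoplus_{i=1}^{k-1}\mathrm{Hom}(H_{i,\zeta},F_{i,z})\to\bigoplus_{i=1}^{k-2}\mathrm{Hom}(H_{i,\zeta},F_{i+1,z}),\quad \Phi\Big(\sum f_i\Big)=\sum_{i=1}^{k-2}\big(f_{i+1}|_{H_{i,\zeta}}-Q_i\circ f_i\big).$$ $E$ is a holomorphic vector bundle of rank $n$ and $\eta$ is a holomorphic section of $E$. Weights: Let $V\to X$ be a holomorphic vector bundle. Put $G_E=\Lambda[T^*(X\times X)\oplus E\oplus E^*]$ and $G_{E,V}=\mathrm{Hom}(V_\zeta,V_z)\otimes G_E$. Let $\delta_\eta$ be interior multiplication (contraction) by $\eta$ (acting on the $E^*$ factors) and $\nabla_\eta=\delta_\eta-\bar\partial$, acting on smooth sections of $G_{E,V}$. A smooth section $g=g_{0,0}+\cdots+g_{n,n}$ of $G_{E,V}$, where $g_{l,l}$ has values in $\mathrm{Hom}(V_\zeta,V_z)\otimes(\Lambda^lE^*\wedge T^*_{0,l}(X\times X))$, is called a weight for $V$ if $\nabla_\eta g=0$ and $g_{0,0}|_\Delta=\mathrm{Id}\in\mathrm{Hom}(V_\zeta,V_z)|_\Delta$. Define $\gamma_{0,i}$, a section of $H_i\boxtimes H_i^*=\mathrm{Hom}(H_{i,\zeta},H_{i,z})$, by $\gamma_{0,i}(z,\zeta)v=\pi_{H_{i,z}}v$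 for $v\in H_{i,\zeta}$. Define $\gamma_{1,i}$, a smooth section of $(H_i\boxtimes H_i^* )\otimes E^*\otimes T^*_{0,1}(X\times X)$, as follows: for germs of smooth sections $\xi$ of $E$ and $v$ of $H_{i,\zeta}$, write $\xi=\xi_1+\cdots+\xi_{k-1}$ with $\xi_j\in F_{j,z}\otimes H_{j,\zeta}^*$, put $\xi_k=0$ (note $F_k=0$), and set $$\gamma_{1,i}(\xi\otimes v)=-\pi_{H_{i,z}}\big(\bar\partial\,\varphi_i(\xi_i(v))\big),$$ where $\varphi_i(\xi_i(v))$ is regarded as a $\mathbb{C}^N$-valued function and $\varphi_i$ is taken on $F_{i,z}$. This expression is $C^\infty(X\times X)$-linear in $\xi\otimes v$, so it defines such a section. *)

theory Defs
  imports "HOL-Analysis.Analysis"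
begin

section \<open>Smooth functions and the Cauchy--Riemann operator on pairs of matrices\<close>

type_synonym 'n cmat = "complex^'n^'n"

primrec Ck_on :: "nat \<Rightarrow> 'a::real_normed_vector set \<Rightarrow> ('a \<Rightarrow> 'b::real_normed_vector) \<Rightarrow> bool" where
  "Ck_on 0 S f = continuous_on S f"
| "Ck_on (Suc m) S f =
     ((\<forall>x\<in>S. f differentiable (at x)) \<and> (\<forall>v. Ck_on m S (\<lambda>x. frechet_derivative f (at x) v)))"

text \<open>Only used for open sets.\<close>

definition smooth_on :: "'a::real_normed_vector set \<Rightarrow> ('a \<Rightarrow> 'b::real_normed_vector) \<Rightarrow> bool" where
  "smooth_on S f \<longleftrightarrow> (\<forall>m. Ck_on m S f)"

definition mscale :: "complex \<Rightarrow> 'n cmat \<times> 'n cmat \<Rightarrow> 'n::finite cmat \<times> 'n cmat" where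
  "mscale c M = ((\<chi> r s. c * fst M $ r $ s), (\<chi> r s. c * snd M $ r $ s))"

text \<open>The complex antilinear part of the real derivative, that is, the (0,1)-form
  \<open>\<partial>bar f\<close> at \<open>a\<close> evaluated on the tangent vector \<open>M\<close>.\<close>

definition dbar :: "('n::finite cmat \<times> 'n cmat \<Rightarrow> complex) \<Rightarrow> 'n cmat \<times> 'n cmat \<Rightarrow>
    'n cmat \<times> 'n cmat \<Rightarrow> complex" where
  "dbar f a M = (frechet_derivative f (at a) M + \<i> * frechet_derivative f (at a) (mscale \<i> M)) / 2"

definition dbar_vec :: "('n::finite cmat \<times> 'n cmat \<Rightarrow> complex^'m) \<Rightarrow> 'n cmat \<times> 'n cmat \<Rightarrow>
    'n cmat \<times> 'n cmat \<Rightarrow> complex^'m" where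
  "dbar_vec f a M = (\<chi> r. dbar (\<lambda>b. f b $ r) a M)"

section \<open>The flag manifold\<close>

text \<open>The numbers \<open>d 1 < \<dots> < d k = N\<close> are given by a function \<open>d\<close> and by \<open>k\<close>, with \<open>N = CARD('n)\<close>.
  A flag is stored as the family \<open>F 1 \<subseteq> \<dots> \<subseteq> F k\<close>, undefined at indices outside \<open>{1..k}\<close>.\<close>

type_synonym 'n flag = "nat \<Rightarrow> (complex^'n) set"

definition flags :: "nat \<Rightarrow> (nat \<Rightarrow> nat) \<Rightarrow> 'n::finite flag set" where
  "flags k d = {F \<in> extensional {1..k}.
     (\<forall>i\<in>{1..k}. vec.subspace (F i) \<and> vec.dim (F i) = d i) \<and>
     (\<forall>i\<in>{1..<k}. F i \<subseteq> F (Suc i)) \<and> F k = UNIV}"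

definition flag_dim :: "nat \<Rightarrow> (nat \<Rightarrow> nat) \<Rightarrow> nat" where
  "flag_dim k d = (\<Sum>j\<in>{1..<k}. d j * (d (Suc j) - d j))"

text \<open>The complex manifold structure on the set \<open>X\<close> of flags is that of the homogeneous space
  \<open>GL\<^sub>N(\<complex>)/P\<close>: for every flag \<open>F\<close>, the orbit map \<open>g \<mapsto> g F\<close> is a surjective holomorphic
  submersion from \<open>GL\<^sub>N(\<complex>)\<close> onto \<open>X\<close>. Hence a subset of \<open>X\<close> is open, a function is smooth,
  or holomorphic, iff this holds after composition with the orbit maps; and the tangent space of \<open>X\<close>
  at \<open>F\<close> is the quotient of the space of all matrices \<open>M\<close> (acting by
  \<open>d/dt (1 + t M) F\<close> at \<open>t = 0\<close>) by the matrices stabilizing \<open>F\<close>.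
  The same is done for \<open>X \<times> X\<close> with pairs of matrices.\<close>

definition act :: "nat \<Rightarrow> 'n::finite cmat \<Rightarrow> 'n flag \<Rightarrow> 'n flag" where
  "act k g F = (\<lambda>i\<in>{1..k}. (\<lambda>v. g *v v) ` F i)"

definition act2 :: "nat \<Rightarrow> 'n::finite cmat \<times> 'n cmat \<Rightarrow> 'n flag \<times> 'n flag \<Rightarrow> 'n flag \<times> 'n flag" where
  "act2 k a x = (act k (fst a) (fst x), act k (snd a) (snd x))"

definition GL2 :: "('n::finite cmat \<times> 'n cmat) set" where
  "GL2 = {a. invertible (fst a) \<and> invertible (snd a)}"

abbreviation one2 :: "'n::finite cmat \<times> 'n cmat" where
  "one2 \<equiv> (mat 1, mat 1)"

definition stab2 :: "nat \<Rightarrow> 'n::finite flag \<times> 'n flag \<Rightarrow> ('n cmat \<times> 'n cmat) set" where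
  "stab2 k x = {M. \<forall>i\<in>{1..k}. (\<forall>v\<in>fst x i. fst M *v v \<in> fst x i) \<and> (\<forall>v\<in>snd x i. snd M *v v \<in> snd x i)}"

definition openX :: "nat \<Rightarrow> (nat \<Rightarrow> nat) \<Rightarrow> 'n::finite flag set \<Rightarrow> bool" where
  "openX k d W \<longleftrightarrow> W \<subseteq> flags k d \<and> (\<forall>F\<in>W. open {g. invertible g \<and> act k g F \<in> W})"

definition openXX :: "nat \<Rightarrow> (nat \<Rightarrow> nat) \<Rightarrow> ('n::finite flag \<times> 'n flag) set \<Rightarrow> bool" where
  "openXX k d U \<longleftrightarrow> U \<subseteq> flags k d \<times> flags k d \<and> (\<forall>x\<in>U. open {a \<in> GL2. act2 k a x \<in> U})"

definition smoothXX :: "nat \<Rightarrow> ('n::finite flag \<times> 'n flag) set \<Rightarrow>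
    ('n flag \<times> 'n flag \<Rightarrow> 'b::real_normed_vector) \<Rightarrow> bool" where
  "smoothXX k U f \<longleftrightarrow> (\<forall>x\<in>U. smooth_on {a \<in> GL2. act2 k a x \<in> U} (\<lambda>a. f (act2 k a x)))"

text \<open>\<open>dbarXX k f x M\<close> is \<open>\<partial>bar f\<close> at \<open>x \<in> X \<times> X\<close> evaluated on the class of \<open>M\<close> in the
  tangent space at \<open>x\<close>.\<close>

definition dbarXX :: "nat \<Rightarrow> ('n::finite flag \<times> 'n flag \<Rightarrow> complex^'m) \<Rightarrow> 'n flag \<times> 'n flag \<Rightarrow>
    'n cmat \<times> 'n cmat \<Rightarrow> complex^'m" where
  "dbarXX k f x M = dbar_vec (\<lambda>a. f (act2 k a x)) one2 M"

definition holoXX :: "nat \<Rightarrow> ('n::finite flag \<times> 'n flag) set \<Rightarrow>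
    ('n flag \<times> 'n flag \<Rightarrow> complex^'m) \<Rightarrow> bool" where
  "holoXX k U f \<longleftrightarrow> smoothXX k U f \<and> (\<forall>x\<in>U. \<forall>M. dbarXX k f x M = 0)"

section \<open>Projections and quotient spaces\<close>

text \<open>For complex subspaces the orthogonal complement with respect to the real inner product
  on \<open>\<complex>\<^sup>N\<close> is the Hermitian one.\<close>

definition oproj :: "(complex^'n) set \<Rightarrow> complex^'n \<Rightarrow> complex^'n" where
  "oproj V v = (THE u. u \<in> V \<and> v - u \<in> V\<^sup>\<bottom>)"

text \<open>Elements of \<open>\<complex>\<^sup>N/V\<close> are the cosets.\<close>

definition coset :: "(complex^'n) set \<Rightarrow> complex^'n \<Rightarrow> (complex^'n) set" where
  "coset V v = {v + h | h. h \<in> V}"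

definition phi :: "(complex^'n) set \<Rightarrow> (complex^'n) set \<Rightarrow> complex^'n" where
  "phi V P = (THE u. u \<in> P \<and> u \<in> V\<^sup>\<bottom>)"

text \<open>The map \<open>Q : \<complex>\<^sup>N/V \<rightarrow> \<complex>\<^sup>N/V'\<close> for \<open>V \<subseteq> V'\<close>.\<close>

definition Qmap :: "(complex^'n) set \<Rightarrow> (complex^'n) set \<Rightarrow> (complex^'n) set" where
  "Qmap V' P = {v + h | v h. v \<in> P \<and> h \<in> V'}"

text \<open>\<open>quot_hom U V\<close> is the space of linear maps from \<open>U\<close> to \<open>\<complex>\<^sup>N/V\<close>.\<close>

definition quot_hom :: "(complex^'n) set \<Rightarrow> (complex^'n) set \<Rightarrow> (complex^'n \<Rightarrow> (complex^'n) set) set" where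
  "quot_hom U V = {f \<in> U \<rightarrow>\<^sub>E range (coset V).
     \<forall>a b. \<forall>v\<in>U. \<forall>w\<in>U. \<forall>p\<in>f v. \<forall>q\<in>f w. a *s p + b *s q \<in> f (a *s v + b *s w)}"

section \<open>The bundle \<open>E\<close> and its section \<open>\<eta>\<close>\<close>

type_synonym 'n efib = "nat \<Rightarrow> complex^'n \<Rightarrow> (complex^'n) set"

text \<open>The fibre at \<open>x = (z, \<zeta>)\<close>: families \<open>\<xi> j \<in> Hom(H\<^sub>j(\<zeta>), F\<^sub>j(z))\<close>, \<open>1 \<le> j < k\<close>,
  in the kernel of \<open>\<Phi>\<close>.\<close>

definition E_fib :: "nat \<Rightarrow> 'n::finite flag \<times> 'n flag \<Rightarrow> 'n efib set" where
  "E_fib k x = {\<xi> \<in> (\<Pi>\<^sub>E j\<in>{1..<k}. quot_hom (snd x j) (fst x j)).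
     \<forall>j\<in>{1..<k-1}. \<forall>v\<in>snd x j. \<xi> (Suc j) v = Qmap (fst x (Suc j)) (\<xi> j v)}"

text \<open>The linear combination \<open>a \<xi> + b \<xi>'\<close> in the fibre at \<open>x\<close>; the summand \<open>h\<close> makes the value
  a full coset also if \<open>a = b = 0\<close>.\<close>

definition E_comb :: "nat \<Rightarrow> 'n::finite flag \<times> 'n flag \<Rightarrow> complex \<Rightarrow> 'n efib \<Rightarrow> complex \<Rightarrow> 'n efib \<Rightarrow> 'n efib" where
  "E_comb k x a \<xi> b \<xi>' = (\<lambda>j\<in>{1..<k}. \<lambda>v\<in>snd x j.
     {a *s p + b *s q + h | p q h. p \<in> \<xi> j v \<and> q \<in> \<xi>' j v \<and> h \<in> fst x j})"

definition eta :: "nat \<Rightarrow> 'n::finite flag \<times> 'n flag \<Rightarrow> 'n efib" where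
  "eta k x = (\<lambda>j\<in>{1..<k}. \<lambda>v\<in>snd x j. coset (fst x j) v)"

text \<open>Local smooth and holomorphic sections. The parameter \<open>R\<close> stands for \<open>smoothXX k\<close> or
  \<open>holoXX k\<close>. Sections of the subbundle \<open>H\<^sub>j\<close>, pulled back from the second factor, are sections of the
  trivial bundle with values in \<open>H\<^sub>j\<close>; sections of the quotient bundle \<open>F\<^sub>j\<close>, pulled back from the
  first factor, locally lift to sections of the trivial bundle; sections of \<open>Hom\<close> map sections
  to sections.\<close>

type_synonym 'n regularity = "('n flag \<times> 'n flag) set \<Rightarrow> ('n flag \<times> 'n flag \<Rightarrow> complex^'n) \<Rightarrow> bool"

definition H_sec :: "'n regularity \<Rightarrow> nat \<Rightarrow> ('n flag \<times> 'n flag) set \<Rightarrow>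
    ('n::finite flag \<times> 'n flag \<Rightarrow> complex^'n) \<Rightarrow> bool" where
  "H_sec R j U s \<longleftrightarrow> R U s \<and> (\<forall>x\<in>U. s x \<in> snd x j)"

definition F_sec :: "nat \<Rightarrow> (nat \<Rightarrow> nat) \<Rightarrow> 'n regularity \<Rightarrow> nat \<Rightarrow> ('n flag \<times> 'n flag) set \<Rightarrow>
    ('n::finite flag \<times> 'n flag \<Rightarrow> (complex^'n) set) \<Rightarrow> bool" where
  "F_sec k d R j U t \<longleftrightarrow> (\<forall>x\<in>U. \<exists>U' f. openXX k d U' \<and> x \<in> U' \<and> U' \<subseteq> U \<and> R U' f \<and>
     (\<forall>y\<in>U'. t y = coset (fst y j) (f y)))"

definition E_sec :: "nat \<Rightarrow> (nat \<Rightarrow> nat) \<Rightarrow> 'n regularity \<Rightarrow> ('n flag \<times> 'n flag) set \<Rightarrow>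
    ('n::finite flag \<times> 'n flag \<Rightarrow> 'n efib) \<Rightarrow> bool" where
  "E_sec k d R U \<Xi> \<longleftrightarrow> (\<forall>x\<in>U. \<Xi> x \<in> E_fib k x) \<and>
     (\<forall>j\<in>{1..<k}. \<forall>U' s. openXX k d U' \<and> U' \<subseteq> U \<and> H_sec R j U' s \<longrightarrow>
        F_sec k d R j U' (\<lambda>x. \<Xi> x j (s x)))"

section \<open>Holomorphic vector bundles over the flag manifold\<close>

text \<open>A bundle is given by its fibres, complex subspaces of some \<open>\<complex>\<^sup>m\<close>, and its local holomorphic
  sections over open sets. The inclusion of the fibres in \<open>\<complex>\<^sup>m\<close> need not be holomorphic, so
  smooth sections and their \<open>\<partial>bar\<close> are computed from the holomorphic sections.\<close>

record ('n::finite, 'm::finite) vbundle =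
  fib :: "'n flag \<Rightarrow> (complex^'m) set"
  hol :: "'n flag set \<Rightarrow> ('n flag \<Rightarrow> complex^'m) \<Rightarrow> bool"

definition H_bundle :: "nat \<Rightarrow> (nat \<Rightarrow> nat) \<Rightarrow> nat \<Rightarrow> ('n::finite, 'n) vbundle" where
  "H_bundle k d i = \<lparr>fib = (\<lambda>F. F i),
     hol = (\<lambda>W s. (\<forall>F\<in>W. s F \<in> F i) \<and> holoXX k (flags k d \<times> W) (\<lambda>x. s (snd x)))\<rparr>"

text \<open>Smooth local sections of the pullback of \<open>V\<close> to \<open>X \<times> X\<close> by \<open>pr\<close>, one of the
  two projections.\<close>

definition smooth_sec :: "nat \<Rightarrow> (nat \<Rightarrow> nat) \<Rightarrow> ('n, 'm::finite) vbundle \<Rightarrow> ('n flag \<times> 'n flag \<Rightarrow> 'n flag) \<Rightarrow>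
    ('n::finite flag \<times> 'n flag) set \<Rightarrow> ('n flag \<times> 'n flag \<Rightarrow> complex^'m) \<Rightarrow> bool" where
  "smooth_sec k d V pr U t \<longleftrightarrow> (\<forall>x\<in>U. \<exists>U' W r es fs.
     openXX k d U' \<and> x \<in> U' \<and> U' \<subseteq> U \<and> openX k d W \<and> pr ` U' \<subseteq> W \<and>
     (\<forall>j<r::nat. hol V W (es j) \<and> smoothXX k U' (fs j)) \<and>
     (\<forall>y\<in>U'. t y = (\<Sum>j<r. fs j y *s es j (pr y))))"

text \<open>Let \<open>T\<close> be a smooth section of the pullback of \<open>V\<^sub>z\<close> by the orbit map \<open>a \<mapsto> a x\<close>,
  defined near \<open>a = 1\<close>. Then \<open>\<partial>bar T\<close> at \<open>a = 1\<close> is the sum of \<open>\<partial>bar f\<^sub>j\<close> times \<open>e\<^sub>j\<close>,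
  where \<open>T\<close> is the sum of \<open>f\<^sub>j e\<^sub>j\<close> with \<open>e\<^sub>j\<close> holomorphic and \<open>f\<^sub>j\<close> smooth.\<close>

definition dbar_sec :: "nat \<Rightarrow> (nat \<Rightarrow> nat) \<Rightarrow> ('n, 'm::finite) vbundle \<Rightarrow> 'n flag \<times> 'n flag \<Rightarrow>
    ('n::finite cmat \<times> 'n cmat \<Rightarrow> complex^'m) \<Rightarrow> 'n cmat \<times> 'n cmat \<Rightarrow> complex^'m" where
  "dbar_sec k d V x T M = (THE y. \<exists>S W r es fs.
     open S \<and> one2 \<in> S \<and> S \<subseteq> GL2 \<and> openX k d W \<and> (\<forall>a\<in>S. fst (act2 k a x) \<in> W) \<and>
     (\<forall>j<r::nat. hol V W (es j) \<and> smooth_on S (fs j)) \<and>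
     (\<forall>a\<in>S. T a = (\<Sum>j<r. fs j a *s es j (fst (act2 k a x)))) \<and>
     y = (\<Sum>j<r. dbar (fs j) one2 M *s es j (fst x)))"

section \<open>Sections of \<open>G\<^sub>E\<^sub>,\<^sub>V\<close> and the operator \<open>\<nabla>\<^sub>\<eta>\<close>\<close>

text \<open>The operator \<open>\<nabla>\<^sub>\<eta>\<close> preserves the subalgebra of \<open>G\<^sub>E\<^sub>,\<^sub>V\<close> in which weights live, the direct sum of
  the bundles \<open>Hom(V\<^sub>\<zeta>, V\<^sub>z) \<otimes> (\<Lambda>\<^sup>p E* \<and> T*\<^sub>0\<^sub>,\<^sub>q)\<close> over all \<open>p\<close>, \<open>q\<close>. An element
  of such a bundle at \<open>x\<close> is a map taking \<open>p\<close> vectors of \<open>E\<close>, \<open>q\<close> tangent vectors and an element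
  of \<open>V\<^sub>\<zeta>\<close> to an element of \<open>V\<^sub>z\<close>, alternating and linear in the first, alternating and antilinear
  in the second group; tangent vectors are represented by pairs of matrices.
  The factors from \<open>E*\<close> are written before those from \<open>T*\<close>: the product
  \<open>\<epsilon>\<^sub>1 \<and> \<dots> \<and> \<epsilon>\<^sub>p \<and> \<tau>\<^sub>1 \<and> \<dots> \<and> \<tau>\<^sub>q\<close> is the map \<open>det(\<epsilon>\<^sub>i(\<xi>\<^sub>j)) det(\<tau>\<^sub>i(M\<^sub>j))\<close>.\<close>

type_synonym ('n, 'm) comp =
  "'n flag \<times> 'n flag \<Rightarrow> 'n efib list \<Rightarrow> ('n cmat \<times> 'n cmat) list \<Rightarrow> complex^'m \<Rightarrow> complex^'m"

definition args :: "nat \<Rightarrow> ('n::finite, 'm::finite) vbundle \<Rightarrow> nat \<Rightarrow> nat \<Rightarrow> 'n flag \<times> 'n flag \<Rightarrow>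
    ('n efib list \<times> ('n cmat \<times> 'n cmat) list \<times> (complex^'m)) set" where
  "args k V p q x = {(\<xi>s, Ms, v). length \<xi>s = p \<and> set \<xi>s \<subseteq> E_fib k x \<and> length Ms = q \<and> v \<in> fib V (snd x)}"

definition G_fib :: "nat \<Rightarrow> ('n::finite, 'm::finite) vbundle \<Rightarrow> nat \<Rightarrow> nat \<Rightarrow> 'n flag \<times> 'n flag \<Rightarrow>
    ('n efib list \<Rightarrow> ('n cmat \<times> 'n cmat) list \<Rightarrow> complex^'m \<Rightarrow> complex^'m) set" where
  "G_fib k V p q x = {\<omega>. \<forall>(\<xi>s, Ms, v) \<in> args k V p q x.
     \<omega> \<xi>s Ms v \<in> fib V (fst x) \<and>
     (\<forall>a b. \<forall>w\<in>fib V (snd x). \<omega> \<xi>s Ms (a *s v + b *s w) = a *s \<omega> \<xi>s Ms v + b *s \<omega> \<xi>s Ms w) \<and>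
     (\<forall>j<p. \<forall>a b. \<forall>\<xi>\<in>E_fib k x.
        \<omega> (\<xi>s[j := E_comb k x a (\<xi>s ! j) b \<xi>]) Ms v = a *s \<omega> \<xi>s Ms v + b *s \<omega> (\<xi>s[j := \<xi>]) Ms v) \<and>
     (\<forall>j<p. \<forall>l<p. j \<noteq> l \<and> \<xi>s ! j = \<xi>s ! l \<longrightarrow> \<omega> \<xi>s Ms v = 0) \<and>
     (\<forall>j<q. \<forall>a b M.
        \<omega> \<xi>s (Ms[j := mscale a (Ms ! j) + mscale b M]) v =
          cnj a *s \<omega> \<xi>s Ms v + cnj b *s \<omega> \<xi>s (Ms[j := M]) v) \<and>
     (\<forall>j<q. \<forall>l<q. j \<noteq> l \<and> Ms ! j = Ms ! l \<longrightarrow> \<omega> \<xi>s Ms v = 0) \<and>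
     (\<forall>j<q. Ms ! j \<in> stab2 k x \<longrightarrow> \<omega> \<xi>s Ms v = 0)}"

text \<open>Smoothness is tested on smooth sections of \<open>E\<close> and \<open>V\<^sub>\<zeta>\<close> and on the vector fields
  on \<open>X \<times> X\<close> induced by constant pairs of matrices, which span all tangent spaces.\<close>

definition G_smooth :: "nat \<Rightarrow> (nat \<Rightarrow> nat) \<Rightarrow> ('n::finite, 'm::finite) vbundle \<Rightarrow> nat \<Rightarrow> nat \<Rightarrow> ('n, 'm) comp \<Rightarrow> bool" where
  "G_smooth k d V p q g \<longleftrightarrow> (\<forall>x\<in>flags k d \<times> flags k d. g x \<in> G_fib k V p q x) \<and>
     (\<forall>U \<Xi>s Ms s. openXX k d U \<and> length \<Xi>s = p \<and> (\<forall>\<Xi>\<in>set \<Xi>s. E_sec k d (smoothXX k) U \<Xi>) \<and>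
        length Ms = q \<and> smooth_sec k d V snd U s \<longrightarrow>
        smooth_sec k d V fst U (\<lambda>x. g x (map (\<lambda>\<Xi>. \<Xi> x) \<Xi>s) Ms (s x)))"

definition delta_eta :: "nat \<Rightarrow> ('n::finite, 'm) comp \<Rightarrow> ('n, 'm) comp" where
  "delta_eta k g x \<xi>s Ms v = g x (eta k x # \<xi>s) Ms v"

definition minv2 :: "'n::finite cmat \<times> 'n cmat \<Rightarrow> 'n cmat \<times> 'n cmat" where
  "minv2 a = (matrix_inv (fst a), matrix_inv (snd a))"

definition mmult2 :: "'n::finite cmat \<times> 'n cmat \<Rightarrow> 'n cmat \<times> 'n cmat \<Rightarrow> 'n cmat \<times> 'n cmat" where
  "mmult2 a b = (fst a ** fst b, snd a ** snd b)"

text \<open>The component \<open>(p, q + 1)\<close> of \<open>\<partial>bar g\<close>, for \<open>g\<close> of type \<open>(p, q)\<close>.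
  The vectors \<open>\<xi>s\<close> and \<open>v\<close> are extended to holomorphic sections, and the resulting \<open>V\<^sub>z\<close>-valued
  \<open>(0, q)\<close>-form is pulled back by the orbit map \<open>a \<mapsto> a x\<close>, where \<open>\<partial>bar\<close> is given by the usual
  alternating sum over constant vector fields. The tangent vector \<open>M\<close> at the matrix \<open>a\<close> is mapped by
  the differential of the orbit map to the class of \<open>M a\<^bsup>-1\<^esup>\<close> at \<open>a x\<close>. The sign \<open>(-1)\<^sup>p\<close> comes
  from moving the new form factor past the \<open>p\<close> factors from \<open>E*\<close>.\<close>

definition dbar_G :: "nat \<Rightarrow> (nat \<Rightarrow> nat) \<Rightarrow> ('n::finite, 'm::finite) vbundle \<Rightarrow> nat \<Rightarrow> ('n, 'm) comp \<Rightarrow> ('n, 'm) comp" where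
  "dbar_G k d V p g x \<xi>s Ms v = (THE y. \<exists>U \<Xi>s W s.
     openXX k d U \<and> x \<in> U \<and> (\<forall>\<Xi>\<in>set \<Xi>s. E_sec k d (holoXX k) U \<Xi>) \<and> map (\<lambda>\<Xi>. \<Xi> x) \<Xi>s = \<xi>s \<and>
     openX k d W \<and> snd x \<in> W \<and> hol V W s \<and> s (snd x) = v \<and>
     y = (-1) ^ p *s (\<Sum>m<length Ms. (-1) ^ m *s
       dbar_sec k d V x
         (\<lambda>a. g (act2 k a x) (map (\<lambda>\<Xi>. \<Xi> (act2 k a x)) \<Xi>s)
                (map (\<lambda>M. mmult2 M (minv2 a)) (take m Ms @ drop (Suc m) Ms)) (s (snd (act2 k a x))))
         (Ms ! m)))"

text \<open>\<open>G p q\<close> is the component of type \<open>(p, q)\<close> of a section \<open>G\<close>.\<close>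

definition nabla_eta :: "nat \<Rightarrow> (nat \<Rightarrow> nat) \<Rightarrow> ('n::finite, 'm::finite) vbundle \<Rightarrow>
    (nat \<Rightarrow> nat \<Rightarrow> ('n, 'm) comp) \<Rightarrow> (nat \<Rightarrow> nat \<Rightarrow> ('n, 'm) comp)" where
  "nabla_eta k d V G p q x \<xi>s Ms v = delta_eta k (G (Suc p) q) x \<xi>s Ms v -
     (if q = 0 then 0 else dbar_G k d V p (G p (q - 1)) x \<xi>s Ms v)"

definition is_weight :: "nat \<Rightarrow> (nat \<Rightarrow> nat) \<Rightarrow> ('n::finite, 'm::finite) vbundle \<Rightarrow>
    (nat \<Rightarrow> nat \<Rightarrow> ('n, 'm) comp) \<Rightarrow> bool" where
  "is_weight k d V G \<longleftrightarrow>
     (\<forall>p q. G_smooth k d V p q (G p q)) \<and>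
     (\<forall>p q. p \<noteq> q \<or> flag_dim k d < p \<longrightarrow>
        (\<forall>x\<in>flags k d \<times> flags k d. \<forall>(\<xi>s, Ms, v) \<in> args k V p q x. G p q x \<xi>s Ms v = 0)) \<and>
     (\<forall>p q. \<forall>x\<in>flags k d \<times> flags k d. \<forall>(\<xi>s, Ms, v) \<in> args k V p q x.
        nabla_eta k d V G p q x \<xi>s Ms v = 0) \<and>
     (\<forall>F\<in>flags k d. \<forall>v\<in>fib V F. G 0 0 (F, F) [] [] v = v)"

section \<open>The weight for the tautological bundle\<close>

definition gamma0 :: "nat \<Rightarrow> 'n::finite flag \<times> 'n flag \<Rightarrow> complex^'n \<Rightarrow> complex^'n" where
  "gamma0 i x v = oproj (fst x i) v"

text \<open>The component \<open>\<xi>\<^sub>i\<close> of \<open>\<xi>\<close>, where \<open>\<xi>\<^sub>k = 0\<close>.\<close>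

definition E_component :: "nat \<Rightarrow> nat \<Rightarrow> 'n::finite flag \<times> 'n flag \<Rightarrow> 'n efib \<Rightarrow> complex^'n \<Rightarrow> (complex^'n) set" where
  "E_component k i x \<xi> v = (if i < k then \<xi> i v else coset (fst x i) 0)"

text \<open>The value of the (0,1)-form \<open>\<gamma>\<^sub>1\<^sub>,\<^sub>i(\<xi> \<otimes> v)\<close> at \<open>x\<close> on the tangent vector \<open>M\<close>, computed
  from any smooth sections \<open>\<Xi>\<close>, \<open>s\<close> near \<open>x\<close> extending \<open>\<xi>\<close>, \<open>v\<close>.\<close>

definition gamma1 :: "nat \<Rightarrow> (nat \<Rightarrow> nat) \<Rightarrow> nat \<Rightarrow> 'n::finite flag \<times> 'n flag \<Rightarrow> 'n efib \<Rightarrow>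
    'n cmat \<times> 'n cmat \<Rightarrow> complex^'n \<Rightarrow> complex^'n" where
  "gamma1 k d i x \<xi> M v = (THE y. \<exists>U \<Xi> s.
     openXX k d U \<and> x \<in> U \<and> E_sec k d (smoothXX k) U \<Xi> \<and> \<Xi> x = \<xi> \<and>
     H_sec (smoothXX k) i U s \<and> s x = v \<and>
     y = - oproj (fst x i)
            (dbarXX k (\<lambda>x'. phi (fst x' i) (E_component k i x' (\<Xi> x') (s x'))) x M))"

definition G_section :: "nat \<Rightarrow> (nat \<Rightarrow> nat) \<Rightarrow> nat \<Rightarrow> nat \<Rightarrow> nat \<Rightarrow> ('n::finite, 'n) comp" where
  "G_section k d i p q x \<xi>s Ms v =
     (if p = 0 \<and> q = 0 then gamma0 i x v
      else if p = 1 \<and> q = 1 then gamma1 k d i x (hd \<xi>s) (hd Ms) v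
      else 0)"

end

theory Submission
  imports Defs
begin

text \<open>All computations are done on pairs of invertible matrices, pulled back by the orbit map
  at a point \<open>x\<close>, and \<open>\<partial>bar\<close> is only needed at the pair of identity matrices. If \<open>P\<close> is the orthogonal
  projector onto \<open>V\<close>, the projector \<open>\<pi>\<close> onto \<open>g V\<close> is an explicit smooth function of \<open>g\<close> with
  \<open>\<partial>bar \<pi> (M) = P M* (1 - P)\<close> at \<open>g = 1\<close>. If \<open>w\<close> represents \<open>\<xi>\<^sub>i(v)\<close>, then \<open>\<phi>\<^sub>i(\<xi>\<^sub>i(v)) = w - \<pi> w\<close>, so that
  \<open>\<gamma>\<^sub>1\<^sub>,\<^sub>i(\<xi> \<otimes> v)(M) = P M* (1 - P) w\<close>, which for \<open>\<xi> = \<eta>\<close> and \<open>w = v\<close> is \<open>\<partial>bar \<gamma>\<^sub>0\<^sub>,\<^sub>i (M) v\<close>. Differentiating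
  once more along \<open>M'\<close> gives an expression symmetric in \<open>M\<close> and \<open>M'\<close>, so \<open>\<partial>bar \<gamma>\<^sub>1\<^sub>,\<^sub>i = 0\<close>.\<close>

section \<open>Calculus of smooth functions\<close>

text \<open>\<open>gamma1\<close>, \<open>dbar_sec\<close> and \<open>dbar_G\<close> are definite
  descriptions over all local extensions or all holomorphic expansions, so every value must be shown
  both to be attained and to be independent of the choices. Attained: a family in the kernel of
  \<Phi> is induced by a single matrix \<open>L\<close>, because compatibility allows a lift on one
  step of the flag to be extended to the next; the section of \<open>E\<close> that \<open>L\<close>
  induces is global and holomorphic. Sections of \<open>H\<^sub>i\<close> come from vectors with
  prescribed projection to one fixed space. Independent: \<open>P M* (1 - P)\<close> annihilates
  \<open>V\<close>, so it sees a lift only modulo \<open>V\<close>, and the derivative of the lift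
  cancels under the outer projection. The symmetry of the second derivative rests on the pullback.
  The orbit map at \<open>a\<close> sends the constant field \<open>M'\<close> to the class of
  \<open>M' a\<^sup>-\<^sup>1\<close>, and the derivative of this factor turns
  \<open>P M* (1 - P) M'*\<close> into \<open>- P M* P M'*\<close>, the mirror image of the term
  that comes from the inner projector.\<close>

lemma frechet_derivative_eq_on_open:
  assumes "open S" "x \<in> S" "\<And>y. y \<in> S \<Longrightarrow> f y = g y"
  shows "frechet_derivative f (at x) = frechet_derivative g (at x)"
proof -
  have "(f has_derivative D) (at x) \<longleftrightarrow> (g has_derivative D) (at x)" for D
    using has_derivative_transform_within_open[of f D x UNIV S g]
      has_derivative_transform_within_open[of g D x UNIV S f] assms by auto
  then show ?thesis
    unfolding frechet_derivative_def by simp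
qed

text \<open>\<open>Ck_on\<close> differentiates in the ambient space, not within \<open>S\<close>;
  for open \<open>S\<close> equality on \<open>S\<close> still forces equality of all derivatives
  there, which carries the induction.\<close>

lemma Ck_on_cong:
  assumes "open S" "\<And>x. x \<in> S \<Longrightarrow> f x = g x" "Ck_on m S f"
  shows "Ck_on m S g"
  using assms(2,3)
proof (induction m arbitrary: f g)
  case 0
  then show ?case by (simp cong: continuous_on_cong)
next
  case (Suc m)
  have "g differentiable (at x)" if "x \<in> S" for x
  proof -
    have "f differentiable (at x)" using Suc.prems(2) that by simp
    then obtain D where "(f has_derivative D) (at x)" by (auto simp: differentiable_def)
    then have "(g has_derivative D) (at x)"
      using has_derivative_transform_within_open[of f D x UNIV S g] assms(1) that Suc.prems(1) by auto
    then show ?thesis by (auto simp: differentiable_def)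
  qed
  moreover have "Ck_on m S (\<lambda>x. frechet_derivative g (at x) v)" for v
  proof (rule Suc.IH)
    show "Ck_on m S (\<lambda>x. frechet_derivative f (at x) v)" using Suc.prems(2) by simp
    show "frechet_derivative f (at x) v = frechet_derivative g (at x) v" if "x \<in> S" for x
      using frechet_derivative_eq_on_open[OF assms(1) that, of f g] Suc.prems(1) by simp
  qed
  ultimately show ?case by simp
qed

text \<open>Uniqueness of derivatives replaces the \<open>frechet_derivative\<close> of the
  definition by any explicit derivative. The rules for sums, products, inverses and linear
  substitutions are inductions on the order with this as their step.\<close>

lemma Ck_on_SucI:
  assumes "open S" "\<And>x. x \<in> S \<Longrightarrow> (f has_derivative f' x) (at x)" "\<And>v. Ck_on m S (\<lambda>x. f' x v)"
  shows "Ck_on (Suc m) S f"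
proof -
  have "Ck_on m S (\<lambda>x. frechet_derivative f (at x) v)" for v
    by (rule Ck_on_cong[OF assms(1) _ assms(3)[of v]]) (use frechet_derivative_at[OF assms(2)] in auto)
  then show ?thesis using assms(2) by (auto simp: differentiable_def)
qed

lemma Ck_on_SucD:
  assumes "Ck_on (Suc m) S f" "x \<in> S"
  shows "(f has_derivative frechet_derivative f (at x)) (at x)"
  using assms frechet_derivative_works by auto

text \<open>The product rule leaves one factor undifferentiated, so its induction step needs a
  factor of order \<open>Suc m\<close> also at order \<open>m\<close>.\<close>

lemma Ck_on_Suc_imp: "Ck_on (Suc m) S f \<Longrightarrow> Ck_on m S f"
proof (induction m arbitrary: f)
  case 0
  then show ?case
    by (auto intro!: continuous_at_imp_continuous_on differentiable_imp_continuous_within)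
next
  case (Suc m)
  from Suc.prems have "\<forall>x\<in>S. f differentiable (at x)"
    and "\<And>v. Ck_on (Suc m) S (\<lambda>x. frechet_derivative f (at x) v)" by simp_all
  then show ?case using Suc.IH by simp
qed

lemma Ck_on_subset: "Ck_on m S f \<Longrightarrow> T \<subseteq> S \<Longrightarrow> Ck_on m T f"
  by (induction m arbitrary: f) (auto intro: continuous_on_subset)

lemma Ck_on_const: "open S \<Longrightarrow> Ck_on m S (\<lambda>x. c)"
proof (induction m arbitrary: c)
  case (Suc m)
  show ?case by (rule Ck_on_SucI[where f' = "\<lambda>_ _. 0"]) (use Suc in auto)
qed simp

lemma Ck_on_add:
  assumes "open S"
  shows "Ck_on m S f \<Longrightarrow> Ck_on m S g \<Longrightarrow> Ck_on m S (\<lambda>x. f x + g x)"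
proof (induction m arbitrary: f g)
  case 0
  then show ?case by (simp add: continuous_on_add)
next
  case (Suc m)
  show ?case
    by (rule Ck_on_SucI[OF assms has_derivative_add[OF Ck_on_SucD[OF Suc.prems(1)] Ck_on_SucD[OF Suc.prems(2)]]])
       (use Suc in auto)
qed

lemma Ck_on_bounded_linear:
  assumes "open S" "bounded_linear L"
  shows "Ck_on m S f \<Longrightarrow> Ck_on m S (\<lambda>x. L (f x))"
proof (induction m arbitrary: f)
  case 0
  then show ?case by (simp add: bounded_linear.continuous_on[OF assms(2)])
next
  case (Suc m)
  show ?case
    by (rule Ck_on_SucI[OF assms(1) bounded_linear.has_derivative[OF assms(2) Ck_on_SucD[OF Suc.prems]]])
       (use Suc in auto)
qed

lemma Ck_on_bounded_bilinear:
  assumes "open S" "bounded_bilinear b"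
  shows "Ck_on m S f \<Longrightarrow> Ck_on m S g \<Longrightarrow> Ck_on m S (\<lambda>x. b (f x) (g x))"
proof (induction m arbitrary: f g)
  case 0
  then show ?case by (simp add: bounded_bilinear.continuous_on[OF assms(2)])
next
  case (Suc m)
  show ?case
  proof (rule Ck_on_SucI[OF assms(1) bounded_bilinear.FDERIV[OF assms(2)
        Ck_on_SucD[OF Suc.prems(1)] Ck_on_SucD[OF Suc.prems(2)]]])
    fix v
    show "Ck_on m S (\<lambda>x. b (f x) (frechet_derivative g (at x) v) + b (frechet_derivative f (at x) v) (g x))"
      by (rule Ck_on_add[OF assms(1)]; rule Suc.IH) (use Suc.prems Ck_on_Suc_imp in auto)
  qed
qed

lemma Ck_on_inverse:
  fixes f :: "_ \<Rightarrow> 'b::real_normed_field"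
  assumes "open S" "\<And>x. x \<in> S \<Longrightarrow> f x \<noteq> 0"
  shows "Ck_on m S f \<Longrightarrow> Ck_on m S (\<lambda>x. inverse (f x))"
proof (induction m)
  case 0
  then show ?case using assms(2) by (auto intro: continuous_on_inverse)
next
  case (Suc m)
  note bm = Ck_on_bounded_bilinear[OF assms(1) bounded_bilinear_mult]
  show ?case
  proof (rule Ck_on_SucI[OF assms(1)])
    fix x assume "x \<in> S"
    \<comment> \<open>The sign is written as the factor \<open>- 1\<close>, so that the derivative
      is built from products and constants only.\<close>
    show "((\<lambda>x. inverse (f x)) has_derivative
        (\<lambda>v. - 1 * (inverse (f x) * (frechet_derivative f (at x) v * inverse (f x))))) (at x)"
      using Deriv.has_derivative_inverse[OF assms(2)[OF \<open>x \<in> S\<close>] Ck_on_SucD[OF Suc.prems \<open>x \<in> S\<close>]]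
      by (simp add: mult.assoc)
  next
    fix v
    show "Ck_on m S (\<lambda>x. - 1 * (inverse (f x) * (frechet_derivative f (at x) v * inverse (f x))))"
      by (intro bm Ck_on_const assms(1) Suc.IH Ck_on_Suc_imp[OF Suc.prems]) (use Suc.prems in simp)
  qed
qed

text \<open>The linear map used later is the exchange of the two matrices of a pair. Being its own
  derivative, it keeps the chain rule within one induction, whose hypothesis is applied to a
  directional derivative of \<open>f\<close>.\<close>

lemma Ck_on_precompose_linear:
  assumes "open T" "bounded_linear L" "L ` T \<subseteq> S"
  shows "Ck_on m S f \<Longrightarrow> Ck_on m T (\<lambda>x. f (L x))"
proof (induction m arbitrary: f)
  case 0
  show ?case
    using continuous_on_compose2[of S f T L] 0 assms linear_continuous_on[OF assms(2)] by auto
next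
  case (Suc m)
  have L: "(L has_derivative L) (at x)" for x
    using assms(2) by (rule bounded_linear_imp_has_derivative)
  show ?case
  proof (rule Ck_on_SucI[OF assms(1) has_derivative_compose[OF L Ck_on_SucD[OF Suc.prems]]])
    show "L x \<in> S" if "x \<in> T" for x using that assms(3) by auto
    show "Ck_on m T (\<lambda>x. frechet_derivative f (at (L x)) (L v))" for v
      by (rule Suc.IH[of "\<lambda>y. frechet_derivative f (at y) (L v)"]) (use Suc.prems in simp)
  qed
qed

lemma smooth_on_cong:
  "open S \<Longrightarrow> smooth_on S f \<Longrightarrow> (\<And>x. x \<in> S \<Longrightarrow> f x = g x) \<Longrightarrow> smooth_on S g"
  unfolding smooth_on_def using Ck_on_cong by metis

lemma smooth_on_subset: "smooth_on S f \<Longrightarrow> T \<subseteq> S \<Longrightarrow> smooth_on T f"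
  unfolding smooth_on_def using Ck_on_subset by blast

lemma smooth_on_imp_differentiable: "smooth_on S f \<Longrightarrow> x \<in> S \<Longrightarrow> f differentiable (at x)"
  unfolding smooth_on_def by (metis Ck_on.simps(2))

lemma smooth_on_imp_continuous_on: "smooth_on S f \<Longrightarrow> continuous_on S f"
  unfolding smooth_on_def by (metis Ck_on.simps(1))

lemma smooth_on_const: "open S \<Longrightarrow> smooth_on S (\<lambda>x. c)"
  unfolding smooth_on_def by (simp add: Ck_on_const)

lemma smooth_on_add:
  "open S \<Longrightarrow> smooth_on S f \<Longrightarrow> smooth_on S g \<Longrightarrow> smooth_on S (\<lambda>x. f x + g x)"
  unfolding smooth_on_def by (simp add: Ck_on_add)

lemma smooth_on_bounded_linear:
  "open S \<Longrightarrow> bounded_linear L \<Longrightarrow> smooth_on S f \<Longrightarrow> smooth_on S (\<lambda>x. L (f x))"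
  unfolding smooth_on_def by (simp add: Ck_on_bounded_linear)

lemma smooth_on_linear:
  assumes "open S" "bounded_linear L"
  shows "smooth_on S L"
  unfolding smooth_on_def
proof
  fix m
  show "Ck_on m S L"
  proof (cases m)
    case 0
    then show ?thesis using linear_continuous_on[OF assms(2)] by simp
  next
    case (Suc m')
    show ?thesis unfolding Suc
      by (rule Ck_on_SucI[OF assms(1) bounded_linear_imp_has_derivative[OF assms(2)]])
         (rule Ck_on_const[OF assms(1)])
  qed
qed

lemma smooth_on_uminus: "open S \<Longrightarrow> smooth_on S f \<Longrightarrow> smooth_on S (\<lambda>x. - f x)"
  using smooth_on_bounded_linear bounded_linear_minus[OF bounded_linear_ident] by blast

lemma smooth_on_diff:
  "open S \<Longrightarrow> smooth_on S f \<Longrightarrow> smooth_on S g \<Longrightarrow> smooth_on S (\<lambda>x. f x - g x)"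
  using smooth_on_add[OF _ _ smooth_on_uminus] by fastforce

lemma smooth_on_mult:
  fixes f :: "_ \<Rightarrow> 'b::real_normed_algebra"
  shows "open S \<Longrightarrow> smooth_on S f \<Longrightarrow> smooth_on S g \<Longrightarrow> smooth_on S (\<lambda>x. f x * g x)"
  unfolding smooth_on_def using Ck_on_bounded_bilinear[OF _ bounded_bilinear_mult] by blast

lemma smooth_on_inverse:
  fixes f :: "_ \<Rightarrow> 'b::real_normed_field"
  shows "open S \<Longrightarrow> smooth_on S f \<Longrightarrow> (\<And>x. x \<in> S \<Longrightarrow> f x \<noteq> 0) \<Longrightarrow> smooth_on S (\<lambda>x. inverse (f x))"
  unfolding smooth_on_def using Ck_on_inverse by blast

lemma smooth_on_sum:
  "open S \<Longrightarrow> (\<And>j. j \<in> I \<Longrightarrow> smooth_on S (f j)) \<Longrightarrow> smooth_on S (\<lambda>x. \<Sum>j\<in>I. f j x)"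
  by (induction I rule: infinite_finite_induct) (simp_all add: smooth_on_const smooth_on_add)

lemma smooth_on_prod:
  fixes f :: "_ \<Rightarrow> _ \<Rightarrow> 'b::real_normed_field"
  shows "open S \<Longrightarrow> (\<And>j. j \<in> I \<Longrightarrow> smooth_on S (f j)) \<Longrightarrow> smooth_on S (\<lambda>x. \<Prod>j\<in>I. f j x)"
  by (induction I rule: infinite_finite_induct) (simp_all add: smooth_on_const smooth_on_mult)

lemma smooth_on_precompose_linear:
  "open T \<Longrightarrow> bounded_linear L \<Longrightarrow> L ` T \<subseteq> S \<Longrightarrow> smooth_on S f \<Longrightarrow> smooth_on T (\<lambda>x. f (L x))"
  unfolding smooth_on_def using Ck_on_precompose_linear by blast

lemma smooth_on_vec_nth: "open S \<Longrightarrow> smooth_on S f \<Longrightarrow> smooth_on S (\<lambda>x. f x $ r)"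
  by (rule smooth_on_bounded_linear[OF _ bounded_linear_vec_nth])

text \<open>A vector is the sum of its coordinates placed on the axes, and \<open>axis r\<close> is
  bounded linear for entries in any normed space. This generality lets the rule be applied twice, to
  matrices as vectors of rows.\<close>

lemma smooth_on_vecI:
  fixes f :: "_ \<Rightarrow> 'b::real_normed_vector^'m"
  assumes "open S" "\<And>r. smooth_on S (\<lambda>x. f x $ r)"
  shows "smooth_on S f"
proof (rule smooth_on_cong[OF assms(1)])
  have "bounded_linear (axis r :: 'b \<Rightarrow> 'b^'m)" for r
  proof (rule bounded_linear_intro[where K = 1])
    have "norm (axis r x :: 'b^'m) \<le> (\<Sum>i\<in>UNIV. norm ((axis r x :: 'b^'m) $ i))" for x
      unfolding norm_vec_def by (rule L2_set_le_sum) simp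
    moreover have "(\<Sum>i\<in>UNIV. norm ((axis r x :: 'b^'m) $ i)) = norm x" for x
      by (simp add: axis_def if_distrib[of norm] cong: if_cong)
    ultimately show "norm (axis r x :: 'b^'m) \<le> norm x * 1" for x by simp
  qed (auto simp: axis_def vec_eq_iff)
  then show "smooth_on S (\<lambda>x. \<Sum>r\<in>UNIV. axis r (f x $ r))"
    by (intro smooth_on_sum assms(1) smooth_on_bounded_linear[OF assms(1) _ assms(2)])
  show "(\<Sum>r\<in>UNIV. axis r (f x $ r)) = f x" for x
    by (simp add: vec_eq_iff axis_def if_distrib[of "\<lambda>u. u $ _"] cong: if_cong)
qed

lemma smooth_on_matrix_mult:
  fixes f :: "_ \<Rightarrow> complex^'m^'l"
  assumes "open S" "smooth_on S f" "smooth_on S g"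
  shows "smooth_on S (\<lambda>x. f x ** g x)"
  unfolding matrix_matrix_mult_def
  by (intro smooth_on_vecI assms(1)) (simp add: smooth_on_sum smooth_on_mult smooth_on_vec_nth assms)

lemma smooth_on_matrix_vector_mult:
  fixes f :: "_ \<Rightarrow> complex^'m^'l"
  assumes "open S" "smooth_on S f" "smooth_on S g"
  shows "smooth_on S (\<lambda>x. f x *v g x)"
  unfolding matrix_vector_mult_def
  by (intro smooth_on_vecI assms(1)) (simp add: smooth_on_sum smooth_on_mult smooth_on_vec_nth assms)

lemma smooth_on_vector_smult:
  fixes f :: "_ \<Rightarrow> complex"
  assumes "open S" "smooth_on S f" "smooth_on S g"
  shows "smooth_on S (\<lambda>x. f x *s g x)"
  unfolding vector_scalar_mult_def
  by (intro smooth_on_vecI assms(1)) (simp add: smooth_on_mult smooth_on_vec_nth assms)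

lemma smooth_on_det:
  fixes f :: "_ \<Rightarrow> complex^'m^'m"
  assumes "open S" "smooth_on S f"
  shows "smooth_on S (\<lambda>x. det (f x))"
  unfolding det_def
  by (intro smooth_on_sum smooth_on_mult smooth_on_prod smooth_on_const smooth_on_vec_nth assms)

section \<open>Inverse matrices as smooth functions of their entries\<close>

lemma matrix_inv_works:
  assumes "invertible A"
  shows "A ** matrix_inv A = mat 1" "matrix_inv A ** A = mat 1"
  using someI_ex[OF assms[unfolded invertible_def]] unfolding matrix_inv_def by auto

text \<open>Cramer's rule for the columns of the identity presents each entry of the inverse as a
  polynomial in the entries divided by the determinant; smoothness of the inverse is read off from
  this.\<close>

lemma matrix_inv_cramer:
  fixes A :: "complex^'m^'m"
  assumes "invertible A"
  shows "matrix_inv A $ r $ s = det (\<chi> i j. if j = r then axis s 1 $ i else A $ i $ j) * inverse (det A)"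
proof -
  have "A *v (matrix_inv A *v axis s 1) = axis s 1"
    by (simp add: matrix_vector_mul_assoc matrix_inv_works[OF assms])
  then have "matrix_inv A *v axis s 1 =
      (\<chi> k. det (\<chi> i j. if j = k then axis s 1 $ i else A $ i $ j) / det A)"
    using cramer assms invertible_det_nz by blast
  moreover have "(matrix_inv A *v axis s 1) $ r = matrix_inv A $ r $ s"
    by (simp add: matrix_vector_mult_def axis_def if_distrib cong: if_cong)
  ultimately show ?thesis by (simp add: divide_inverse)
qed

lemma smooth_on_matrix_inv:
  fixes f :: "_ \<Rightarrow> complex^'m^'m"
  assumes "open S" "smooth_on S f" "\<And>x. x \<in> S \<Longrightarrow> invertible (f x)"
  shows "smooth_on S (\<lambda>x. matrix_inv (f x))"
proof (intro smooth_on_vecI assms(1))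
  fix r s
  have "smooth_on S (\<lambda>x. (\<chi> i j. if j = r then axis s 1 $ i else f x $ i $ j) :: complex^'m^'m)"
  proof (intro smooth_on_vecI assms(1))
    fix i j
    show "smooth_on S (\<lambda>x. (\<chi> i j. if j = r then axis s 1 $ i else f x $ i $ j) $ i $ j)"
      by (cases "j = r") (simp_all add: smooth_on_const smooth_on_vec_nth assms)
  qed
  then have "smooth_on S (\<lambda>x. det (\<chi> i j. if j = r then axis s 1 $ i else f x $ i $ j) * inverse (det (f x)))"
    using assms by (intro smooth_on_mult smooth_on_inverse smooth_on_det) (auto simp: invertible_det_nz)
  then show "smooth_on S (\<lambda>x. matrix_inv (f x) $ r $ s)"
    by (rule smooth_on_cong[OF assms(1)]) (simp add: matrix_inv_cramer assms(3))
qed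

lemma open_invertible:
  fixes f :: "_ \<Rightarrow> complex^'m^'m"
  assumes "open S" "smooth_on S f"
  shows "open {x \<in> S. invertible (f x)}"
proof -
  have "continuous_on S (\<lambda>x. det (f x))"
    using smooth_on_imp_continuous_on smooth_on_det assms by blast
  then have "open (S \<inter> (\<lambda>x. det (f x)) -` (- {0}))"
    using assms(1) by (intro continuous_open_preimage) auto
  moreover have "S \<inter> (\<lambda>x. det (f x)) -` (- {0}) = {x \<in> S. invertible (f x)}"
    by (auto simp: invertible_det_nz)
  ultimately show ?thesis by simp
qed

lemma matrix_sub_ldistrib:
  fixes A :: "'a::ring_1^'n^'m"
  shows "A ** (B - C) = A ** B - A ** C"
  by (vector matrix_matrix_mult_def sum_subtractf right_diff_distrib)

lemma matrix_sub_rdistrib: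
  fixes A :: "'a::ring_1^'n^'m"
  shows "(A - B) ** C = A ** C - B ** C"
  by (vector matrix_matrix_mult_def sum_subtractf left_diff_distrib)

lemma matrix_add_rdistrib:
  fixes A :: "'a::ring_1^'n^'m"
  shows "(A + B) ** C = A ** C + B ** C"
  by (vector matrix_matrix_mult_def sum.distrib distrib_right)

lemma matrix_minus_left:
  fixes A :: "'a::ring_1^'n^'m"
  shows "(- A) ** C = - (A ** C)"
  by (vector matrix_matrix_mult_def sum_negf)

lemma matrix_minus_right:
  fixes A :: "'a::ring_1^'n^'m"
  shows "A ** (- C) = - (A ** C)"
  by (vector matrix_matrix_mult_def sum_negf)

lemma matrix_vector_minus_left:
  fixes A :: "'a::ring_1^'n^'m"
  shows "(- A) *v v = - (A *v v)"
  by (vector matrix_vector_mult_def sum_negf)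

section \<open>Calculus of the Cauchy--Riemann operator\<close>

lemma dbar_eq:
  assumes "(f has_derivative D) (at a)"
  shows "dbar f a M = (D M + \<i> * D (mscale \<i> M)) / 2"
  unfolding dbar_def using frechet_derivative_at[OF assms] by simp

lemma dbar_cong:
  assumes "open S" "a \<in> S" "\<And>b. b \<in> S \<Longrightarrow> f b = g b"
  shows "dbar f a M = dbar g a M"
  unfolding dbar_def using frechet_derivative_eq_on_open[OF assms] by simp

lemma dbar_const [simp]: "dbar (\<lambda>b. c) a M = 0"
  by (simp add: dbar_eq[OF has_derivative_const])

lemma dbar_add:
  assumes "f differentiable (at a)" "g differentiable (at a)"
  shows "dbar (\<lambda>b. f b + g b) a M = dbar f a M + dbar g a M"
proof -
  obtain f' g' where "(f has_derivative f') (at a)" "(g has_derivative g') (at a)"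
    using assms unfolding differentiable_def by blast
  then show ?thesis
    by (simp add: dbar_eq[OF has_derivative_add] dbar_eq field_simps)
qed

lemma dbar_diff:
  assumes "f differentiable (at a)" "g differentiable (at a)"
  shows "dbar (\<lambda>b. f b - g b) a M = dbar f a M - dbar g a M"
proof -
  obtain f' g' where "(f has_derivative f') (at a)" "(g has_derivative g') (at a)"
    using assms unfolding differentiable_def by blast
  then show ?thesis
    by (simp add: dbar_eq[OF has_derivative_diff] dbar_eq field_simps)
qed

lemma dbar_mult:
  assumes "f differentiable (at a)" "g differentiable (at a)"
  shows "dbar (\<lambda>b. f b * g b) a M = dbar f a M * g a + f a * dbar g a M"
proof -
  obtain f' g' where "(f has_derivative f') (at a)" "(g has_derivative g') (at a)"
    using assms unfolding differentiable_def by blast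
  then show ?thesis
    by (simp add: dbar_eq[OF has_derivative_mult] dbar_eq field_simps)
qed

lemma dbar_sum:
  assumes "\<And>j. j \<in> I \<Longrightarrow> f j differentiable (at a)"
  shows "dbar (\<lambda>b. \<Sum>j\<in>I. f j b) a M = (\<Sum>j\<in>I. dbar (f j) a M)"
  using assms
proof (induction I rule: infinite_finite_induct)
  case (insert j I)
  then show ?case using dbar_add[of "f j" a "\<lambda>b. \<Sum>j\<in>I. f j b"] differentiable_sum[of I f] by simp
qed simp_all

lemma dbar_linear:
  assumes "bounded_linear L"
  shows "dbar L a M = (L M + \<i> * L (mscale \<i> M)) / 2"
  by (rule dbar_eq[OF bounded_linear_imp_has_derivative[OF assms]])

definition dbar_mat :: "('n::finite cmat \<times> 'n cmat \<Rightarrow> complex^'m^'l) \<Rightarrow> 'n cmat \<times> 'n cmat \<Rightarrow>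
    'n cmat \<times> 'n cmat \<Rightarrow> complex^'m^'l" where
  "dbar_mat f a M = (\<chi> r. dbar_vec (\<lambda>b. f b $ r) a M)"

lemma dbar_vec_nth [simp]: "dbar_vec f a M $ r = dbar (\<lambda>b. f b $ r) a M"
  by (simp add: dbar_vec_def)

lemma dbar_mat_nth [simp]: "dbar_mat f a M $ r $ s = dbar (\<lambda>b. f b $ r $ s) a M"
  by (simp add: dbar_mat_def)

lemma differentiable_vec_nth:
  "f differentiable F \<Longrightarrow> (\<lambda>x. f x $ r) differentiable F"
  unfolding differentiable_def using bounded_linear.has_derivative[OF bounded_linear_vec_nth] by blast

lemma dbar_vec_cong:
  assumes "open S" "a \<in> S" "\<And>b. b \<in> S \<Longrightarrow> f b = g b"
  shows "dbar_vec f a M = dbar_vec g a M"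
proof -
  have "dbar (\<lambda>b. f b $ r) a M = dbar (\<lambda>b. g b $ r) a M" for r
    by (rule dbar_cong[OF assms(1,2)]) (simp add: assms(3))
  then show ?thesis by (simp add: vec_eq_iff)
qed

lemma dbar_mat_cong:
  assumes "open S" "a \<in> S" "\<And>b. b \<in> S \<Longrightarrow> f b = g b"
  shows "dbar_mat f a M = dbar_mat g a M"
proof -
  have "dbar (\<lambda>b. f b $ r $ s) a M = dbar (\<lambda>b. g b $ r $ s) a M" for r s
    by (rule dbar_cong[OF assms(1,2)]) (simp add: assms(3))
  then show ?thesis by (simp add: vec_eq_iff)
qed

lemma dbar_vec_const [simp]: "dbar_vec (\<lambda>b. c) a M = 0"
  by (simp add: vec_eq_iff)

lemma dbar_mat_const [simp]: "dbar_mat (\<lambda>b. c) a M = 0"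
  by (simp add: vec_eq_iff)

lemma dbar_vec_diff:
  assumes "f differentiable (at a)" "g differentiable (at a)"
  shows "dbar_vec (\<lambda>b. f b - g b) a M = dbar_vec f a M - dbar_vec g a M"
  by (simp add: vec_eq_iff dbar_diff differentiable_vec_nth assms)

lemma dbar_vec_sum:
  assumes "\<And>j. j \<in> I \<Longrightarrow> f j differentiable (at a)"
  shows "dbar_vec (\<lambda>b. \<Sum>j\<in>I. f j b) a M = (\<Sum>j\<in>I. dbar_vec (f j) a M)"
  by (simp add: vec_eq_iff dbar_sum differentiable_vec_nth assms)

lemma dbar_mat_add:
  assumes "f differentiable (at a)" "g differentiable (at a)"
  shows "dbar_mat (\<lambda>b. f b + g b) a M = dbar_mat f a M + dbar_mat g a M"
  by (simp add: vec_eq_iff dbar_add differentiable_vec_nth assms)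

lemma dbar_vec_smult:
  assumes "f differentiable (at a)" "g differentiable (at a)"
  shows "dbar_vec (\<lambda>b. f b *s g b) a M = dbar f a M *s g a + f a *s dbar_vec g a M"
  by (simp add: vec_eq_iff dbar_mult differentiable_vec_nth assms)

lemma dbar_vec_matrix_mult:
  assumes "f differentiable (at a)" "g differentiable (at a)"
  shows "dbar_vec (\<lambda>b. f b *v g b) a M = dbar_mat f a M *v g a + f a *v dbar_vec g a M"
proof -
  have "(\<lambda>b. f b $ r $ s * g b $ s) differentiable (at a)" for r s
    by (intro differentiable_mult differentiable_vec_nth assms)
  then show ?thesis
    by (simp add: vec_eq_iff matrix_vector_mult_def dbar_sum dbar_mult differentiable_vec_nth assms
        sum.distrib)
qed

lemma dbar_mat_mult:
  assumes "f differentiable (at a)" "g differentiable (at a)"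
  shows "dbar_mat (\<lambda>b. f b ** g b) a M = dbar_mat f a M ** g a + f a ** dbar_mat g a M"
proof -
  have "(\<lambda>b. f b $ r $ s * g b $ s $ t) differentiable (at a)" for r s t
    by (intro differentiable_mult differentiable_vec_nth assms)
  then show ?thesis
    by (simp add: vec_eq_iff matrix_matrix_mult_def dbar_sum dbar_mult differentiable_vec_nth assms
        sum.distrib)
qed

text \<open>Apply the product rule to \<open>A b ** B b = mat 1\<close> and multiply by
  \<open>B a\<close> from the left; for square matrices a right inverse is also a left
  inverse.\<close>

lemma dbar_mat_inverse:
  fixes A B :: "_ \<Rightarrow> complex^'m^'m"
  assumes "open S" "a \<in> S" "\<And>b. b \<in> S \<Longrightarrow> A b ** B b = mat 1"
    and "A differentiable (at a)" "B differentiable (at a)"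
  shows "dbar_mat B a M = - (B a ** dbar_mat A a M ** B a)"
proof -
  have BA: "B a ** A a = mat 1"
    using assms(2,3) matrix_left_right_inverse by blast
  have "dbar_mat (\<lambda>b. A b ** B b) a M = 0"
    by (subst dbar_mat_cong[OF assms(1,2), of _ "\<lambda>b. mat 1"]) (use assms(3) in auto)
  then have "B a ** (dbar_mat A a M ** B a + A a ** dbar_mat B a M) = 0"
    by (simp add: dbar_mat_mult[OF assms(4,5)])
  then have "B a ** dbar_mat A a M ** B a + dbar_mat B a M = 0"
    by (simp add: matrix_add_ldistrib matrix_mul_assoc BA)
  then show ?thesis by (simp add: eq_neg_iff_add_eq_0 add.commute)
qed

section \<open>Conjugate transposes\<close>

definition cadj :: "complex^'n^'m \<Rightarrow> complex^'m^'n" where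
  "cadj A = (\<chi> r s. cnj (A $ s $ r))"

lemma cadj_nth [simp]: "cadj A $ r $ s = cnj (A $ s $ r)"
  by (simp add: cadj_def)

lemma cadj_mult: "cadj (A ** B) = cadj B ** cadj A"
  by (simp add: vec_eq_iff matrix_matrix_mult_def mult.commute)

lemma cadj_mat_1 [simp]: "cadj (mat 1) = mat 1"
  by (auto simp: vec_eq_iff mat_def)

lemma bounded_linear_cadj: "bounded_linear (cadj :: complex^'n^'m \<Rightarrow> complex^'m^'n)"
  unfolding linear_conv_bounded_linear[symmetric]
  by (rule linearI) (simp_all add: vec_eq_iff)

text \<open>The real inner product is the real part of the Hermitian one, so the conjugate transpose
  is the adjoint for it as well.\<close>

lemma inner_cadj: "(A *v u) \<bullet> w = u \<bullet> (cadj A *v w)"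
proof -
  have *: "x \<bullet> y = Re (\<Sum>r\<in>UNIV. x $ r * cnj (y $ r))" for x y :: "complex^'k"
    by (simp add: inner_vec_def inner_complex_def)
  show ?thesis
  proof -
    have "(\<Sum>r\<in>UNIV. \<Sum>s\<in>UNIV. A $ r $ s * u $ s * cnj (w $ r)) =
        (\<Sum>s\<in>UNIV. \<Sum>r\<in>UNIV. A $ r $ s * u $ s * cnj (w $ r))"
      by (rule sum.swap)
    then show ?thesis
      unfolding * matrix_vector_mult_def
      by (simp add: sum_distrib_left sum_distrib_right mult.commute mult.left_commute del: Re_sum)
  qed
qed

lemma mscale_nth [simp]:
  "fst (mscale c M) $ r $ s = c * fst M $ r $ s" "snd (mscale c M) $ r $ s = c * snd M $ r $ s"
  by (simp_all add: mscale_def)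

text \<open>The entries of either matrix are complex linear coordinates, so their antilinear part
  vanishes. In the next lemma the conjugated entries are antilinear and \<open>\<partial>bar\<close>
  reproduces them; the nonzero \<open>\<partial>bar\<close> of the projectors comes from
  there.\<close>

lemma
  fixes a :: "'n::finite cmat \<times> 'n cmat"
  shows dbar_mat_fst [simp]: "dbar_mat fst a M = 0"
    and dbar_mat_snd [simp]: "dbar_mat snd a M = 0"
proof -
  have "bounded_linear (\<lambda>b :: 'n cmat \<times> 'n cmat. fst b $ r $ s)"
    "bounded_linear (\<lambda>b :: 'n cmat \<times> 'n cmat. snd b $ r $ s)" for r s
    by (intro bounded_linear_vec_nth[THEN bounded_linear_compose] bounded_linear_fst bounded_linear_snd)+
  then show "dbar_mat fst a M = 0" "dbar_mat snd a M = 0"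
    by (simp_all add: vec_eq_iff dbar_linear)
qed

lemma dbar_mat_cadj_fst:
  fixes a :: "'n::finite cmat \<times> 'n cmat"
  shows "dbar_mat (\<lambda>b. cadj (fst b)) a M = cadj (fst M)"
proof -
  have "bounded_linear (\<lambda>b :: 'n cmat \<times> 'n cmat. cnj (fst b $ r $ s))" for r s
    by (intro bounded_linear_cnj[THEN bounded_linear_compose] bounded_linear_vec_nth[THEN bounded_linear_compose]
        bounded_linear_fst)
  then show ?thesis
    by (simp add: vec_eq_iff dbar_linear)
qed

text \<open>The exchange of the two factors is complex linear. This transports holomorphy, which
  \<open>H_bundle\<close> tests on the second factor, to the first.\<close>

lemma dbar_swap:
  assumes "h differentiable (at (prod.swap a))"
  shows "dbar (\<lambda>b. h (prod.swap b)) a M = dbar h (prod.swap a) (prod.swap M)"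
proof -
  have bl: "bounded_linear (prod.swap :: 'n::finite cmat \<times> 'n cmat \<Rightarrow> _)"
    unfolding prod.swap_def by (intro bounded_linear_Pair bounded_linear_fst bounded_linear_snd)
  obtain D where D: "(h has_derivative D) (at (prod.swap a))"
    using assms by (auto simp: differentiable_def)
  have "((\<lambda>b. h (prod.swap b)) has_derivative (\<lambda>v. D (prod.swap v))) (at a)"
    using has_derivative_compose[OF bounded_linear_imp_has_derivative[OF bl] D] .
  moreover have "prod.swap (mscale \<i> M) = mscale \<i> (prod.swap M)"
    by (simp add: mscale_def)
  ultimately show ?thesis using D by (simp add: dbar_eq)
qed

section \<open>Orthogonal projections\<close>

lemma vec_subspace_imp_subspace:
  fixes V :: "(complex^'n) set"
  assumes "vec.subspace V"
  shows "subspace V"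
proof (rule subspaceI)
  have "c *\<^sub>R v = complex_of_real c *s v" for c and v :: "complex^'n"
    by (simp add: vec_eq_iff) (simp add: scaleR_conv_of_real)
  then show "c *\<^sub>R v \<in> V" if "v \<in> V" for c v
    using that assms vec.subspace_scale by metis
qed (use assms in \<open>auto simp: vec.subspace_0 vec.subspace_add\<close>)

lemma orthogonal_comp_iff: "w \<in> V\<^sup>\<bottom> \<longleftrightarrow> (\<forall>u\<in>V. u \<bullet> w = 0)"
  by (simp add: orthogonal_comp_def orthogonal_def)

lemma inner_smult_complex:
  fixes u w :: "complex^'n"
  shows "u \<bullet> (c *s w) = (cnj c *s u) \<bullet> w"
  by (simp add: inner_vec_def inner_complex_def algebra_simps)

lemma vec_subspace_orthogonal_comp:
  fixes V :: "(complex^'n) set"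
  assumes "vec.subspace V"
  shows "vec.subspace (V\<^sup>\<bottom>)"
  by (rule vec.subspaceI)
     (use assms in \<open>auto simp: orthogonal_comp_iff inner_right_distrib inner_smult_complex vec.subspace_scale\<close>)

lemma oproj_unique:
  assumes "vec.subspace V" "u \<in> V" "v - u \<in> V\<^sup>\<bottom>"
  shows "oproj V v = u"
  unfolding oproj_def
proof (rule the_equality)
  fix w assume w: "w \<in> V \<and> v - w \<in> V\<^sup>\<bottom>"
  have "u - w \<in> V" using assms w vec.subspace_diff by blast
  moreover have "(v - w) - (v - u) \<in> V\<^sup>\<bottom>"
    using assms w vec.subspace_diff vec_subspace_orthogonal_comp by blast
  ultimately have "(u - w) \<bullet> (u - w) = 0" by (simp add: orthogonal_comp_iff)
  then show "w = u" by simp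
qed (use assms in auto)

text \<open>The decomposition is taken from real linear algebra: a complex subspace is its own real
  span, and its real orthogonal complement is the one used in \<open>oproj\<close>.\<close>

lemma
  fixes V :: "(complex^'n) set"
  assumes "vec.subspace V"
  shows oproj_mem: "oproj V v \<in> V" and oproj_orth: "v - oproj V v \<in> V\<^sup>\<bottom>"
proof -
  obtain y z where "y \<in> span V" "\<And>w. w \<in> span V \<Longrightarrow> orthogonal z w" "v = y + z"
    using orthogonal_subspace_decomp_exists[of V v] by blast
  moreover have "span V = V"
    using vec_subspace_imp_subspace[OF assms] by (simp add: span_eq_iff)
  ultimately have "y \<in> V" "v - y \<in> V\<^sup>\<bottom>"
    by (auto simp: orthogonal_comp_def orthogonal_commute)
  with oproj_unique[OF assms this] show "oproj V v \<in> V" "v - oproj V v \<in> V\<^sup>\<bottom>" by simp_all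
qed

lemma oproj_ident: "vec.subspace V \<Longrightarrow> v \<in> V \<Longrightarrow> oproj V v = v"
  by (rule oproj_unique) (simp_all add: orthogonal_comp_iff)

lemma oproj_eq_0: "vec.subspace V \<Longrightarrow> v \<in> V\<^sup>\<bottom> \<Longrightarrow> oproj V v = 0"
  by (rule oproj_unique) (simp_all add: vec.subspace_0)

text \<open>Additivity and complex homogeneity both follow from uniqueness, because the complement
  of a complex subspace is again complex.\<close>

lemma oproj_linear:
  assumes V: "vec.subspace V"
  shows "Vector_Spaces.linear (*s) (*s) (oproj V)"
proof -
  note O = vec_subspace_orthogonal_comp[OF V]
  have "oproj V (u + v) = oproj V u + oproj V v" for u v
  proof (rule oproj_unique[OF V])
    have "(u - oproj V u) + (v - oproj V v) \<in> V\<^sup>\<bottom>"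
      by (intro vec.subspace_add[OF O] oproj_orth V)
    then show "u + v - (oproj V u + oproj V v) \<in> V\<^sup>\<bottom>" by (simp add: algebra_simps)
  qed (intro vec.subspace_add V oproj_mem)
  moreover have "oproj V (c *s v) = c *s oproj V v" for c v
  proof (rule oproj_unique[OF V])
    have "c *s (v - oproj V v) \<in> V\<^sup>\<bottom>"
      by (intro vec.subspace_scale[OF O] oproj_orth V)
    then show "c *s v - c *s oproj V v \<in> V\<^sup>\<bottom>" by (simp add: vector_sub_rdistrib vec_eq_iff algebra_simps)
  qed (intro vec.subspace_scale V oproj_mem)
  ultimately show ?thesis by unfold_locales auto
qed

section \<open>Projector matrices and their motion under invertible matrices\<close>

definition pmat :: "(complex^'n) set \<Rightarrow> complex^'n^'n" where
  "pmat V = matrix (oproj V)"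

lemma pmat_mult: "vec.subspace V \<Longrightarrow> pmat V *v v = oproj V v"
  by (simp add: pmat_def matrix_works[OF oproj_linear])

lemma pmat_idem: "vec.subspace V \<Longrightarrow> pmat V ** pmat V = pmat V"
  unfolding matrix_eq by (simp add: pmat_mult oproj_ident oproj_mem flip: matrix_vector_mul_assoc)

lemma pmat_mult_eq_iff: "vec.subspace V \<Longrightarrow> pmat V *v v = v \<longleftrightarrow> v \<in> V"
  by (metis pmat_mult oproj_ident oproj_mem)

lemma pmat_mult_inner:
  assumes V: "vec.subspace V"
  shows "(pmat V *v u) \<bullet> w = u \<bullet> (pmat V *v w)"
proof -
  have "oproj V u \<bullet> (w - oproj V w) = 0" "oproj V w \<bullet> (u - oproj V u) = 0"
    using oproj_orth[OF V] oproj_mem[OF V] by (auto simp: orthogonal_comp_iff)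
  then show ?thesis
    by (simp add: pmat_mult[OF V] inner_diff_right inner_commute)
qed

text \<open>With respect to the decomposition by the projector \<open>P\<close>, this is the block diagonal matrix with the
  compression of \<open>X\<close> to the range of \<open>P\<close> and the identity as its blocks.\<close>

definition compress :: "complex^'n^'n \<Rightarrow> complex^'n^'n \<Rightarrow> complex^'n^'n" where
  "compress P X = P ** X ** P + (mat 1 - P)"

lemma compress_commute:
  assumes "P ** P = P"
  shows "P ** compress P X = P ** X ** P" "compress P X ** P = P ** X ** P"
  by (simp_all add: compress_def matrix_add_ldistrib matrix_add_rdistrib matrix_sub_ldistrib
      matrix_sub_rdistrib matrix_mul_assoc assms)
     (metis assms matrix_mul_assoc)

text \<open>Multiplied by \<open>P\<close> from either side, \<open>compress P X\<close> becomes
  \<open>P ** X ** P\<close>; hence \<open>P ** C ** P\<close> inverts the compression on the range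
  of \<open>P\<close>. This replaces a choice of basis of the range.\<close>

lemma compress_inv_works:
  assumes P: "P ** P = P" and inv: "invertible (compress P X)"
  defines "C \<equiv> matrix_inv (compress P X)"
  shows "P ** X ** P ** C ** P = P"
proof -
  note CC = matrix_inv_works[OF inv, folded C_def]
  have "P ** X ** P ** C ** P = P ** (compress P X ** C) ** P"
    by (simp add: matrix_mul_assoc compress_commute[OF P])
  then show "P ** X ** P ** C ** P = P" by (simp add: CC P)
qed

lemma invertible_iff_ker:
  fixes A :: "complex^'n^'n"
  shows "invertible A \<longleftrightarrow> (\<forall>x. A *v x = 0 \<longrightarrow> x = 0)"
  by (simp add: invertible_left_inverse matrix_left_invertible_ker)

text \<open>The two blocks vanish separately: multiplying by \<open>P\<close> isolates
  \<open>P ** X ** P\<close>, and what remains says that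
  \<open>(mat 1 - P) *v u = 0\<close>.\<close>

lemma compress_ker:
  assumes P: "P ** P = P" and u: "compress P X *v u = 0"
  shows "P *v (X *v u) = 0" "P *v u = u"
proof -
  have "(P ** compress P X) *v u = 0"
    by (simp add: u flip: matrix_vector_mul_assoc)
  then have 1: "(P ** X ** P) *v u = 0" by (simp add: compress_commute[OF P])
  with u show 2: "P *v u = u"
    by (simp add: compress_def matrix_vector_mult_add_rdistrib matrix_vector_mult_diff_rdistrib)
  show "P *v (X *v u) = 0"
    using 1 by (simp add: 2 flip: matrix_vector_mul_assoc)
qed

text \<open>On the range of the projector the compression of \<open>g* g\<close> is the Gram form of
  \<open>g\<close>, so a kernel vector \<open>u\<close> has \<open>g *v u\<close> of norm
  zero.\<close>

lemma invertible_compress_gram: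
  fixes g :: "complex^'n^'n"
  assumes V: "vec.subspace V" and g: "invertible g"
  shows "invertible (compress (pmat V) (cadj g ** g))"
  unfolding invertible_iff_ker
proof (intro allI impI)
  fix u assume "compress (pmat V) (cadj g ** g) *v u = 0"
  note ker = compress_ker[OF pmat_idem[OF V] this]
  have "(g *v u) \<bullet> (g *v u) = u \<bullet> ((cadj g ** g) *v u)"
    by (simp add: inner_cadj matrix_vector_mul_assoc)
  also have "\<dots> = (pmat V *v u) \<bullet> ((cadj g ** g) *v u)" by (simp add: ker)
  also have "\<dots> = 0"
    by (simp only: pmat_mult_inner[OF V] ker(1) inner_zero_right)
  finally have "g *v u = 0" by simp
  then show "u = 0" using g invertible_iff_ker by blast
qed

text \<open>The formula \<open>A (A* A)\<^sup>-\<^sup>1 A*\<close> for the projector onto a column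
  space, with \<open>A = g P\<close> and the inverse taken only on the range of
  \<open>P\<close>.\<close>

definition moved_proj :: "(complex^'n) set \<Rightarrow> complex^'n^'n \<Rightarrow> complex^'n^'n" where
  "moved_proj V g =
     g ** pmat V ** matrix_inv (compress (pmat V) (cadj g ** g)) ** pmat V ** cadj g"

lemma vec_subspace_image: "vec.subspace V \<Longrightarrow> vec.subspace ((*v) A ` V)"
  using vec.subspace_image by blast

lemma oproj_image:
  assumes V: "vec.subspace V" and g: "invertible g"
  shows "oproj ((*v) g ` V) w = moved_proj V g *v w"
proof (rule oproj_unique[OF vec_subspace_image[OF V]])
  define P where "P = pmat V"
  define C where "C = matrix_inv (compress P (cadj g ** g))"
  have P: "P ** P = P" using pmat_idem[OF V] P_def by simp
  note works = compress_inv_works[OF P invertible_compress_gram[OF V g, folded P_def], folded C_def]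
  define t where "t = (C ** P ** cadj g) *v w"
  have eq: "moved_proj V g *v w = g *v (P *v t)"
    by (simp add: moved_proj_def t_def P_def C_def matrix_vector_mul_assoc matrix_mul_assoc)
  then show "moved_proj V g *v w \<in> (*v) g ` V"
    by (simp add: P_def pmat_mult[OF V] oproj_mem[OF V])
  \<comment> \<open>The normal equations: they make the residual \<open>w - g *v (P *v t)\<close>
    orthogonal to \<open>g *v v\<close> for all \<open>v\<close> in the range of
    \<open>P\<close>.\<close>
  have "P ** cadj g ** g ** P ** C ** P ** cadj g = P ** cadj g"
    using arg_cong[OF works, of "\<lambda>A. A ** cadj g"] by (simp add: matrix_mul_assoc)
  then have PP: "P *v (cadj g *v (g *v (P *v t))) = P *v (cadj g *v w)"
    by (simp add: t_def matrix_vector_mul_assoc matrix_mul_assoc)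
  have "(g *v v) \<bullet> (w - g *v (P *v t)) = 0" if "v \<in> V" for v
  proof -
    have v: "P *v v = v" using that by (simp add: P_def pmat_mult[OF V] oproj_ident[OF V])
    have "(g *v v) \<bullet> (w - g *v (P *v t)) = (P *v v) \<bullet> (cadj g *v (w - g *v (P *v t)))"
      by (simp add: inner_cadj v)
    also have "\<dots> = v \<bullet> (P *v (cadj g *v (w - g *v (P *v t))))"
      by (simp add: P_def pmat_mult_inner[OF V])
    also have "\<dots> = 0"
      by (simp add: matrix_vector_mult_diff_distrib PP)
    finally show ?thesis .
  qed
  then show "w - moved_proj V g *v w \<in> ((*v) g ` V)\<^sup>\<bottom>"
    by (auto simp: orthogonal_comp_iff eq)
qed

lemma moved_proj_1: "vec.subspace V \<Longrightarrow> moved_proj V (mat 1) = pmat V"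
  unfolding matrix_eq using oproj_image[of V "mat 1"] 
  by (simp add: pmat_mult invertible_def exI[of _ "mat 1"])

lemma smooth_on_compress:
  "open S \<Longrightarrow> smooth_on S f \<Longrightarrow> smooth_on S (\<lambda>a. compress P (f a))"
  unfolding compress_def by (intro smooth_on_add smooth_on_matrix_mult smooth_on_const)

lemma smooth_on_moved_proj:
  assumes "vec.subspace V" "open S" "smooth_on S f" "\<And>a. a \<in> S \<Longrightarrow> invertible (f a)"
  shows "smooth_on S (\<lambda>a. moved_proj V (f a))"
  unfolding moved_proj_def
  by (intro smooth_on_matrix_mult smooth_on_const smooth_on_matrix_inv smooth_on_compress
      invertible_compress_gram smooth_on_bounded_linear[OF _ bounded_linear_cadj] assms)

text \<open>A vector of \<open>g V\<close> is determined by its orthogonal projection to \<open>V\<close> if \<open>g V\<close> meets the orthogonal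
  complement of \<open>V\<close> only in zero. In contrast to the orthogonal projection to \<open>g V\<close>, the vector
  depends holomorphically on \<open>g\<close>.\<close>

lemma invertible_compress_iff:
  assumes V: "vec.subspace V" and g: "invertible g"
  shows "invertible (compress (pmat V) g) \<longleftrightarrow> (\<forall>u\<in>(*v) g ` V. oproj V u = 0 \<longrightarrow> u = 0)"
proof
  assume inv: "invertible (compress (pmat V) g)"
  show "\<forall>u\<in>(*v) g ` V. oproj V u = 0 \<longrightarrow> u = 0"
  proof (clarify)
    fix t assume t: "t \<in> V" "oproj V (g *v t) = 0"
    then have "pmat V *v t = t" by (simp add: pmat_mult_eq_iff[OF V])
    then have "compress (pmat V) g *v t = 0"
      using t(2) by (simp add: compress_def matrix_vector_mult_add_rdistrib
          matrix_vector_mult_diff_rdistrib pmat_mult[OF V] flip: matrix_vector_mul_assoc)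
    then have "t = 0" using inv by (simp add: invertible_iff_ker)
    then show "g *v t = 0" by simp
  qed
next
  assume *: "\<forall>u\<in>(*v) g ` V. oproj V u = 0 \<longrightarrow> u = 0"
  show "invertible (compress (pmat V) g)"
    unfolding invertible_iff_ker
  proof (intro allI impI)
    fix u assume "compress (pmat V) g *v u = 0"
    note ker = compress_ker[OF pmat_idem[OF V] this]
    have "u \<in> V" using ker(2) pmat_mult_eq_iff[OF V] by blast
    moreover have "oproj V (g *v u) = 0" using ker(1) by (simp add: pmat_mult[OF V])
    ultimately have "u \<in> V" "oproj V (g *v u) = 0" by blast+
    with * have "g *v u = 0" by blast
    then show "u = 0" using g by (simp add: invertible_iff_ker)
  qed
qed

text \<open>The projection onto \<open>g V\<close> along the orthogonal complement of
  \<open>V\<close>: the compression of \<open>g\<close> is inverted on the range of the projector,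
  and no adjoint of \<open>g\<close> occurs.\<close>

definition frame_mat :: "(complex^'n) set \<Rightarrow> complex^'n^'n \<Rightarrow> complex^'n^'n" where
  "frame_mat V g = g ** pmat V ** matrix_inv (compress (pmat V) g) ** pmat V"

text \<open>Described through the moved subspace alone, and not through \<open>g\<close>, so that it
  gives a well-defined section over flags; \<open>frame_mat\<close> computes it for any
  \<open>g\<close> that moves \<open>V\<close> to \<open>V'\<close>.\<close>

definition frame_vec :: "(complex^'n) set \<Rightarrow> complex^'n \<Rightarrow> (complex^'n) set \<Rightarrow> complex^'n" where
  "frame_vec V v V' = (THE u. u \<in> V' \<and> oproj V u = oproj V v)"

lemma frame_vec_unique:
  assumes V: "vec.subspace V" and g: "invertible g" "invertible (compress (pmat V) g)"
    and u: "u \<in> (*v) g ` V" "oproj V u = oproj V v"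
  shows "frame_vec V v ((*v) g ` V) = u"
  unfolding frame_vec_def
proof (rule the_equality)
  fix w assume w: "w \<in> (*v) g ` V \<and> oproj V w = oproj V v"
  interpret L: Vector_Spaces.linear "(*s)" "(*s)" "oproj V" by (rule oproj_linear[OF V])
  have "w - u \<in> (*v) g ` V" using w u(1) vec.subspace_diff vec_subspace_image[OF V] by blast
  moreover have "oproj V (w - u) = 0" using w u(2) by (simp add: L.diff)
  ultimately have "w - u = 0" using invertible_compress_iff[OF V g(1)] g(2) by blast
  then show "w = u" by simp
qed (use u in auto)

lemma frame_mat_works:
  assumes V: "vec.subspace V" and g: "invertible g" "invertible (compress (pmat V) g)"
  shows "frame_mat V g *v v \<in> (*v) g ` V" "oproj V (frame_mat V g *v v) = oproj V v"
    "frame_vec V v ((*v) g ` V) = frame_mat V g *v v"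
proof -
  define t where "t = (matrix_inv (compress (pmat V) g) ** pmat V) *v v"
  have "frame_mat V g *v v = g *v (pmat V *v t)"
    by (simp add: frame_mat_def t_def matrix_vector_mul_assoc matrix_mul_assoc)
  then show 1: "frame_mat V g *v v \<in> (*v) g ` V" by (simp add: pmat_mult[OF V] oproj_mem[OF V])
  have "pmat V ** frame_mat V g = pmat V"
    using compress_inv_works[OF pmat_idem[OF V] g(2)] by (simp add: frame_mat_def matrix_mul_assoc)
  then show 2: "oproj V (frame_mat V g *v v) = oproj V v"
    by (simp add: matrix_vector_mul_assoc flip: pmat_mult[OF V])
  show "frame_vec V v ((*v) g ` V) = frame_mat V g *v v"
    by (rule frame_vec_unique[OF assms 1 2])
qed

lemma smooth_on_frame_mat:
  assumes "open S" "smooth_on S f" "\<And>a. a \<in> S \<Longrightarrow> invertible (compress (pmat V) (f a))"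
  shows "smooth_on S (\<lambda>a. frame_mat V (f a))"
  unfolding frame_mat_def
  by (intro smooth_on_matrix_mult smooth_on_const smooth_on_matrix_inv smooth_on_compress assms)

lemma dbar_mat_matrix_inv:
  fixes f :: "_ \<Rightarrow> complex^'m^'m"
  assumes S: "open S" "a \<in> S" and f: "smooth_on S f" "\<And>b. b \<in> S \<Longrightarrow> invertible (f b)"
  shows "dbar_mat (\<lambda>b. matrix_inv (f b)) a M = - (matrix_inv (f a) ** dbar_mat f a M ** matrix_inv (f a))"
proof (rule dbar_mat_inverse[OF S])
  show "f b ** matrix_inv (f b) = mat 1" if "b \<in> S" for b
    using f(2) that matrix_inv_works by blast
qed (use assms in \<open>blast intro: smooth_on_imp_differentiable smooth_on_matrix_inv\<close>)+

lemma dbar_mat_mult_const: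
  assumes S: "open S" "a \<in> S" and f: "smooth_on S f"
  shows "dbar_mat (\<lambda>b. A ** f b ** B) a M = A ** dbar_mat f a M ** B"
proof -
  have "(\<lambda>b. A ** f b) differentiable (at a)" "f differentiable (at a)"
    by (intro smooth_on_imp_differentiable[OF _ S(2)] smooth_on_matrix_mult smooth_on_const S f)+
  then show ?thesis by (simp add: dbar_mat_mult)
qed

lemma dbar_mat_compress:
  assumes S: "open S" "a \<in> S" and f: "smooth_on S f"
  shows "dbar_mat (\<lambda>b. compress P (f b)) a M = P ** dbar_mat f a M ** P"
proof -
  have "(\<lambda>b. P ** f b ** P) differentiable (at a)"
    by (intro smooth_on_imp_differentiable[OF _ S(2)] smooth_on_matrix_mult smooth_on_const S f)
  then show ?thesis
    unfolding compress_def by (simp add: dbar_mat_add dbar_mat_mult_const[OF S f])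
qed

text \<open>The inverse contributes only through \<open>\<partial>bar f\<close>, which vanishes at
  \<open>a\<close> in the direction \<open>M\<close>; hence \<open>frame_mat\<close> inherits
  holomorphy from \<open>f\<close>.\<close>

lemma dbar_mat_frame_mat:
  assumes S: "open S" "a \<in> S" and f: "smooth_on S f"
    and inv: "\<And>b. b \<in> S \<Longrightarrow> invertible (compress (pmat V) (f b))"
    and holo: "dbar_mat f a M = 0"
  shows "dbar_mat (\<lambda>b. frame_mat V (f b)) a M = 0"
proof -
  let ?P = "pmat V" and ?C = "\<lambda>b. matrix_inv (compress (pmat V) (f b))"
  note C = smooth_on_compress[OF S(1) f, of ?P]
  have C': "smooth_on S ?C" by (rule smooth_on_matrix_inv[OF S(1) C inv])
  have "f differentiable (at a)" "(\<lambda>b. ?P ** ?C b ** ?P) differentiable (at a)"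
    by (intro smooth_on_imp_differentiable[OF _ S(2)] smooth_on_matrix_mult smooth_on_const S f C')+
  moreover have "dbar_mat ?C a M = 0"
    by (simp add: dbar_mat_matrix_inv[OF S C inv] dbar_mat_compress[OF S f] holo
        matrix_minus_left)
  ultimately have "dbar_mat (\<lambda>b. f b ** (?P ** ?C b ** ?P)) a M = 0"
    by (simp add: dbar_mat_mult dbar_mat_mult_const[OF S C'] holo)
  then show ?thesis by (simp add: frame_mat_def matrix_mul_assoc)
qed

section \<open>The moved projector on pairs of invertible matrices\<close>

lemma open_GL2: "open (GL2 :: ('n::finite cmat \<times> 'n cmat) set)"
proof -
  have "open {a :: 'n cmat \<times> 'n cmat. a \<in> UNIV \<and> invertible (fst a)}"
    "open {a :: 'n cmat \<times> 'n cmat. a \<in> UNIV \<and> invertible (snd a)}"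
    using open_invertible[OF open_UNIV smooth_on_linear[OF open_UNIV bounded_linear_fst]]
      open_invertible[OF open_UNIV smooth_on_linear[OF open_UNIV bounded_linear_snd]] by auto
  from open_Int[OF this] show ?thesis unfolding GL2_def by (simp add: Collect_conj_eq)
qed

lemma one2_GL2 [simp]: "one2 \<in> GL2"
  by (auto simp: GL2_def invertible_def exI[of _ "mat 1"])

lemma matrix_inv_unique: "A ** B = mat 1 \<Longrightarrow> matrix_inv A = (B :: complex^'n^'n)"
  by (metis invertible_right_inverse matrix_inv_works(2) matrix_mul_assoc matrix_mul_lid matrix_mul_rid)

lemma matrix_inv_1 [simp]: "matrix_inv (mat 1) = (mat 1 :: complex^'n^'n)"
  by (rule matrix_inv_unique) simp

lemma smooth_on_fst: "open S \<Longrightarrow> smooth_on S fst"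
  and smooth_on_snd: "open S \<Longrightarrow> smooth_on S snd"
  by (auto intro: smooth_on_linear bounded_linear_fst bounded_linear_snd)

lemma smooth_on_cadj: "open S \<Longrightarrow> smooth_on S f \<Longrightarrow> smooth_on S (\<lambda>a. cadj (f a))"
  by (rule smooth_on_bounded_linear[OF _ bounded_linear_cadj])

lemma smooth_moved_proj_fst:
  "vec.subspace V \<Longrightarrow> smooth_on GL2 (\<lambda>a. moved_proj V (fst a))"
  by (rule smooth_on_moved_proj[OF _ open_GL2 smooth_on_fst[OF open_GL2]]) (simp_all add: GL2_def)

text \<open>Among the factors of \<open>moved_proj\<close> the leading \<open>g\<close> is
  holomorphic, the inverse Gram block contributes \<open>- P M* P\<close>, and the last factor, the
  adjoint of \<open>g\<close>, contributes \<open>P M*\<close>. Here \<open>M\<close> stands for the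
  first matrix of the pair.\<close>

lemma dbar_mat_moved_proj:
  fixes V :: "(complex^'n) set"
  assumes V: "vec.subspace V"
  shows "dbar_mat (\<lambda>a. moved_proj V (fst a)) one2 M = pmat V ** cadj (fst M) ** (mat 1 - pmat V)"
proof -
  let ?P = "pmat V" and ?X = "\<lambda>a :: 'n cmat \<times> 'n cmat. cadj (fst a) ** fst a"
  let ?C = "\<lambda>a. matrix_inv (compress ?P (?X a))"
  note S = open_GL2 one2_GL2
  note P = pmat_idem[OF V]
  have X: "smooth_on GL2 ?X"
    by (intro smooth_on_matrix_mult smooth_on_cadj smooth_on_fst open_GL2)
  note C = smooth_on_compress[OF S(1) X, of ?P]
  have inv: "invertible (compress ?P (?X a))" if "a \<in> GL2" for a
    by (rule invertible_compress_gram[OF V]) (use that in \<open>simp add: GL2_def\<close>)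
  have C': "smooth_on GL2 ?C" by (rule smooth_on_matrix_inv[OF S(1) C inv])
  \<comment> \<open>At the identity the blocks \<open>P\<close> and \<open>mat 1 - P\<close> add up
    to \<open>mat 1\<close>, so the inverse disappears from all terms.\<close>
  have C1: "compress ?P (?X one2) = mat 1" by (simp add: compress_def P)
  have [simp]: "fst differentiable (at one2)" "(\<lambda>a. cadj (fst a)) differentiable (at one2)"
    "(\<lambda>a. ?P ** ?C a ** ?P) differentiable (at one2)"
    "(\<lambda>a. ?P ** ?C a ** ?P ** cadj (fst a)) differentiable (at one2)"
    by (intro smooth_on_imp_differentiable[OF _ S(2)] smooth_on_matrix_mult smooth_on_const S
        smooth_on_cadj smooth_on_fst C')+
  have "dbar_mat ?X one2 M = cadj (fst M)"
    by (simp add: dbar_mat_mult dbar_mat_cadj_fst)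
  then have dC: "dbar_mat ?C one2 M = - (?P ** cadj (fst M) ** ?P)"
    using C1 by (simp add: dbar_mat_matrix_inv[OF S C inv] dbar_mat_compress[OF S X])
  have "dbar_mat (\<lambda>a. fst a ** (?P ** ?C a ** ?P ** cadj (fst a))) one2 M =
      ?P ** dbar_mat ?C one2 M ** ?P + ?P ** ?C one2 ** ?P ** cadj (fst M)"
    by (simp add: dbar_mat_mult dbar_mat_mult_const[OF S C'] dbar_mat_cadj_fst)
  also have "\<dots> = - (?P ** cadj (fst M) ** ?P) + ?P ** cadj (fst M)"
    unfolding dC using C1 P
    by (simp add: matrix_minus_left matrix_minus_right matrix_mul_assoc)
       (metis matrix_mul_assoc)
  also have "\<dots> = ?P ** cadj (fst M) ** (mat 1 - ?P)"
    by (simp add: matrix_sub_ldistrib)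
  finally show ?thesis by (simp add: moved_proj_def matrix_mul_assoc)
qed

section \<open>Flags and local frames of the tautological bundles\<close>

lemma flags_subspace: "F \<in> flags k d \<Longrightarrow> i \<in> {1..k} \<Longrightarrow> vec.subspace (F i)"
  by (simp add: flags_def)

lemma act_nth: "i \<in> {1..k} \<Longrightarrow> act k g F i = (*v) g ` F i"
  by (simp add: act_def)

lemma act_mult: "act k g (act k h F) = act k (g ** h) F"
  by (auto simp: act_def restrict_def fun_eq_iff image_image matrix_vector_mul_assoc)

lemma act_one: "F \<in> flags k d \<Longrightarrow> act k (mat 1) F = F"
  by (auto simp: act_def flags_def fun_eq_iff restrict_def extensional_def)

lemma act_flags:
  fixes F :: "'n::finite flag"
  assumes F: "F \<in> flags k d" and g: "invertible g"
  shows "act k g F \<in> flags k d"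
proof -
  have inj: "inj ((*v) g)" using inj_matrix_vector_mult[OF g] .
  have surj: "surj ((*v) g)"
    using g invertible_right_inverse matrix_right_invertible_surjective by blast
  have "vec.dim ((*v) g ` V) = vec.dim V" for V
    by (rule vec.dim_image_eq) (auto intro: inj_on_subset[OF inj])
  then show ?thesis
    using F surj unfolding flags_def
    by (auto simp: act_nth vec_subspace_image image_mono intro!: image_eqI) (auto simp: act_def)
qed

lemma act2_simps [simp]:
  "fst (act2 k a x) = act k (fst a) (fst x)" "snd (act2 k a x) = act k (snd a) (snd x)"
  by (simp_all add: act2_def)

lemma act2_one: "x \<in> flags k d \<times> flags k d \<Longrightarrow> act2 k one2 x = x"
  by (auto simp: prod_eq_iff act_one)

lemma act2_flags:
  "x \<in> flags k d \<times> flags k d \<Longrightarrow> a \<in> GL2 \<Longrightarrow> act2 k a x \<in> flags k d \<times> flags k d"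
  by (auto simp: act2_def GL2_def act_flags)

abbreviation pull :: "nat \<Rightarrow> ('n::finite flag \<times> 'n flag) set \<Rightarrow> 'n flag \<times> 'n flag \<Rightarrow> ('n cmat \<times> 'n cmat) set" where
  "pull k U x \<equiv> {a \<in> GL2. act2 k a x \<in> U}"

lemma openXX_imp_open: "openXX k d U \<Longrightarrow> x \<in> U \<Longrightarrow> open (pull k U x)"
  by (simp add: openXX_def)

lemma openXX_subset: "openXX k d U \<Longrightarrow> U \<subseteq> flags k d \<times> flags k d"
  by (simp add: openXX_def)

lemma one2_pull: "openXX k d U \<Longrightarrow> x \<in> U \<Longrightarrow> one2 \<in> pull k U x"
  using act2_one openXX_subset by fastforce

lemma openXX_flags: "openXX k d (flags k d \<times> flags k d :: ('n::finite flag \<times> 'n flag) set)"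
proof -
  have "pull k (flags k d \<times> flags k d) x = GL2" if "x \<in> flags k d \<times> flags k d" for x :: "'n flag \<times> 'n flag"
    using act2_flags[OF that] by blast
  then show ?thesis by (simp add: openXX_def open_GL2)
qed

lemma openXX_Int:
  assumes "openXX k d U" "openXX k d U'"
  shows "openXX k d (U \<inter> U')"
proof -
  have "pull k (U \<inter> U') x = pull k U x \<inter> pull k U' x" for x by blast
  then show ?thesis using assms by (auto simp: openXX_def open_Int)
qed

lemma openX_subset: "openX k d W \<Longrightarrow> W \<subseteq> flags k d"
  by (simp add: openX_def)

lemma openXX_Times:
  fixes W :: "'n::finite flag set"
  assumes W: "openX k d W"
  shows openXX_Times_left: "openXX k d (W \<times> flags k d)"
    and openXX_Times_right: "openXX k d (flags k d \<times> W)"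
proof -
  have W': "open {g. invertible g \<and> act k g F \<in> W}" if "F \<in> W" for F
    using W that by (simp add: openX_def)
  have "open (pull k (W \<times> flags k d) x)" if "x \<in> W \<times> flags k d" for x
  proof -
    have "pull k (W \<times> flags k d) x = GL2 \<inter> fst -` {g. invertible g \<and> act k g (fst x) \<in> W}"
      using that by (auto simp: act2_def GL2_def act_flags)
    moreover have "open {g. invertible g \<and> act k g (fst x) \<in> W}" using that by (intro W') auto
    then have "open (GL2 \<inter> fst -` {g. invertible g \<and> act k g (fst x) \<in> W})"
      by (intro open_Int open_GL2 open_vimage_fst)
    ultimately show ?thesis by (simp only:)
  qed
  moreover have "open (pull k (flags k d \<times> W) x)" if "x \<in> flags k d \<times> W" for x
  proof -
    have "pull k (flags k d \<times> W) x = GL2 \<inter> snd -` {g. invertible g \<and> act k g (snd x) \<in> W}"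
      using that by (auto simp: act2_def GL2_def act_flags)
    moreover have "open {g. invertible g \<and> act k g (snd x) \<in> W}" using that by (intro W') auto
    then have "open (GL2 \<inter> snd -` {g. invertible g \<and> act k g (snd x) \<in> W})"
      by (intro open_Int open_GL2 open_vimage_snd)
    ultimately show ?thesis by (simp only:)
  qed
  ultimately show "openXX k d (W \<times> flags k d)" "openXX k d (flags k d \<times> W)"
    using openX_subset[OF W] by (auto simp: openXX_def)
qed

text \<open>The flags whose \<open>i\<close>-th space is transversal to the orthogonal complement of
  \<open>F i\<close>, a neighbourhood of \<open>F\<close>. Membership in the orbit supplies a
  \<open>g\<close> with \<open>y = act k g F\<close>, in terms of which the frames are
  computed.\<close>

definition frame_dom :: "nat \<Rightarrow> nat \<Rightarrow> 'n::finite flag \<Rightarrow> 'n flag set" where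
  "frame_dom k i F = {act k g F | g. invertible g} \<inter> {y. \<forall>u\<in>y i. oproj (F i) u = 0 \<longrightarrow> u = 0}"

lemma smoothXX_subset: "smoothXX k U f \<Longrightarrow> U' \<subseteq> U \<Longrightarrow> smoothXX k U' f"
  unfolding smoothXX_def by (blast intro: smooth_on_subset)

lemma holoXX_subset: "holoXX k U f \<Longrightarrow> U' \<subseteq> U \<Longrightarrow> holoXX k U' f"
  unfolding holoXX_def using smoothXX_subset by blast

lemma holoXX_imp_smoothXX: "holoXX k U f \<Longrightarrow> smoothXX k U f"
  by (simp add: holoXX_def)

lemma ex_index_bij: "\<exists>b. bij_betw b {..<CARD('n)} (UNIV :: 'n::finite set)"
  using ex_bij_betw_nat_finite[of "UNIV :: 'n set"] by (simp add: lessThan_atLeast0)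

context
  fixes k i :: nat and d :: "nat \<Rightarrow> nat"
  assumes i: "i \<in> {1..k}"
begin

lemma act_frame_dom_iff:
  assumes F: "F \<in> flags k d" and g: "invertible g"
  shows "act k g F \<in> frame_dom k i F \<longleftrightarrow> invertible (compress (pmat (F i)) g)"
  using invertible_compress_iff[OF flags_subspace[OF F i] g] g
  by (auto simp: frame_dom_def act_nth[OF i])

lemma frame_dom_self:
  assumes F: "F \<in> flags k d"
  shows "F \<in> frame_dom k i F"
  using act_one[OF F] oproj_ident[OF flags_subspace[OF F i]]
  by (auto simp: frame_dom_def invertible_def intro!: exI[of _ "mat 1"])

lemma openX_frame_dom:
  fixes F :: "'n::finite flag"
  assumes F: "F \<in> flags k d"
  shows "openX k d (frame_dom k i F)"
  unfolding openX_def
proof (intro conjI ballI)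
  show "frame_dom k i F \<subseteq> flags k d"
    using act_flags[OF F] by (auto simp: frame_dom_def)
  fix y assume "y \<in> frame_dom k i F"
  then obtain h where h: "y = act k h F" "invertible h" by (auto simp: frame_dom_def)
  have "open {g \<in> UNIV. invertible (compress (pmat (F i)) (g ** h))}"
    by (intro open_invertible smooth_on_compress smooth_on_matrix_mult smooth_on_const
        smooth_on_linear bounded_linear_ident open_UNIV)
  moreover have "open {g :: 'n cmat \<in> UNIV. invertible g}"
    by (intro open_invertible smooth_on_linear bounded_linear_ident open_UNIV)
  moreover have "{g. invertible g \<and> act k g y \<in> frame_dom k i F} =
      {g \<in> UNIV. invertible g} \<inter> {g \<in> UNIV. invertible (compress (pmat (F i)) (g ** h))}"
    using h by (auto simp: act_mult act_frame_dom_iff[OF F invertible_mult])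
  ultimately show "open {g. invertible g \<and> act k g y \<in> frame_dom k i F}" by auto
qed

lemma frame_vec_act:
  assumes F: "F \<in> flags k d" and g: "invertible g" "act k g F \<in> frame_dom k i F"
  shows "frame_vec (F i) v (act k g F i) = frame_mat (F i) g *v v"
    and "frame_vec (F i) v (act k g F i) \<in> act k g F i"
  using frame_mat_works[OF flags_subspace[OF F i] g(1)] g act_frame_dom_iff[OF F g(1)]
  by (simp_all add: act_nth[OF i])

text \<open>Seen from a point whose second flag is \<open>act k h F\<close>, the section is
  \<open>frame_mat\<close> at \<open>snd a ** h\<close> applied to \<open>v\<close>, and this
  depends holomorphically on \<open>a\<close>.\<close>

lemma hol_frame:
  fixes F :: "'n::finite flag"
  assumes F: "F \<in> flags k d"
  shows "hol (H_bundle k d i) (frame_dom k i F) (\<lambda>y. frame_vec (F i) v (y i))"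
proof -
  let ?W = "frame_dom k i F"
  have mem: "frame_vec (F i) v (y i) \<in> y i" if "y \<in> ?W" for y
    using that frame_vec_act(2)[OF F] by (auto simp: frame_dom_def)
  have "smooth_on (pull k (flags k d \<times> ?W) x) (\<lambda>a. frame_vec (F i) v (snd (act2 k a x) i)) \<and>
      dbarXX k (\<lambda>x. frame_vec (F i) v (snd x i)) x M = 0"
    if x: "x \<in> flags k d \<times> ?W" for x :: "'n flag \<times> 'n flag" and M
  proof -
    let ?S = "pull k (flags k d \<times> ?W) x"
    have op: "openXX k d (flags k d \<times> ?W)" by (intro openXX_Times openX_frame_dom F)
    note S = openXX_imp_open[OF op x] one2_pull[OF op x]
    obtain h where h: "snd x = act k h F" "invertible h" using x by (auto simp: frame_dom_def)
    let ?f = "\<lambda>a :: 'n cmat \<times> 'n cmat. snd a ** h"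
    have dom: "invertible (?f a)" "act k (?f a) F \<in> ?W" if "a \<in> ?S" for a
      using that h by (auto simp: act2_def GL2_def act_mult invertible_mult)
    have eq: "frame_vec (F i) v (snd (act2 k a x) i) = frame_mat (F i) (?f a) *v v" if "a \<in> ?S" for a
      using frame_vec_act(1)[OF F dom[OF that]] by (simp add: h act_mult)
    have inv: "invertible (compress (pmat (F i)) (?f a))" if "a \<in> ?S" for a
      using dom[OF that] act_frame_dom_iff[OF F] by blast
    have f: "smooth_on ?S ?f"
      by (intro smooth_on_matrix_mult smooth_on_snd smooth_on_const S)
    have m: "smooth_on ?S (\<lambda>a. frame_mat (F i) (?f a))"
      by (rule smooth_on_frame_mat[OF S(1) f inv])
    have "dbar_mat ?f one2 M = 0"
      using dbar_mat_mult[OF smooth_on_imp_differentiable[OF smooth_on_snd[OF S(1)] S(2)]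
          differentiable_const, of h] by simp
    then have "dbar_mat (\<lambda>a. frame_mat (F i) (?f a)) one2 M = 0"
      by (intro dbar_mat_frame_mat[OF S f inv])
    then have "dbar_vec (\<lambda>a. frame_mat (F i) (?f a) *v v) one2 M = 0"
      using dbar_vec_matrix_mult[OF smooth_on_imp_differentiable[OF m S(2)] differentiable_const, of v]
      by simp
    then have "dbarXX k (\<lambda>x. frame_vec (F i) v (snd x i)) x M = 0"
      unfolding dbarXX_def using dbar_vec_cong[OF S eq] by simp
    moreover have "smooth_on ?S (\<lambda>a. frame_mat (F i) (?f a) *v v)"
      by (intro smooth_on_matrix_vector_mult smooth_on_const m S)
    then have "smooth_on ?S (\<lambda>a. frame_vec (F i) v (snd (act2 k a x) i))"
      by (rule smooth_on_cong[OF S(1)]) (simp only: eq)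
    ultimately show ?thesis by blast
  qed
  then show ?thesis
    unfolding H_bundle_def holoXX_def smoothXX_def vbundle.select_convs using mem by blast
qed

text \<open>\<open>frame_mat\<close> restricts to the identity on \<open>y i\<close>, so expanding
  \<open>u\<close> in the standard basis and applying it gives this sum. The sections generate the
  fibre but need not be independent; the coefficients are the coordinates of \<open>u\<close>
  itself, hence as regular as \<open>u\<close>.\<close>

lemma frame_expansion:
  fixes F :: "'n::finite flag"
  assumes F: "F \<in> flags k d" and y: "y \<in> frame_dom k i F" and u: "u \<in> y i"
    and b: "bij_betw b {..<CARD('n)} (UNIV :: 'n set)"
  shows "u = (\<Sum>j<CARD('n). u $ b j *s frame_vec (F i) (axis (b j) 1) (y i))"
proof -
  obtain g where g: "y = act k g F" "invertible g" using y by (auto simp: frame_dom_def)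
  let ?A = "frame_mat (F i) g"
  have V: "vec.subspace (F i)" using flags_subspace[OF F i] .
  have inv: "invertible (compress (pmat (F i)) g)"
    using y g act_frame_dom_iff[OF F] by blast
  have "(\<Sum>j<CARD('n). u $ b j *s frame_vec (F i) (axis (b j) 1) (y i)) =
      (\<Sum>j<CARD('n). u $ b j *s (?A *v axis (b j) 1))"
    using frame_vec_act(1)[OF F g(2)] y g(1) by simp
  also have "\<dots> = (\<Sum>r\<in>UNIV. u $ r *s (?A *v axis r 1))"
    using sum.reindex_bij_betw[OF b, of "\<lambda>r. u $ r *s (?A *v axis r 1)"] .
  also have "\<dots> = ?A *v (\<Sum>r\<in>UNIV. u $ r *s axis r 1)"
    by (simp add: vec.sum vec.scale)
  also have "\<dots> = ?A *v u" by (simp add: basis_expansion)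
  also have "\<dots> = frame_vec (F i) u (y i)"
    using frame_mat_works(3)[OF V g(2) inv] by (simp add: g act_nth[OF i])
  also have "\<dots> = u"
    using frame_vec_unique[OF V g(2) inv, of u u] u by (simp add: g act_nth[OF i])
  finally show ?thesis by simp
qed

lemma hol_snd:
  assumes "hol (H_bundle k d i) W e"
  shows "holoXX k (flags k d \<times> W) (\<lambda>x. e (snd x))" and "y \<in> W \<Longrightarrow> e y \<in> y i"
  using assms by (auto simp: H_bundle_def)

lemma hol_fst:
  fixes W :: "'n::finite flag set"
  assumes e: "hol (H_bundle k d i) W e" and W: "openX k d W"
  shows "holoXX k (W \<times> flags k d) (\<lambda>x. e (fst x))"
  unfolding holoXX_def smoothXX_def
proof (intro conjI ballI allI)
  fix x :: "'n flag \<times> 'n flag" assume x: "x \<in> W \<times> flags k d"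
  let ?h = "\<lambda>a. e (snd (act2 k a (prod.swap x)))"
  have x': "prod.swap x \<in> flags k d \<times> W" using x by auto
  have op: "open (pull k (W \<times> flags k d) x)"
    using openXX_imp_open[OF openXX_Times_left[OF W] x] .
  have h: "smooth_on (pull k (flags k d \<times> W) (prod.swap x)) ?h"
    using hol_snd(1)[OF e] x' by (simp only: holoXX_def smoothXX_def)
  have bl: "bounded_linear (prod.swap :: 'n cmat \<times> 'n cmat \<Rightarrow> _)"
    unfolding prod.swap_def by (intro bounded_linear_Pair bounded_linear_fst bounded_linear_snd)
  have "smooth_on (pull k (W \<times> flags k d) x) (\<lambda>a. ?h (prod.swap a))"
    by (rule smooth_on_precompose_linear[OF op bl _ h]) (auto simp: act2_def GL2_def)
  then show "smooth_on (pull k (W \<times> flags k d) x) (\<lambda>a. e (fst (act2 k a x)))" by simp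
  fix M
  have "?h differentiable (at (prod.swap one2))"
    using smooth_on_imp_differentiable[OF h] one2_pull[OF openXX_Times_right[OF W] x'] by simp
  moreover have "dbar_vec ?h one2 (prod.swap M) = 0"
    using hol_snd(1)[OF e] x' by (simp only: holoXX_def dbarXX_def)
  ultimately have "dbar (\<lambda>a. ?h (prod.swap a) $ r) one2 M = 0" for r
    using dbar_swap[OF differentiable_vec_nth, of ?h one2 r M] by (simp add: vec_eq_iff)
  then show "dbarXX k (\<lambda>x. e (fst x)) x M = 0"
    by (simp add: dbarXX_def vec_eq_iff)
qed

section \<open>Sections of the tautological bundle as vector-valued functions\<close>

lemma smooth_secI:
  fixes t :: "'n::finite flag \<times> 'n flag \<Rightarrow> complex^'n"
  assumes "\<And>x. x \<in> U \<Longrightarrow> \<exists>U'. openXX k d U' \<and> x \<in> U' \<and> U' \<subseteq> U \<and> smoothXX k U' t \<and> (\<forall>y\<in>U'. t y \<in> fst y i)"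
  shows "smooth_sec k d (H_bundle k d i) fst U t"
  unfolding smooth_sec_def
proof
  fix x assume "x \<in> U"
  from assms[OF this] obtain U' where U': "openXX k d U'" "x \<in> U'" "U' \<subseteq> U" "smoothXX k U' t"
    and t: "\<And>y. y \<in> U' \<Longrightarrow> t y \<in> fst y i" by blast
  obtain b where b: "bij_betw b {..<CARD('n)} (UNIV :: 'n set)" using ex_index_bij by blast
  let ?F = "fst x"
  let ?W = "frame_dom k i ?F"
  let ?U = "U' \<inter> (?W \<times> flags k d)"
  have x: "x \<in> flags k d \<times> flags k d" using U' openXX_subset by blast
  then have F: "?F \<in> flags k d" by auto
  note W = openX_frame_dom[OF F]
  have U: "openXX k d ?U" by (intro openXX_Int U'(1) openXX_Times W)
  have "x \<in> ?U" using U'(2) frame_dom_self[OF F] x by (auto simp: mem_Times_iff)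
  have "smoothXX k ?U (\<lambda>y. t y $ b j)" for j
    unfolding smoothXX_def
  proof
    fix y assume y: "y \<in> ?U"
    have "smooth_on (pull k ?U y) (\<lambda>a. t (act2 k a y))"
      using y smoothXX_subset[OF U'(4), of ?U] by (simp add: smoothXX_def)
    then show "smooth_on (pull k ?U y) (\<lambda>a. t (act2 k a y) $ b j)"
      by (rule smooth_on_vec_nth[OF openXX_imp_open[OF U y]])
  qed
  moreover have "t y = (\<Sum>j<CARD('n). t y $ b j *s frame_vec (?F i) (axis (b j) 1) (fst y i))" if "y \<in> ?U" for y
    by (rule frame_expansion[OF F _ _ b]) (use that t in auto)
  ultimately show "\<exists>U' W r es fs. openXX k d U' \<and> x \<in> U' \<and> U' \<subseteq> U \<and> openX k d W \<and> fst ` U' \<subseteq> W \<and>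
     (\<forall>j<r::nat. hol (H_bundle k d i) W (es j) \<and> smoothXX k U' (fs j)) \<and>
     (\<forall>y\<in>U'. t y = (\<Sum>j<r. fs j y *s es j (fst y)))"
    using U \<open>x \<in> ?U\<close> U'(3) W hol_frame[OF F]
    by (intro exI[of _ ?U] exI[of _ ?W] exI[of _ "CARD('n)"]
        exI[of _ "\<lambda>j y. frame_vec (?F i) (axis (b j) 1) (y i)"] exI[of _ "\<lambda>j y. t y $ b j"]) auto
qed

text \<open>Since \<open>H\<^sub>i\<close> is a holomorphic subbundle of the trivial bundle, its
  holomorphic sections are smooth as vector-valued functions, and so are their combinations with
  smooth coefficients.\<close>

lemma smooth_secD:
  assumes t: "smooth_sec k d (H_bundle k d i) snd U t" and x: "x \<in> U"
  shows "\<exists>U'. openXX k d U' \<and> x \<in> U' \<and> U' \<subseteq> U \<and> H_sec (smoothXX k) i U' t"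
proof -
  obtain U' W r es fs where *: "openXX k d U' \<and> x \<in> U' \<and> U' \<subseteq> U \<and> openX k d W \<and> snd ` U' \<subseteq> W \<and>
     (\<forall>j<r::nat. hol (H_bundle k d i) W (es j) \<and> smoothXX k U' (fs j)) \<and>
     (\<forall>y\<in>U'. t y = (\<Sum>j<r. fs j y *s es j (snd y)))"
    using bspec[OF t[unfolded smooth_sec_def] x] by (elim exE) (erule that)
  have U': "openXX k d U'" "x \<in> U'" "U' \<subseteq> U" and W: "openX k d W" "snd ` U' \<subseteq> W"
    and es: "\<And>j. j < r \<Longrightarrow> hol (H_bundle k d i) W (es j)"
    and fs: "\<And>j. j < r \<Longrightarrow> smoothXX k U' (fs j)"
    and eq: "\<And>y. y \<in> U' \<Longrightarrow> t y = (\<Sum>j<r. fs j y *s es j (snd y))"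
    using * by auto
  have sub: "U' \<subseteq> flags k d \<times> W" using W(2) openXX_subset[OF U'(1)] by auto
  have "smooth_on (pull k U' y) (\<lambda>a. t (act2 k a y))" if y: "y \<in> U'" for y
  proof (rule smooth_on_cong)
    show op: "open (pull k U' y)" using openXX_imp_open[OF U'(1) y] .
    show "smooth_on (pull k U' y) (\<lambda>a. \<Sum>j<r. fs j (act2 k a y) *s es j (snd (act2 k a y)))"
    proof (intro smooth_on_sum smooth_on_vector_smult op)
      fix j assume "j \<in> {..<r}"
      then have j: "j < r" by simp
      show "smooth_on (pull k U' y) (\<lambda>a. fs j (act2 k a y))"
        using fs[OF j] y by (simp add: smoothXX_def)
      show "smooth_on (pull k U' y) (\<lambda>a. es j (snd (act2 k a y)))"
        using smoothXX_subset[OF holoXX_imp_smoothXX[OF hol_snd(1)[OF es[OF j]]] sub] y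
        by (simp add: smoothXX_def)
    qed
  qed (simp add: eq)
  moreover have "t y \<in> snd y i" if y: "y \<in> U'" for y
  proof -
    have y': "snd y \<in> flags k d" "snd y \<in> W" using subsetD[OF sub y] openX_subset[OF W(1)] by (auto simp: mem_Times_iff)
    show ?thesis
      unfolding eq[OF y]
      by (intro vec.subspace_sum vec.subspace_scale flags_subspace[OF y'(1) i] hol_snd(2)[OF es] y'(2))
         simp
  qed
  ultimately show ?thesis using U' by (auto simp: H_sec_def smoothXX_def)
qed

text \<open>The inclusion of \<open>H\<^sub>i\<close> in the trivial bundle is holomorphic, so the
  intrinsic operator agrees with the componentwise one.\<close>

lemma dbar_sec_eq:
  fixes x :: "'n::finite flag \<times> 'n flag"
  assumes x: "x \<in> flags k d \<times> flags k d"
    and S: "open S" "one2 \<in> S" "S \<subseteq> GL2" and T: "smooth_on S T" "\<And>a. a \<in> S \<Longrightarrow> T a \<in> fst (act2 k a x) i"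
  shows "dbar_sec k d (H_bundle k d i) x T M = dbar_vec T one2 M"
  unfolding dbar_sec_def
proof (rule the_equality)
  \<comment> \<open>Independence of the expansion: in the product rule the terms with
    \<open>\<partial>bar\<close> of the holomorphic \<open>es j\<close> vanish.\<close>
  have *: "(\<Sum>j<r. dbar (fs j) one2 M *s es j (fst x)) = dbar_vec T one2 M"
    if S: "open S" "one2 \<in> S" "S \<subseteq> GL2" and W: "openX k d W" "\<forall>a\<in>S. fst (act2 k a x) \<in> W"
      and r: "\<forall>j<r::nat. hol (H_bundle k d i) W (es j) \<and> smooth_on S (fs j)"
      and eq: "\<forall>a\<in>S. T a = (\<Sum>j<r. fs j a *s es j (fst (act2 k a x)))" for S W r es fs
  proof -
    have "fst (act2 k one2 x) \<in> W" using W(2) S(2) by blast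
    then have xW: "x \<in> W \<times> flags k d" using x act2_one[OF x] by (auto simp: mem_Times_iff)
    have e: "(\<lambda>a. es j (fst (act2 k a x))) differentiable (at one2)"
      "dbar_vec (\<lambda>a. es j (fst (act2 k a x))) one2 M = 0" if "j < r" for j
    proof -
      have h: "holoXX k (W \<times> flags k d) (\<lambda>x. es j (fst x))" using hol_fst r W(1) that by blast
      then have "smooth_on (pull k (W \<times> flags k d) x) (\<lambda>a. es j (fst (act2 k a x)))"
        using xW by (simp only: holoXX_def smoothXX_def)
      from smooth_on_imp_differentiable[OF this one2_pull[OF openXX_Times_left[OF W(1)] xW]]
      show "(\<lambda>a. es j (fst (act2 k a x))) differentiable (at one2)" .
      show "dbar_vec (\<lambda>a. es j (fst (act2 k a x))) one2 M = 0"
        using h xW by (simp only: holoXX_def dbarXX_def)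
    qed
    have f: "fs j differentiable (at one2)" if "j < r" for j
      using r that S(2) smooth_on_imp_differentiable by blast
    have fe: "(\<lambda>a. fs j a *s es j (fst (act2 k a x))) differentiable (at one2)" if "j < r" for j
    proof -
      have "bounded_bilinear ((*s) :: complex \<Rightarrow> complex^'n \<Rightarrow> complex^'n)"
        unfolding bilinear_conv_bounded_bilinear[symmetric] bilinear_def
        by (auto intro!: linearI simp: vec_eq_iff algebra_simps)
      from bounded_bilinear.FDERIV[OF this] f[OF that] e(1)[OF that]
      show ?thesis unfolding differentiable_def by blast
    qed
    have "dbar_vec T one2 M = dbar_vec (\<lambda>a. \<Sum>j<r. fs j a *s es j (fst (act2 k a x))) one2 M"
      by (rule dbar_vec_cong[OF S(1,2)]) (use eq in blast)
    also have "\<dots> = (\<Sum>j<r. dbar_vec (\<lambda>a. fs j a *s es j (fst (act2 k a x))) one2 M)"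
      by (rule dbar_vec_sum) (use fe in simp)
    also have "\<dots> = (\<Sum>j<r. dbar (fs j) one2 M *s es j (fst (act2 k one2 x)))"
    proof (rule sum.cong[OF refl])
      fix j assume "j \<in> {..<r}"
      then have "j < r" by simp
      from dbar_vec_smult[OF f e(1), OF this this, of M] e(2)[OF this]
      show "dbar_vec (\<lambda>a. fs j a *s es j (fst (act2 k a x))) one2 M =
          dbar (fs j) one2 M *s es j (fst (act2 k one2 x))"
        by (simp only: vector_smult_rzero add_0_right)
    qed
    finally show ?thesis by (simp only: act2_one[OF x])
  qed
  \<comment> \<open>Existence of an expansion: the frame based at \<open>fst x\<close>, with the
    coordinates of \<open>T\<close> as coefficients.\<close>
  obtain b where b: "bij_betw b {..<CARD('n)} (UNIV :: 'n set)" using ex_index_bij by blast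
  let ?F = "fst x"
  let ?W = "frame_dom k i ?F"
  let ?S = "S \<inter> pull k (?W \<times> flags k d) x"
  have F: "?F \<in> flags k d" using x by auto
  note W = openX_frame_dom[OF F]
  have xW: "x \<in> ?W \<times> flags k d" using x frame_dom_self[OF F] by (auto simp: mem_Times_iff)
  have S': "open ?S" "one2 \<in> ?S" "?S \<subseteq> GL2"
    using S one2_pull[OF openXX_Times_left[OF W] xW] openXX_imp_open[OF openXX_Times_left[OF W] xW]
    by (auto intro: open_Int)
  have W': "\<forall>a\<in>?S. fst (act2 k a x) \<in> ?W" by (auto simp: act2_def)
  let ?es = "\<lambda>j y. frame_vec (?F i) (axis (b j) 1) (y i)" and ?fs = "\<lambda>j a. T a $ b j"
  have r: "\<forall>j<CARD('n). hol (H_bundle k d i) ?W (?es j) \<and> smooth_on ?S (?fs j)"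
    using hol_frame[OF F] smooth_on_vec_nth[OF S'(1) smooth_on_subset[OF T(1)]] by auto
  have eq: "\<forall>a\<in>?S. T a = (\<Sum>j<CARD('n). ?fs j a *s ?es j (fst (act2 k a x)))"
    using frame_expansion[OF F _ _ b] W' T(2) by auto
  show "\<exists>S W r es fs. open S \<and> one2 \<in> S \<and> S \<subseteq> GL2 \<and> openX k d W \<and> (\<forall>a\<in>S. fst (act2 k a x) \<in> W) \<and>
     (\<forall>j<r::nat. hol (H_bundle k d i) W (es j) \<and> smooth_on S (fs j)) \<and>
     (\<forall>a\<in>S. T a = (\<Sum>j<r. fs j a *s es j (fst (act2 k a x)))) \<and>
     dbar_vec T one2 M = (\<Sum>j<r. dbar (fs j) one2 M *s es j (fst x))"
    by (rule exI[of _ ?S], rule exI[of _ ?W], rule exI[of _ "CARD('n)"], rule exI[of _ ?es], rule exI[of _ ?fs])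
       (intro conjI S' W W' r eq *[OF S' W W' r eq, symmetric])
  show "y = dbar_vec T one2 M"
    if "\<exists>S W r es fs. open S \<and> one2 \<in> S \<and> S \<subseteq> GL2 \<and> openX k d W \<and> (\<forall>a\<in>S. fst (act2 k a x) \<in> W) \<and>
     (\<forall>j<r::nat. hol (H_bundle k d i) W (es j) \<and> smooth_on S (fs j)) \<and>
     (\<forall>a\<in>S. T a = (\<Sum>j<r. fs j a *s es j (fst (act2 k a x)))) \<and>
     y = (\<Sum>j<r. dbar (fs j) one2 M *s es j (fst x))" for y
    using that by - (elim exE conjE, erule trans, rule *; assumption)
qed

lemma oproj_act:
  assumes "x \<in> flags k d \<times> flags k d" "a \<in> GL2"
  shows "oproj (act k (fst a) (fst x) i) w = moved_proj (fst x i) (fst a) *v w"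
  using assms oproj_image[OF flags_subspace[of "fst x" k d i]] i by (auto simp: act_nth GL2_def)

lemma smoothXX_oproj:
  assumes U: "openXX k d U" and f: "smoothXX k U f"
  shows "smoothXX k U (\<lambda>y. oproj (fst y i) (f y))"
  unfolding smoothXX_def
proof
  fix x assume x: "x \<in> U"
  then have x': "x \<in> flags k d \<times> flags k d" using openXX_subset[OF U] by blast
  then have V: "vec.subspace (fst x i)" using flags_subspace[of "fst x" k d i] i by auto
  note op = openXX_imp_open[OF U x]
  show "smooth_on (pull k U x) (\<lambda>a. oproj (fst (act2 k a x) i) (f (act2 k a x)))"
  proof (rule smooth_on_cong[OF op])
    show "smooth_on (pull k U x) (\<lambda>a. moved_proj (fst x i) (fst a) *v f (act2 k a x))"
      using f x by (intro smooth_on_matrix_vector_mult op smooth_on_subset[OF smooth_moved_proj_fst[OF V]])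
        (auto simp: smoothXX_def)
  qed (simp add: oproj_act[OF x'])
qed

end

lemma smoothXX_const: "openXX k d U \<Longrightarrow> smoothXX k U (\<lambda>y. c)"
  unfolding smoothXX_def by (intro ballI smooth_on_const openXX_imp_open)

lemma smoothXX_diff: "openXX k d U \<Longrightarrow> smoothXX k U f \<Longrightarrow> smoothXX k U g \<Longrightarrow> smoothXX k U (\<lambda>y. f y - g y)"
  unfolding smoothXX_def by (intro ballI smooth_on_diff openXX_imp_open) simp_all

lemma smoothXX_matrix_mult:
  fixes A :: "complex^'m^'l"
  shows "openXX k d U \<Longrightarrow> smoothXX k U f \<Longrightarrow> smoothXX k U (\<lambda>y. A *v f y)"
  unfolding smoothXX_def
proof
  fix x assume U: "openXX k d U" "x \<in> U" and f: "\<forall>x\<in>U. smooth_on (pull k U x) (\<lambda>a. f (act2 k a x))"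
  note op = openXX_imp_open[OF U]
  show "smooth_on (pull k U x) (\<lambda>a. A *v f (act2 k a x))"
    by (rule smooth_on_matrix_vector_mult[OF op smooth_on_const[OF op]]) (use f U(2) in blast)
qed

lemma holoXX_matrix_mult:
  assumes U: "openXX k d U" and f: "holoXX k U f"
  shows "holoXX k U (\<lambda>y. A *v f y)"
proof -
  have "dbarXX k (\<lambda>y. A *v f y) x M = 0" if x: "x \<in> U" for x M
  proof -
    have "smooth_on (pull k U x) (\<lambda>a. f (act2 k a x))"
      using f x by (simp only: holoXX_def smoothXX_def)
    from smooth_on_imp_differentiable[OF this one2_pull[OF U x]]
    have "(\<lambda>a. f (act2 k a x)) differentiable (at one2)" .
    moreover have "dbar_vec (\<lambda>a. f (act2 k a x)) one2 M = 0"
      using f x by (simp only: holoXX_def dbarXX_def)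
    ultimately show ?thesis by (simp add: dbarXX_def dbar_vec_matrix_mult del: act2_simps)
  qed
  then show ?thesis
    using smoothXX_matrix_mult[OF U holoXX_imp_smoothXX[OF f]] by (simp add: holoXX_def)
qed

section \<open>The bundle of compatible families\<close>

lemma flags_mono:
  assumes F: "F \<in> flags k d" and j: "1 \<le> j" "j \<le> m" "m \<le> k"
  shows "F j \<subseteq> F m"
  using j(2,3)
proof (induction m rule: dec_induct)
  case (step m)
  then have "F m \<subseteq> F (Suc m)" using F j(1) by (simp add: flags_def)
  with step show ?case by auto
qed simp

lemma mem_coset_iff: "u \<in> coset V w \<longleftrightarrow> u - w \<in> V"
proof
  assume "u - w \<in> V"
  then have "w + (u - w) \<in> coset V w" unfolding coset_def by blast
  then show "u \<in> coset V w" by simp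
qed (auto simp: coset_def)

lemma coset_self: "vec.subspace V \<Longrightarrow> w \<in> coset V w"
  by (simp add: mem_coset_iff vec.subspace_0)

lemma coset_eqI:
  assumes V: "vec.subspace V" and u: "u \<in> coset V w"
  shows "coset V w = coset V u"
proof (rule set_eqI)
  fix t
  have uw: "u - w \<in> V" "w - u \<in> V"
    using u vec.subspace_neg[OF V, of "u - w"] by (auto simp: mem_coset_iff)
  have "t - w \<in> V \<longleftrightarrow> t - u \<in> V"
    using vec.subspace_add[OF V, of "t - w" "w - u"] vec.subspace_add[OF V, of "t - u" "u - w"] uw
    by auto
  then show "t \<in> coset V w \<longleftrightarrow> t \<in> coset V u" by (simp add: mem_coset_iff)
qed

lemma phi_coset:
  assumes V: "vec.subspace V"
  shows "phi V (coset V w) = w - oproj V w"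
  unfolding phi_def
proof (rule the_equality)
  show "w - oproj V w \<in> coset V w \<and> w - oproj V w \<in> V\<^sup>\<bottom>"
    using oproj_orth[OF V] vec.subspace_neg[OF V oproj_mem[OF V]] by (simp add: mem_coset_iff)
  fix u assume u: "u \<in> coset V w \<and> u \<in> V\<^sup>\<bottom>"
  then have "w - u \<in> V" using vec.subspace_neg[OF V, of "u - w"] by (simp add: mem_coset_iff)
  then have "oproj V w = w - u" by (rule oproj_unique[OF V]) (use u in simp)
  then show "u = w - oproj V w" by simp
qed

text \<open>The fibres of \<open>E\<close> are spanned by the values of the global holomorphic sections that a fixed
  matrix \<open>L\<close> induces; \<open>\<eta>\<close> is the section induced by the identity.\<close>

definition lin_sec :: "nat \<Rightarrow> 'n::finite cmat \<Rightarrow> 'n flag \<times> 'n flag \<Rightarrow> 'n efib" where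
  "lin_sec k L x = (\<lambda>j\<in>{1..<k}. \<lambda>v\<in>snd x j. coset (fst x j) (L *v v))"

lemma eta_eq_lin_sec: "eta k = lin_sec k (mat 1)"
  by (simp add: eta_def lin_sec_def fun_eq_iff)

lemma lin_sec_quot_hom:
  assumes V: "vec.subspace V" and U: "vec.subspace U"
  shows "(\<lambda>v\<in>U. coset V (L *v v)) \<in> quot_hom U V"
proof -
  have "a *s p + b *s q - L *v (a *s v + b *s w) \<in> V" if "p - L *v v \<in> V" "q - L *v w \<in> V" for a b p q v w
  proof -
    have "a *s (p - L *v v) + b *s (q - L *v w) \<in> V"
      using that by (intro vec.subspace_add vec.subspace_scale V)
    then show ?thesis
      by (simp add: vec.add vec.scale vec.scale_right_diff_distrib algebra_simps)
  qed
  then show ?thesis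
    using U by (auto simp: quot_hom_def mem_coset_iff vec.subspace_add vec.subspace_scale)
qed

lemma Qmap_coset:
  assumes V': "vec.subspace V'" and V: "vec.subspace V" "V \<subseteq> V'"
  shows "Qmap V' (coset V w) = coset V' w"
proof (rule set_eqI)
  fix t
  have "t \<in> Qmap V' (coset V w)" if "t \<in> coset V' w"
  proof -
    have "t = w + (t - w)" by simp
    then show ?thesis
      using that coset_self[OF V(1), of w] unfolding Qmap_def mem_coset_iff by blast
  qed
  moreover have "t \<in> coset V' w" if t: "t \<in> Qmap V' (coset V w)"
  proof -
    obtain v h where "t = v + h" "v - w \<in> V'" "h \<in> V'"
      using t V(2) by (auto simp: Qmap_def mem_coset_iff)
    then show ?thesis
      using vec.subspace_add[OF V', of "v - w" h] by (simp add: mem_coset_iff algebra_simps)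
  qed
  ultimately show "t \<in> Qmap V' (coset V w) \<longleftrightarrow> t \<in> coset V' w" by blast
qed

lemma lin_sec_E_fib:
  assumes x: "x \<in> flags k d \<times> flags k d"
  shows "lin_sec k L x \<in> E_fib k x"
proof -
  have F: "fst x \<in> flags k d" "snd x \<in> flags k d" using x by auto
  have sub: "vec.subspace (fst x j)" "vec.subspace (snd x j)" if "j \<in> {1..k}" for j
    using flags_subspace[OF F(1) that] flags_subspace[OF F(2) that] by auto
  have incl: "fst x j \<subseteq> fst x (Suc j)" "snd x j \<subseteq> snd x (Suc j)" if "j \<in> {1..<k-1}" for j
    using that by (intro flags_mono[OF F(1)] flags_mono[OF F(2)]; simp; linarith)+
  have "lin_sec k L x \<in> (\<Pi>\<^sub>E j\<in>{1..<k}. quot_hom (snd x j) (fst x j))"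
    unfolding lin_sec_def using sub by (auto intro!: lin_sec_quot_hom)
  moreover have "lin_sec k L x (Suc j) v = Qmap (fst x (Suc j)) (lin_sec k L x j v)"
    if j: "j \<in> {1..<k-1}" and v: "v \<in> snd x j" for j v
  proof -
    have "Qmap (fst x (Suc j)) (coset (fst x j) (L *v v)) = coset (fst x (Suc j)) (L *v v)"
      using j by (intro Qmap_coset sub incl) auto
    then show ?thesis using j v incl(2)[OF j] by (auto simp: lin_sec_def)
  qed
  ultimately show ?thesis by (simp add: E_fib_def)
qed

text \<open>Reduces the lifting property to a spanning set. It also yields
  \<open>0 \<in> f 0\<close>, from which a lift on the zero space can be started.\<close>

lemma quot_hom_lift_subspace:
  assumes f: "f \<in> quot_hom U V" and U: "vec.subspace U" and V: "vec.subspace V"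
  shows "vec.subspace {v \<in> U. L *v v \<in> f v}"
proof -
  have comb: "a *s p + b *s q \<in> f (a *s v + b *s w)" if "v \<in> U" "w \<in> U" "p \<in> f v" "q \<in> f w" for a b v w p q
    using f that by (auto simp: quot_hom_def)
  have "f 0 \<in> range (coset V)" using f vec.subspace_0[OF U] by (auto simp: quot_hom_def)
  then obtain c where "c \<in> f 0" using coset_self[OF V] by auto
  \<comment> \<open>Linearity of \<open>f\<close> is a condition on representatives; the combination
    with both coefficients zero puts \<open>0\<close> into the coset \<open>f 0\<close>.\<close>
  then have "0 \<in> f 0" using comb[of 0 0 c c 0 0] vec.subspace_0[OF U] by simp
  then show ?thesis
    using comb[of _ _ _ _ 1 1] comb[of _ _ _ _ _ 0]
    by (intro vec.subspaceI)
       (auto simp: vec.subspace_0 vec.subspace_add vec.subspace_scale vec.add vec.scale U)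
qed

text \<open>A basis of \<open>K\<close> is extended to one of \<open>U\<close>; on the new basis
  vectors any representative of \<open>f b\<close> may be prescribed.\<close>

lemma extend_lift:
  assumes f: "f \<in> quot_hom U V" and U: "vec.subspace U" and V: "vec.subspace V"
    and K: "vec.subspace K" "K \<subseteq> U" and L: "\<And>v. v \<in> K \<Longrightarrow> L *v v \<in> f v"
  shows "\<exists>L'. (\<forall>v\<in>K. L' *v v = L *v v) \<and> (\<forall>v\<in>U. L' *v v \<in> f v)"
proof -
  obtain B where B: "B \<subseteq> K" "vec.independent B" "K \<subseteq> vec.span B"
    using vec.basis_exists[of K] by metis
  then obtain C where C: "B \<subseteq> C" "C \<subseteq> U" "vec.independent C" "U \<subseteq> vec.span C"
    using vec.maximal_independent_subset_extend[of B U] K(2) by (metis subset_trans)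
  define h where "h b = (if b \<in> B then L *v b else (SOME p. p \<in> f b))" for b
  obtain g where g: "Vector_Spaces.linear (*s) (*s) g" "\<forall>b\<in>C. g b = h b"
    using vec.linear_independent_extend[OF C(3), of h] by blast
  let ?L = "matrix g"
  have Lg: "?L *v v = g v" for v using matrix_works[OF g(1)] .
  have "?L *v v = L *v v" if "v \<in> K" for v
    by (rule vec.linear_eq_on[of _ _ _ B]) (use that B g C Lg in \<open>auto simp: h_def\<close>)
  moreover have "?L *v v \<in> f v" if "v \<in> U" for v
  proof -
    have "?L *v b \<in> f b" if b: "b \<in> C" for b
    proof (cases "b \<in> B")
      case True
      then show ?thesis using L[of b] B(1) b g(2) Lg by (auto simp: h_def)
    next
      case False
      have "f b \<in> range (coset V)" using f b C(2) by (auto simp: quot_hom_def)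
      then have "\<exists>p. p \<in> f b" using coset_self[OF V] by auto
      then have "(SOME p. p \<in> f b) \<in> f b" by (rule someI_ex)
      then show ?thesis using False b g(2) Lg by (simp add: h_def)
    qed
    then have "vec.span C \<subseteq> {v \<in> U. ?L *v v \<in> f v}"
      using C(2) by (intro vec.span_minimal quot_hom_lift_subspace[OF f U V]) auto
    then show ?thesis using that C(4) by auto
  qed
  ultimately show ?thesis by blast
qed

text \<open>Induction along the flag. If \<open>L\<close> lifts the first \<open>m\<close>
  components, compatibility puts \<open>L *v v\<close> into \<open>\<xi> (Suc m) v\<close> for
  \<open>v\<close> in the \<open>m\<close>-th space. The extension from \<open>extend_lift\<close>
  agrees with \<open>L\<close> on that space and therefore keeps all earlier lifts.\<close>

lemma E_fib_lin_sec:
  fixes x :: "'n::finite flag \<times> 'n flag"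
  assumes x: "x \<in> flags k d \<times> flags k d" and \<xi>: "\<xi> \<in> E_fib k x"
  obtains L where "\<xi> = lin_sec k L x"
proof -
  have F: "fst x \<in> flags k d" "snd x \<in> flags k d" using x by auto
  have sub: "vec.subspace (fst x j)" "vec.subspace (snd x j)" if "j \<in> {1..<k}" for j
    using flags_subspace[OF F(1), of j] flags_subspace[OF F(2), of j] that by auto
  have hom: "\<xi> j \<in> quot_hom (snd x j) (fst x j)" if "j \<in> {1..<k}" for j
    using \<xi> that by (auto simp: E_fib_def)
  have "m < k \<longrightarrow> (\<exists>L :: 'n cmat. \<forall>j\<in>{1..m}. \<forall>v\<in>snd x j. L *v v \<in> \<xi> j v)" for m
  proof (induction m)
    case (Suc m)
    show ?case
    proof
      assume m: "Suc m < k"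
      then have "m < k" by simp
      with Suc.IH obtain L :: "'n cmat" where "\<forall>j\<in>{1..m}. \<forall>v\<in>snd x j. L *v v \<in> \<xi> j v" by blast
      then have L: "L *v v \<in> \<xi> j v" if "j \<in> {1..m}" "v \<in> snd x j" for j v using that by blast
      have Sm: "Suc m \<in> {1..<k}" using m by auto
      \<comment> \<open>The flag has no member with index \<open>0\<close>, so the first step starts
        from the zero space.\<close>
      define K where "K = (if m = 0 then {0} else snd x m)"
      have K: "vec.subspace K" "K \<subseteq> snd x (Suc m)"
        using m sub(2)[of m] sub(2)[OF Sm] flags_mono[OF F(2), of m "Suc m"]
        by (auto simp: K_def vec.subspace_0 vec.subspace_single_0)
      have "L *v v \<in> \<xi> (Suc m) v" if v: "v \<in> K" for v
      proof (cases "m = 0")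
        case True
        then have "v = 0" using v by (simp add: K_def)
        have "vec.subspace {v \<in> snd x (Suc m). (L :: 'n cmat) *v v \<in> \<xi> (Suc m) v}"
          by (rule quot_hom_lift_subspace[OF hom[OF Sm] sub(2)[OF Sm] sub(1)[OF Sm]])
        from vec.subspace_0[OF this] \<open>v = 0\<close> show ?thesis by simp
      next
        case False
        then have m': "m \<in> {1..<k-1}" "m \<in> {1..<k}" "m \<in> {1..m}" and v': "v \<in> snd x m"
          using m v by (auto simp: K_def)
        have "\<xi> (Suc m) v = Qmap (fst x (Suc m)) (\<xi> m v)"
          using \<xi> m' v' by (auto simp: E_fib_def)
        moreover have "L *v v + 0 \<in> Qmap (fst x (Suc m)) (\<xi> m v)"
          using L[OF m'(3) v'] vec.subspace_0[OF sub(1)[OF Sm]] unfolding Qmap_def by blast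
        ultimately show ?thesis by simp
      qed
      from extend_lift[OF hom[OF Sm] sub(2)[OF Sm] sub(1)[OF Sm] K this]
      obtain L' where L': "\<And>v. v \<in> K \<Longrightarrow> L' *v v = L *v v"
        "\<And>v. v \<in> snd x (Suc m) \<Longrightarrow> L' *v v \<in> \<xi> (Suc m) v" by blast
      have "L' *v v \<in> \<xi> j v" if j: "j \<in> {1..Suc m}" and v: "v \<in> snd x j" for j v
      proof (cases "j = Suc m")
        case False
        then have j': "j \<in> {1..m}" using j by auto
        then have "v \<in> K" using v flags_mono[OF F(2), of j m] m by (auto simp: K_def)
        then show ?thesis using L[OF j' v] L'(1) by simp
      qed (use v L'(2) in simp)
      then show "\<exists>L :: 'n cmat. \<forall>j\<in>{1..Suc m}. \<forall>v\<in>snd x j. L *v v \<in> \<xi> j v" by blast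
    qed
  qed simp
  from this[of "k - 1"] have "\<exists>L :: 'n cmat. \<forall>j\<in>{1..<k}. \<forall>v\<in>snd x j. L *v v \<in> \<xi> j v"
    by (cases k) (auto simp: atLeastLessThanSuc_atLeastAtMost)
  then obtain L :: "'n cmat" where "\<forall>j\<in>{1..<k}. \<forall>v\<in>snd x j. L *v v \<in> \<xi> j v" by blast
  then have L: "L *v v \<in> \<xi> j v" if "j \<in> {1..<k}" "v \<in> snd x j" for j v using that by blast
  have "\<xi> j v = lin_sec k L x j v" if j: "j \<in> {1..<k}" and v: "v \<in> snd x j" for j v
  proof -
    have "\<xi> j v \<in> range (coset (fst x j))"
      using hom[OF j] v by (auto simp: quot_hom_def)
    then obtain w where w: "\<xi> j v = coset (fst x j) w" by blast
    then show ?thesis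
      using coset_eqI[OF sub(1)[OF j]] L[OF j v] j v by (simp add: lin_sec_def)
  qed
  moreover have "\<xi> j v = lin_sec k L x j v" if "j \<in> {1..<k}" "v \<notin> snd x j" for j v
    using hom[OF that(1)] that by (auto simp: quot_hom_def lin_sec_def)
  moreover have "\<xi> j = lin_sec k L x j" if "j \<notin> {1..<k}" for j
    using \<xi> that by (auto simp: E_fib_def lin_sec_def PiE_def extensional_def)
  ultimately have "\<xi> = lin_sec k L x" by (metis ext)
  then show thesis by (rule that)
qed

text \<open>Turns linearity in the fibre of \<open>E\<close> into linearity in the matrix, where
  that of the weight is evident.\<close>

lemma E_comb_lin_sec:
  fixes x :: "'n::finite flag \<times> 'n flag"
  assumes x: "x \<in> flags k d \<times> flags k d"
  shows "E_comb k x a (lin_sec k L x) b (lin_sec k L' x) =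
    lin_sec k (\<chi> r s. a * L $ r $ s + b * L' $ r $ s) x"
proof -
  have "{a *s p + b *s q + h | p q h. p \<in> coset V u \<and> q \<in> coset V w \<and> h \<in> V} = coset V (a *s u + b *s w)"
    if V: "vec.subspace V" for V :: "(complex^'n) set" and u w
  proof (intro set_eqI iffI)
    fix t assume "t \<in> coset V (a *s u + b *s w)"
    then have "t - (a *s u + b *s w) \<in> V" by (simp add: mem_coset_iff)
    moreover have "t = a *s u + b *s w + (t - (a *s u + b *s w))" by simp
    ultimately show "t \<in> {a *s p + b *s q + h | p q h. p \<in> coset V u \<and> q \<in> coset V w \<and> h \<in> V}"
      using coset_self[OF V] by blast
  next
    fix t assume "t \<in> {a *s p + b *s q + h | p q h. p \<in> coset V u \<and> q \<in> coset V w \<and> h \<in> V}"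
    then obtain p q h where t: "t = a *s p + b *s q + h" "p - u \<in> V" "q - w \<in> V" "h \<in> V"
      by (auto simp: mem_coset_iff)
    have "a *s (p - u) + b *s (q - w) + h \<in> V"
      by (intro vec.subspace_add vec.subspace_scale V t)
    then show "t \<in> coset V (a *s u + b *s w)"
      by (simp add: mem_coset_iff t(1) vec.scale_right_diff_distrib algebra_simps)
  qed
  moreover have "(\<chi> r s. a * L $ r $ s + b * L' $ r $ s) *v v = a *s (L *v v) + b *s (L' *v v)" for v
    by (simp add: vec_eq_iff matrix_vector_mult_def sum.distrib sum_distrib_left algebra_simps)
  moreover have "vec.subspace (fst x j)" if "j \<in> {1..<k}" for j
    using flags_subspace[of "fst x" k d j] x that by auto
  ultimately show ?thesis
    unfolding E_comb_def lin_sec_def by (intro restrict_ext) simp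
qed

text \<open>A constant matrix preserves smooth and holomorphic sections alike, so the regularity is
  kept as a parameter.\<close>

lemma lin_sec_E_sec:
  assumes U: "openXX k d U"
    and R: "\<And>U' s. openXX k d U' \<Longrightarrow> R U' s \<Longrightarrow> R U' (\<lambda>y. L *v s y)"
  shows "E_sec k d R U (lin_sec k L)"
  unfolding E_sec_def
proof (intro conjI ballI allI impI)
  show "lin_sec k L x \<in> E_fib k x" if "x \<in> U" for x
    using lin_sec_E_fib[of x k d] openXX_subset[OF U] that by blast
  fix j U' s
  assume j: "j \<in> {1..<k}" and s: "openXX k d U' \<and> U' \<subseteq> U \<and> H_sec R j U' s"
  have "R U' (\<lambda>y. L *v s y)" using R s by (simp add: H_sec_def)
  moreover have "lin_sec k L y j (s y) = coset (fst y j) (L *v s y)" if "y \<in> U'" for y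
    using s that j by (simp add: H_sec_def lin_sec_def)
  ultimately show "F_sec k d R j U' (\<lambda>y. lin_sec k L y j (s y))"
    unfolding F_sec_def using s by blast
qed

section \<open>The form of degree one\<close>

text \<open>The value at the identity of \<open>\<partial>bar\<close> of
  \<open>moved_proj V\<close>, along a tangent vector with first matrix \<open>A\<close>. It takes
  values in \<open>V\<close> and annihilates \<open>V\<close>, so it represents a map from
  \<open>\<complex>\<^sup>N/V\<close> to \<open>V\<close>.\<close>

definition gmat :: "(complex^'n) set \<Rightarrow> complex^'n^'n \<Rightarrow> complex^'n^'n" where
  "gmat V A = pmat V ** cadj A ** (mat 1 - pmat V)"

lemma gmat_mult:
  assumes "vec.subspace V"
  shows "gmat V A *v w = oproj V (cadj A *v (w - oproj V w))"
  by (simp add: gmat_def matrix_vector_mult_diff_rdistrib pmat_mult[OF assms] flip: matrix_vector_mul_assoc)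

text \<open>The inner factor \<open>mat 1 - pmat V\<close> kills the difference. This is what makes
  the choice of a representative of \<open>\<xi>\<^sub>i(v)\<close> immaterial.\<close>

lemma gmat_cong:
  assumes V: "vec.subspace V" and u: "u - w \<in> V"
  shows "gmat V A *v u = gmat V A *v w"
proof -
  have "gmat V A *v (u - w) = 0"
    by (simp add: gmat_mult[OF V] oproj_ident[OF V u] oproj_ident[OF V vec.subspace_0[OF V]])
  then show ?thesis by (simp add: vec.diff)
qed

lemma gmat_UNIV: "gmat UNIV A *v w = 0"
  using gmat_cong[of UNIV w 0 A] by simp

text \<open>If \<open>A\<close> preserves \<open>V\<close>, its adjoint preserves the orthogonal
  complement, which the outer projection kills. Hence matrices representing the zero tangent vector
  give zero.\<close>

lemma gmat_stab:
  assumes V: "vec.subspace V" and A: "\<And>v. v \<in> V \<Longrightarrow> A *v v \<in> V"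
  shows "gmat V A *v w = 0"
proof -
  have "w - oproj V w \<in> V\<^sup>\<bottom>" by (rule oproj_orth[OF V])
  then have "cadj A *v (w - oproj V w) \<in> V\<^sup>\<bottom>"
    using A by (auto simp: orthogonal_comp_iff simp flip: inner_cadj)
  then show ?thesis by (simp add: gmat_mult[OF V] oproj_eq_0[OF V])
qed

lemma gmat_antilinear:
  "gmat V (fst (mscale a M + mscale b M')) *v w = cnj a *s (gmat V (fst M) *v w) + cnj b *s (gmat V (fst M') *v w)"
proof -
  have "cadj (fst (mscale a M + mscale b M')) *v u = cnj a *s (cadj (fst M) *v u) + cnj b *s (cadj (fst M') *v u)" for u
    by (simp add: vec_eq_iff matrix_vector_mult_def sum.distrib sum_distrib_left algebra_simps)
  then show ?thesis
    by (simp add: gmat_def vec.add vec.scale flip: matrix_vector_mul_assoc)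
qed

lemma H_sec_holo_imp_smooth: "H_sec (holoXX k) j U s \<Longrightarrow> H_sec (smoothXX k) j U s"
  by (simp add: H_sec_def holoXX_def)

lemma dbar_vec_moved_proj:
  assumes V: "vec.subspace V" and f: "f differentiable (at one2)"
  shows "dbar_vec (\<lambda>a. moved_proj V (fst a) *v f a) one2 M =
    gmat V (fst M) *v f one2 + oproj V (dbar_vec f one2 M)"
  using dbar_vec_matrix_mult[OF smooth_on_imp_differentiable[OF smooth_moved_proj_fst[OF V] one2_GL2] f]
  by (simp add: dbar_mat_moved_proj[OF V] moved_proj_1[OF V] gmat_def pmat_mult[OF V])

lemma smooth_on_moved_proj_mult:
  fixes f :: "'n::finite cmat \<times> 'n cmat \<Rightarrow> complex^'n"
  assumes V: "vec.subspace V" and S: "open S" "one2 \<in> S" "S \<subseteq> GL2" and f: "smooth_on S f"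
  shows "smooth_on S (\<lambda>a. moved_proj V (fst a) *v f a)"
  by (intro smooth_on_matrix_vector_mult S smooth_on_subset[OF smooth_moved_proj_fst[OF V]] f)

context
  fixes k i :: nat and d :: "nat \<Rightarrow> nat"
  assumes i: "i \<in> {1..k}"
begin

text \<open>Treats \<open>i = k\<close> together with \<open>i < k\<close>: at \<open>i = k\<close>
  the component is the zero coset, with the zero function as its lift.\<close>

lemma E_component_lift:
  assumes U: "openXX k d U" "x \<in> U" and \<Xi>: "E_sec k d R U \<Xi>" and s: "H_sec R i U s"
    and R: "R U (\<lambda>y. 0)"
  obtains U' f where "openXX k d U'" "x \<in> U'" "U' \<subseteq> U" "R U' f"
    "\<And>y. y \<in> U' \<Longrightarrow> E_component k i y (\<Xi> y) (s y) = coset (fst y i) (f y)"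
proof (cases "i < k")
  case True
  then have "i \<in> {1..<k}" using i by simp
  then have "F_sec k d R i U (\<lambda>y. \<Xi> y i (s y))" using \<Xi> s U(1) unfolding E_sec_def by blast
  then obtain U' f where "openXX k d U'" "x \<in> U'" "U' \<subseteq> U" "R U' f"
    "\<forall>y\<in>U'. \<Xi> y i (s y) = coset (fst y i) (f y)" using U(2) unfolding F_sec_def by blast
  then show thesis using that[of U' f] True by (simp add: E_component_def)
next
  case False
  then show thesis using that[of U "\<lambda>y. 0"] U R by (simp add: E_component_def)
qed

text \<open>At the base flag itself, the vector of \<open>F i\<close> whose projection to
  \<open>F i\<close> is \<open>v\<close> can only be \<open>v\<close>.\<close>

lemma ex_hol_sec:
  fixes F :: "'n::finite flag"
  assumes F: "F \<in> flags k d" and v: "v \<in> F i"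
  obtains W s where "openX k d W" "F \<in> W" "hol (H_bundle k d i) W s" "s F = v"
proof (rule that[OF openX_frame_dom[OF i F] frame_dom_self[OF i F] hol_frame[OF i F]])
  have one: "invertible (mat 1 :: 'n cmat)" "act k (mat 1) F \<in> frame_dom k i F"
    using frame_dom_self[OF i F] by (auto simp: act_one[OF F] invertible_def intro!: exI[of _ "mat 1"])
  have "invertible (compress (pmat (F i)) (mat 1))"
    using act_frame_dom_iff[OF i F one(1)] one(2) by simp
  from frame_vec_unique[OF flags_subspace[OF F i] one(1) this, of v v]
  show "frame_vec (F i) v (F i) = v" using v by simp
qed

lemma hol_H_sec:
  assumes s: "hol (H_bundle k d i) W s" and U: "U \<subseteq> flags k d \<times> W"
  shows "H_sec (holoXX k) i U (\<lambda>y. s (snd y))"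
  using holoXX_subset[OF hol_snd(1)[OF i s] U] hol_snd(2)[OF i s] U
  by (auto simp: H_sec_def)

text \<open>For \<open>i = k\<close> the component is the coset of zero modulo \<open>UNIV\<close>,
  which contains every vector; thus \<open>L *v v\<close> is a representative in both cases.\<close>

lemma E_component_mem:
  assumes x: "x \<in> flags k d \<times> flags k d" and k: "fst x k = UNIV" and v: "v \<in> snd x i"
  shows "L *v v \<in> E_component k i x (lin_sec k L x) v"
  using i v coset_self[OF flags_subspace[of "fst x" k d i]] x k
  by (cases "i < k") (auto simp: E_component_def lin_sec_def mem_coset_iff)

text \<open>The derivative \<open>D\<close> of \<open>f\<close> enters as \<open>D - P D\<close>,
  which the outer projection kills, so only the derivative of the projector survives. This is why
  the value depends on \<open>f x\<close> alone although \<open>f\<close> is merely smooth.\<close>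

lemma dbarXX_orthogonal_part:
  fixes f :: "'n::finite flag \<times> 'n flag \<Rightarrow> complex^'n"
  assumes U: "openXX k d U" "x \<in> U" and f: "smoothXX k U f"
  shows "oproj (fst x i) (dbarXX k (\<lambda>y. f y - oproj (fst y i) (f y)) x M) =
    - (gmat (fst x i) (fst M) *v f x)"
proof -
  let ?V = "fst x i" and ?f = "\<lambda>a. f (act2 k a x)"
  have x: "x \<in> flags k d \<times> flags k d" using U openXX_subset by blast
  then have V: "vec.subspace ?V" using flags_subspace[of "fst x" k d i] i by auto
  interpret P: Vector_Spaces.linear "(*s)" "(*s)" "oproj ?V" by (rule oproj_linear[OF V])
  note S = openXX_imp_open[OF U] one2_pull[OF U]
  have smooth: "smooth_on (pull k U x) ?f" using f U(2) unfolding smoothXX_def by blast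
  have d: "?f differentiable (at one2)" "(\<lambda>a. moved_proj ?V (fst a) *v ?f a) differentiable (at one2)"
    using smooth_on_imp_differentiable[OF smooth S(2)]
      smooth_on_imp_differentiable[OF smooth_on_moved_proj_mult[OF V S _ smooth] S(2)] by auto
  have "dbarXX k (\<lambda>y. f y - oproj (fst y i) (f y)) x M =
      dbar_vec (\<lambda>a. ?f a - moved_proj ?V (fst a) *v ?f a) one2 M"
    unfolding dbarXX_def by (rule dbar_vec_cong[OF S]) (simp add: oproj_act[OF i x])
  also have "\<dots> = dbar_vec ?f one2 M - (gmat ?V (fst M) *v f x + oproj ?V (dbar_vec ?f one2 M))"
    using dbar_vec_diff[OF d] dbar_vec_moved_proj[OF V d(1)] by (simp add: act2_one[OF x])
  finally show ?thesis
    by (simp add: P.diff P.add gmat_mult[OF V] oproj_ident[OF V oproj_mem[OF V]])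
qed

end

locale flag_setting =
  fixes k i :: nat and d :: "nat \<Rightarrow> nat"
  assumes i: "i \<in> {1..k}"
begin

lemma gamma1_eq:
  fixes x :: "'n::finite flag \<times> 'n flag"
  assumes x: "x \<in> flags k d \<times> flags k d" and \<xi>: "\<xi> \<in> E_fib k x" and v: "v \<in> snd x i"
    and w: "w \<in> E_component k i x \<xi> v"
  shows "gamma1 k d i x \<xi> M v = gmat (fst x i) (fst M) *v w"
proof -
  let ?V = "fst x i"
  let ?phi = "\<lambda>\<Xi> s y. phi (fst y i) (E_component k i y (\<Xi> y) (s y))"
  have F: "fst x \<in> flags k d" "snd x \<in> flags k d" using x by auto
  have V: "vec.subspace ?V" using flags_subspace[OF F(1) i] .
  \<comment> \<open>All admissible sections give the same value: two lifts of
    \<open>\<xi>\<^sub>i(v)\<close> at \<open>x\<close> differ by an element of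
    \<open>?V\<close>.\<close>
  have *: "- oproj ?V (dbarXX k (?phi \<Xi> s) x M) = gmat ?V (fst M) *v w"
    if U: "openXX k d U" "x \<in> U" and \<Xi>: "E_sec k d (smoothXX k) U \<Xi>" "\<Xi> x = \<xi>"
      and s: "H_sec (smoothXX k) i U s" "s x = v" for U \<Xi> s
  proof -
    have "smoothXX k U (\<lambda>y. 0 :: complex^'n)" by (rule smoothXX_const[OF U(1)])
    then obtain U' f where U': "openXX k d U'" "x \<in> U'" "U' \<subseteq> U" and f: "smoothXX k U' f"
      and eq: "\<And>y. y \<in> U' \<Longrightarrow> E_component k i y (\<Xi> y) (s y) = coset (fst y i) (f y)"
      using E_component_lift[OF i U \<Xi>(1) s(1)] by metis
    have phi_eq: "?phi \<Xi> s y = f y - oproj (fst y i) (f y)" if "y \<in> U'" for y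
      using flags_subspace[of "fst y" k d i] i openXX_subset[OF U'(1)] that
      by (auto simp: eq phi_coset)
    have "dbarXX k (?phi \<Xi> s) x M = dbarXX k (\<lambda>y. f y - oproj (fst y i) (f y)) x M"
      unfolding dbarXX_def
      by (rule dbar_vec_cong[OF openXX_imp_open[OF U'(1,2)] one2_pull[OF U'(1,2)]])
         (rule phi_eq, simp)
    then have "- oproj ?V (dbarXX k (?phi \<Xi> s) x M) = gmat ?V (fst M) *v f x"
      by (simp add: dbarXX_orthogonal_part[OF i U'(1,2) f])
    moreover have "w \<in> coset ?V (f x)" using w eq[OF U'(2)] \<Xi>(2) s(2) by simp
    ultimately show ?thesis using gmat_cong[OF V] by (simp add: mem_coset_iff)
  qed
  \<comment> \<open>Admissible sections exist: \<open>\<xi>\<close> extends by a constant matrix,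
    \<open>v\<close> by a holomorphic section through it.\<close>
  obtain L where L: "\<xi> = lin_sec k L x" using E_fib_lin_sec[OF x \<xi>] .
  obtain W s where W: "openX k d W" "snd x \<in> W" "hol (H_bundle k d i) W s" "s (snd x) = v"
    using ex_hol_sec[OF i F(2) v] .
  let ?U = "flags k d \<times> W"
  have U: "openXX k d ?U" "x \<in> ?U" using openXX_Times(2)[OF W(1)] W(2) F by (auto simp: mem_Times_iff)
  have \<Xi>: "E_sec k d (smoothXX k) ?U (lin_sec k L)"
    by (rule lin_sec_E_sec[OF U(1)]) (rule smoothXX_matrix_mult)
  have s: "H_sec (smoothXX k) i ?U (\<lambda>y. s (snd y))"
    by (rule H_sec_holo_imp_smooth[OF hol_H_sec[OF i W(3)]]) simp
  show ?thesis
    unfolding gamma1_def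
  proof (rule the_equality)
    show "\<exists>U \<Xi> s. openXX k d U \<and> x \<in> U \<and> E_sec k d (smoothXX k) U \<Xi> \<and> \<Xi> x = \<xi> \<and>
      H_sec (smoothXX k) i U s \<and> s x = v \<and>
      gmat ?V (fst M) *v w = - oproj ?V (dbarXX k (?phi \<Xi> s) x M)"
      by (rule exI[of _ ?U], rule exI[of _ "lin_sec k L"], rule exI[of _ "\<lambda>y. s (snd y)"])
         (intro conjI U \<Xi> L[symmetric] s W(4) *[OF U \<Xi> L[symmetric] s W(4), symmetric])
  next
    fix y
    assume "\<exists>U \<Xi> s. openXX k d U \<and> x \<in> U \<and> E_sec k d (smoothXX k) U \<Xi> \<and> \<Xi> x = \<xi> \<and>
      H_sec (smoothXX k) i U s \<and> s x = v \<and> y = - oproj ?V (dbarXX k (?phi \<Xi> s) x M)"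
    then show "y = gmat ?V (fst M) *v w"
      by - (elim exE conjE, erule trans, rule *; assumption)
  qed
qed

lemma gamma1_lin_sec:
  fixes x :: "'n::finite flag \<times> 'n flag"
  assumes x: "x \<in> flags k d \<times> flags k d" and v: "v \<in> snd x i"
  shows "gamma1 k d i x (lin_sec k L x) M v = gmat (fst x i) (fst M) *v (L *v v)"
proof -
  have "fst x k = UNIV" using x by (auto simp: flags_def)
  then show ?thesis
    by (intro gamma1_eq[OF x lin_sec_E_fib[OF x] v] E_component_mem[OF i x _ v])
qed

lemma G_section_G_fib:
  fixes x :: "'n::finite flag \<times> 'n flag"
  assumes x: "x \<in> flags k d \<times> flags k d"
  shows "G_section k d i p q x \<in> G_fib k (H_bundle k d i) p q x"
proof -
  have F: "fst x \<in> flags k d" "snd x \<in> flags k d" using x by auto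
  have V: "vec.subspace (fst x i)" and V': "vec.subspace (snd x i)"
    using flags_subspace[OF F(1) i] flags_subspace[OF F(2) i] by auto
  interpret P: Vector_Spaces.linear "(*s)" "(*s)" "oproj (fst x i)" by (rule oproj_linear[OF V])
  \<comment> \<open>In the two bidegrees that carry a nonzero component, each group has at most one
    argument, so alternation is vacuous.\<close>
  consider "p = 0" "q = 0" | "p = 1" "q = 1" | "\<not> (p = 0 \<and> q = 0)" "\<not> (p = 1 \<and> q = 1)" by auto
  then show ?thesis
  proof cases
    case 1
    then show ?thesis
      by (auto simp: G_fib_def args_def G_section_def gamma0_def H_bundle_def oproj_mem[OF V] P.add P.scale)
  next
    case 3
    then have "G_section k d i p q x = (\<lambda>_ _ _. 0)" by (auto simp: G_section_def fun_eq_iff)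
    then show ?thesis by (auto simp: G_fib_def H_bundle_def vec.subspace_0[OF V])
  next
    case 2
    have mem: "gmat (fst x i) A *v w \<in> fst x i" for A w
      by (simp add: gmat_mult[OF V] oproj_mem[OF V])
    have stab: "gmat (fst x i) (fst M) *v w = 0" if "M \<in> stab2 k x" for M w
      using that i by (intro gmat_stab[OF V]) (auto simp: stab2_def)
    have sub: "a *s v + b *s w \<in> snd x i" if "v \<in> snd x i" "w \<in> snd x i" for a b v w
      by (intro vec.subspace_add vec.subspace_scale V' that)
    have comb: "(\<chi> r s. a * L $ r $ s + b * L' $ r $ s) *v v = a *s (L *v v) + b *s (L' *v v)"
      for a b and L L' :: "'n cmat" and v
      by (simp add: vec_eq_iff matrix_vector_mult_def sum.distrib sum_distrib_left algebra_simps)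
    show ?thesis
      unfolding G_fib_def
    proof (intro CollectI ballI, clarify)
      fix \<xi>s Ms v assume "(\<xi>s, Ms, v) \<in> args k (H_bundle k d i) p q x"
      then obtain \<xi> M where \<xi>: "\<xi>s = [\<xi>]" "\<xi> \<in> E_fib k x" and Ms: "Ms = [M]" and v: "v \<in> snd x i"
        using 2 by (auto simp: args_def H_bundle_def length_Suc_conv)
      obtain L where L: "\<xi> = lin_sec k L x" using E_fib_lin_sec[OF x \<xi>(2)] .
      have E: "gmat (fst x i) (fst M) *v ((\<chi> r s. a * L $ r $ s + b * L' $ r $ s) *v v) =
          a *s (gmat (fst x i) (fst M) *v (L *v v)) + b *s (gmat (fst x i) (fst M) *v (L' *v v))"
        for a b L'
        by (simp only: comb vec.add vec.scale)
      have lin: "gamma1 k d i x (E_comb k x a \<xi> b \<xi>') M v =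
          a *s gamma1 k d i x \<xi> M v + b *s gamma1 k d i x \<xi>' M v" if \<xi>': "\<xi>' \<in> E_fib k x" for a b \<xi>'
      proof -
        obtain L' where L': "\<xi>' = lin_sec k L' x" using E_fib_lin_sec[OF x \<xi>'] .
        show ?thesis by (simp only: L L' E_comb_lin_sec[OF x] gamma1_lin_sec[OF x v] E)
      qed
      show "G_section k d i p q x \<xi>s Ms v \<in> fib (H_bundle k d i) (fst x) \<and>
       (\<forall>a b. \<forall>w\<in>fib (H_bundle k d i) (snd x). G_section k d i p q x \<xi>s Ms (a *s v + b *s w) =
          a *s G_section k d i p q x \<xi>s Ms v + b *s G_section k d i p q x \<xi>s Ms w) \<and>
       (\<forall>j<p. \<forall>a b. \<forall>\<xi>\<in>E_fib k x. G_section k d i p q x (\<xi>s[j := E_comb k x a (\<xi>s ! j) b \<xi>]) Ms v =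
          a *s G_section k d i p q x \<xi>s Ms v + b *s G_section k d i p q x (\<xi>s[j := \<xi>]) Ms v) \<and>
       (\<forall>j<p. \<forall>l<p. j \<noteq> l \<and> \<xi>s ! j = \<xi>s ! l \<longrightarrow> G_section k d i p q x \<xi>s Ms v = 0) \<and>
       (\<forall>j<q. \<forall>a b M. G_section k d i p q x \<xi>s (Ms[j := mscale a (Ms ! j) + mscale b M]) v =
            cnj a *s G_section k d i p q x \<xi>s Ms v + cnj b *s G_section k d i p q x \<xi>s (Ms[j := M]) v) \<and>
       (\<forall>j<q. \<forall>l<q. j \<noteq> l \<and> Ms ! j = Ms ! l \<longrightarrow> G_section k d i p q x \<xi>s Ms v = 0) \<and>
       (\<forall>j<q. Ms ! j \<in> stab2 k x \<longrightarrow> G_section k d i p q x \<xi>s Ms v = 0)"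
      proof (intro conjI allI impI ballI)
        fix j a b \<xi>' assume "j < p" "\<xi>' \<in> E_fib k x"
        then show "G_section k d i p q x (\<xi>s[j := E_comb k x a (\<xi>s ! j) b \<xi>']) Ms v =
          a *s G_section k d i p q x \<xi>s Ms v + b *s G_section k d i p q x (\<xi>s[j := \<xi>']) Ms v"
          using 2 lin by (simp add: G_section_def \<xi>(1) Ms)
      next
        fix j a b M' assume "j < q"
        then have "j = 0" using 2 by simp
        show "G_section k d i p q x \<xi>s (Ms[j := mscale a (Ms ! j) + mscale b M']) v =
            cnj a *s G_section k d i p q x \<xi>s Ms v + cnj b *s G_section k d i p q x \<xi>s (Ms[j := M']) v"
          using 2 gmat_antilinear[of "fst x i" a M b M' "L *v v"]
          by (simp add: G_section_def \<xi>(1) Ms \<open>j = 0\<close> L gamma1_lin_sec[OF x v] del: fst_add)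
      next
        fix a b w assume "w \<in> fib (H_bundle k d i) (snd x)"
        then have w: "w \<in> snd x i" by (simp add: H_bundle_def)
        show "G_section k d i p q x \<xi>s Ms (a *s v + b *s w) =
          a *s G_section k d i p q x \<xi>s Ms v + b *s G_section k d i p q x \<xi>s Ms w"
          using 2 by (simp add: G_section_def \<xi>(1) Ms L gamma1_lin_sec[OF x] v w sub vec.add vec.scale)
      qed (use 2 in \<open>auto simp: G_section_def \<xi>(1) Ms L gamma1_lin_sec[OF x v] stab mem H_bundle_def\<close>)
    qed
  qed
qed

end

section \<open>The operator \<open>\<nabla>\<^sub>\<eta>\<close> on the weight\<close>

lemma E_sec_subset: "E_sec k d R U \<Xi> \<Longrightarrow> U' \<subseteq> U \<Longrightarrow> E_sec k d R U' \<Xi>"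
  unfolding E_sec_def by (meson subset_iff subset_trans)

lemma smooth_cadj_matrix_inv_fst: "smooth_on GL2 (\<lambda>a. cadj (matrix_inv (fst a)))"
  by (intro smooth_on_cadj smooth_on_matrix_inv smooth_on_fst open_GL2) (simp add: GL2_def)

text \<open>Differentiates the factor that the pulled back form acquires from the tangent vector
  \<open>M' a\<^sup>-\<^sup>1\<close>, whose adjoint enters \<open>gmat\<close>.\<close>

lemma dbar_mat_cadj_matrix_inv_fst:
  fixes M :: "'n::finite cmat \<times> 'n cmat"
  shows "dbar_mat (\<lambda>a. cadj (matrix_inv (fst a))) one2 M = - cadj (fst M)"
proof -
  have "cadj (fst a) ** cadj (matrix_inv (fst a)) = mat 1" if "a \<in> GL2" for a :: "'n cmat \<times> 'n cmat"
    using that matrix_inv_works(2)[of "fst a"] by (simp add: GL2_def flip: cadj_mult)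
  from dbar_mat_inverse[OF open_GL2 one2_GL2 this
      smooth_on_imp_differentiable[OF smooth_on_cadj[OF open_GL2 smooth_on_fst[OF open_GL2]] one2_GL2]
      smooth_on_imp_differentiable[OF smooth_cadj_matrix_inv_fst one2_GL2]]
  show ?thesis by (simp add: dbar_mat_cadj_fst)
qed

context flag_setting
begin

text \<open>In the applications \<open>T\<close> is given by definite descriptions, so its
  regularity is inherited from a closed formula \<open>T'\<close> that agrees with it near the
  identity.\<close>

lemma dbar_sec_eqI:
  fixes x :: "'n::finite flag \<times> 'n flag"
  assumes U: "openXX k d U" "x \<in> U" and T': "smooth_on (pull k U x) T'"
    and T: "\<And>a. a \<in> pull k U x \<Longrightarrow> T a = T' a" "\<And>a. a \<in> pull k U x \<Longrightarrow> T a \<in> fst (act2 k a x) i"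
  shows "dbar_sec k d (H_bundle k d i) x T M = dbar_vec T' one2 M"
proof -
  note S = openXX_imp_open[OF U] one2_pull[OF U]
  have x: "x \<in> flags k d \<times> flags k d" using U openXX_subset by blast
  have "smooth_on (pull k U x) T" by (rule smooth_on_cong[OF S(1) T']) (simp add: T(1))
  then have "dbar_sec k d (H_bundle k d i) x T M = dbar_vec T one2 M"
    by (intro dbar_sec_eq[OF i x S _ _ T(2)]) auto
  also have "\<dots> = dbar_vec T' one2 M" by (rule dbar_vec_cong[OF S T(1)])
  finally show ?thesis .
qed

text \<open>The existence of holomorphic extensions is settled here once; what remains is to compute
  the value for arbitrary ones. The domains of the sections of \<open>E\<close> and of
  \<open>H\<^sub>i\<close> are merged into one open set.\<close>

lemma dbar_G_eqI:
  fixes x :: "'n::finite flag \<times> 'n flag"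
  assumes x: "x \<in> flags k d \<times> flags k d" and \<xi>s: "set \<xi>s \<subseteq> E_fib k x" and v: "v \<in> snd x i"
    and val: "\<And>U \<Xi>s s. openXX k d U \<Longrightarrow> x \<in> U \<Longrightarrow> \<forall>\<Xi>\<in>set \<Xi>s. E_sec k d (holoXX k) U \<Xi> \<Longrightarrow>
       map (\<lambda>\<Xi>. \<Xi> x) \<Xi>s = \<xi>s \<Longrightarrow> H_sec (holoXX k) i U (\<lambda>y. s (snd y)) \<Longrightarrow> s (snd x) = v \<Longrightarrow>
       (-1) ^ p *s (\<Sum>m<length Ms. (-1) ^ m *s
         dbar_sec k d (H_bundle k d i) x
           (\<lambda>a. g (act2 k a x) (map (\<lambda>\<Xi>. \<Xi> (act2 k a x)) \<Xi>s)
                  (map (\<lambda>M. mmult2 M (minv2 a)) (take m Ms @ drop (Suc m) Ms)) (s (snd (act2 k a x))))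
           (Ms ! m)) = y"
  shows "dbar_G k d (H_bundle k d i) p g x \<xi>s Ms v = y"
proof -
  let ?Y = "\<lambda>\<Xi>s s. (-1) ^ p *s (\<Sum>m<length Ms. (-1) ^ m *s
         dbar_sec k d (H_bundle k d i) x
           (\<lambda>a. g (act2 k a x) (map (\<lambda>\<Xi>. \<Xi> (act2 k a x)) \<Xi>s)
                  (map (\<lambda>M. mmult2 M (minv2 a)) (take m Ms @ drop (Suc m) Ms)) (s (snd (act2 k a x))))
           (Ms ! m))"
  have F: "snd x \<in> flags k d" using x by auto
  have *: "?Y \<Xi>s s = y"
    if U: "openXX k d U" "x \<in> U" and \<Xi>s: "\<forall>\<Xi>\<in>set \<Xi>s. E_sec k d (holoXX k) U \<Xi>" "map (\<lambda>\<Xi>. \<Xi> x) \<Xi>s = \<xi>s"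
      and W: "openX k d W" "snd x \<in> W" and s: "hol (H_bundle k d i) W s" "s (snd x) = v" for U \<Xi>s W s
  proof (rule val[of "U \<inter> (flags k d \<times> W)"])
    show "openXX k d (U \<inter> (flags k d \<times> W))" by (intro openXX_Int U openXX_Times W)
    show "x \<in> U \<inter> (flags k d \<times> W)" using U(2) W(2) x by (auto simp: mem_Times_iff)
    show "\<forall>\<Xi>\<in>set \<Xi>s. E_sec k d (holoXX k) (U \<inter> (flags k d \<times> W)) \<Xi>"
      using \<Xi>s(1) E_sec_subset by blast
    show "H_sec (holoXX k) i (U \<inter> (flags k d \<times> W)) (\<lambda>y. s (snd y))"
      by (rule hol_H_sec[OF i s(1)]) simp
  qed (use \<Xi>s s in auto)
  obtain W s where W: "openX k d W" "snd x \<in> W" and s: "hol (H_bundle k d i) W s" "s (snd x) = v"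
    using ex_hol_sec[OF i F v] .
  have "\<forall>\<xi>\<in>set \<xi>s. \<exists>L. lin_sec k L x = \<xi>" using E_fib_lin_sec[OF x] \<xi>s by (metis subsetD)
  then obtain l where l: "\<And>\<xi>. \<xi> \<in> set \<xi>s \<Longrightarrow> lin_sec k (l \<xi>) x = \<xi>" by metis
  let ?\<Xi>s = "map (\<lambda>\<xi>. lin_sec k (l \<xi>)) \<xi>s"
  have "E_sec k d (holoXX k) (flags k d \<times> flags k d) (lin_sec k L)" for L :: "'n cmat"
    by (rule lin_sec_E_sec[OF openXX_flags]) (rule holoXX_matrix_mult)
  then have \<Xi>s: "\<forall>\<Xi>\<in>set ?\<Xi>s. E_sec k d (holoXX k) (flags k d \<times> flags k d) \<Xi>" by auto
  have \<Xi>s': "map (\<lambda>\<Xi>. \<Xi> x) ?\<Xi>s = \<xi>s" using l by (simp add: map_idI)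
  show ?thesis
    unfolding dbar_G_def
  proof (rule the_equality)
    show "\<exists>U \<Xi>s W s. openXX k d U \<and> x \<in> U \<and> (\<forall>\<Xi>\<in>set \<Xi>s. E_sec k d (holoXX k) U \<Xi>) \<and>
      map (\<lambda>\<Xi>. \<Xi> x) \<Xi>s = \<xi>s \<and> openX k d W \<and> snd x \<in> W \<and> hol (H_bundle k d i) W s \<and> s (snd x) = v \<and>
      y = ?Y \<Xi>s s"
      by (rule exI[of _ "flags k d \<times> flags k d"], rule exI[of _ ?\<Xi>s], rule exI[of _ W], rule exI[of _ s])
         (intro conjI openXX_flags x \<Xi>s \<Xi>s' W s *[OF openXX_flags x \<Xi>s \<Xi>s' W s, symmetric])
  next
    fix y'
    assume "\<exists>U \<Xi>s W s. openXX k d U \<and> x \<in> U \<and> (\<forall>\<Xi>\<in>set \<Xi>s. E_sec k d (holoXX k) U \<Xi>) \<and>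
      map (\<lambda>\<Xi>. \<Xi> x) \<Xi>s = \<xi>s \<and> openX k d W \<and> snd x \<in> W \<and> hol (H_bundle k d i) W s \<and> s (snd x) = v \<and>
      y' = ?Y \<Xi>s s"
    then show "y' = y"
      by - (elim exE conjE, erule trans, rule *; assumption)
  qed
qed

text \<open>Even for the zero form an argument is due, because both operators involved are definite
  descriptions.\<close>

lemma dbar_G_zero:
  fixes x :: "'n::finite flag \<times> 'n flag"
  assumes x: "x \<in> flags k d \<times> flags k d" and \<xi>s: "set \<xi>s \<subseteq> E_fib k x" and v: "v \<in> snd x i"
  shows "dbar_G k d (H_bundle k d i) p (\<lambda>_ _ _ _. 0) x \<xi>s Ms v = 0"
proof (rule dbar_G_eqI[OF x \<xi>s v])
  have "(0 :: complex^'n) \<in> fst (act2 k a x) i" if "a \<in> pull k (flags k d \<times> flags k d) x" for a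
    using that i by (auto simp: act2_def intro!: vec.subspace_0 flags_subspace[of _ k d])
  then have "dbar_sec k d (H_bundle k d i) x (\<lambda>a. 0) M = 0" for M
    using dbar_sec_eqI[OF openXX_flags x smooth_on_const[OF openXX_imp_open[OF openXX_flags x]], of "\<lambda>a. 0" 0 M]
    by simp
  then show "(-1) ^ p *s (\<Sum>m<length Ms. (-1) ^ m *s dbar_sec k d (H_bundle k d i) x (\<lambda>a. 0) (Ms ! m)) = 0"
    by simp
qed

text \<open>With a holomorphic extension of \<open>v\<close> only the derivative of the projector
  contributes, and that is \<open>gmat\<close>.\<close>

lemma dbar_G_gamma0:
  fixes x :: "'n::finite flag \<times> 'n flag"
  assumes x: "x \<in> flags k d \<times> flags k d" and v: "v \<in> snd x i"
  shows "dbar_G k d (H_bundle k d i) 0 (G_section k d i 0 0) x [] [M] v = gmat (fst x i) (fst M) *v v"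
proof (rule dbar_G_eqI[OF x _ v])
  fix U and \<Xi>s :: "('n flag \<times> 'n flag \<Rightarrow> 'n efib) list" and s :: "'n flag \<Rightarrow> complex^'n"
  assume U: "openXX k d U" "x \<in> U" and "map (\<lambda>\<Xi>. \<Xi> x) \<Xi>s = []"
    and s: "H_sec (holoXX k) i U (\<lambda>y. s (snd y))" "s (snd x) = v"
  let ?s = "\<lambda>a. s (snd (act2 k a x))"
  let ?T = "\<lambda>a. G_section k d i 0 0 (act2 k a x) [] [] (?s a)"
  have V: "vec.subspace (fst x i)" using x i flags_subspace[of "fst x" k d i] by auto
  have h: "holoXX k U (\<lambda>y. s (snd y))" using s by (simp add: H_sec_def)
  have smooth: "smooth_on (pull k U x) ?s"
    using h U(2) by (simp only: holoXX_def smoothXX_def)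
  have "dbar_vec ?s one2 M = 0"
    using h U(2) by (simp only: holoXX_def dbarXX_def)
  moreover have "dbar_sec k d (H_bundle k d i) x ?T M =
      dbar_vec (\<lambda>a. moved_proj (fst x i) (fst a) *v ?s a) one2 M"
  proof (rule dbar_sec_eqI[OF U])
    show "smooth_on (pull k U x) (\<lambda>a. moved_proj (fst x i) (fst a) *v ?s a)"
      by (rule smooth_on_moved_proj_mult[OF V openXX_imp_open[OF U] one2_pull[OF U] _ smooth]) auto
    fix a assume a: "a \<in> pull k U x"
    show "?T a = moved_proj (fst x i) (fst a) *v ?s a"
      using oproj_act[OF i x, of a] a by (simp add: G_section_def gamma0_def)
    have "act2 k a x \<in> flags k d \<times> flags k d" using a openXX_subset[OF U(1)] by blast
    then have "vec.subspace (fst (act2 k a x) i)" using i by (auto simp: act2_def intro: flags_subspace)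
    then show "?T a \<in> fst (act2 k a x) i"
      using oproj_mem by (auto simp: G_section_def gamma0_def)
  qed
  ultimately have "dbar_sec k d (H_bundle k d i) x ?T M = gmat (fst x i) (fst M) *v v"
    using dbar_vec_moved_proj[OF V smooth_on_imp_differentiable[OF smooth one2_pull[OF U]], of M]
      oproj_ident[OF V vec.subspace_0[OF V]] s(2) by (simp add: act_one[of "snd x" k d] x[unfolded mem_Times_iff])
  then show "(-1) ^ 0 *s (\<Sum>m<length [M]. (-1) ^ m *s
       dbar_sec k d (H_bundle k d i) x
         (\<lambda>a. G_section k d i 0 0 (act2 k a x) (map (\<lambda>\<Xi>. \<Xi> (act2 k a x)) \<Xi>s)
                (map (\<lambda>M. mmult2 M (minv2 a)) (take m [M] @ drop (Suc m) [M])) (s (snd (act2 k a x))))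
         ([M] ! m)) = gmat (fst x i) (fst M) *v v"
    using \<open>map (\<lambda>\<Xi>. \<Xi> x) \<Xi>s = []\<close> by simp
qed simp

text \<open>\<open>T\<close> is the closed form of \<open>gamma1\<close> at
  \<open>act2 k a x\<close> on a tangent vector with first matrix
  \<open>A a\<^sup>-\<^sup>1\<close>. The outer projector, the inverse adjoint and the inner
  projector contribute; the first two combine by
  \<open>P M* (1 - P) A* - P M* A* = - P M* P A*\<close>.\<close>

lemma dbar_gamma1_pullback:
  fixes x :: "'n::finite flag \<times> 'n flag" and A :: "'n cmat"
  assumes U: "openXX k d U" "x \<in> U" and f: "holoXX k U f"
  defines "V \<equiv> fst x i"
  defines "T \<equiv> \<lambda>a. moved_proj V (fst a) *v (cadj (matrix_inv (fst a)) *v (cadj A *v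
    (f (act2 k a x) - moved_proj V (fst a) *v f (act2 k a x))))"
  shows "smooth_on (pull k U x) T"
    and "dbar_vec T one2 M =
      - oproj V (cadj (fst M) *v oproj V (cadj A *v (f x - oproj V (f x))))
      - oproj V (cadj A *v oproj V (cadj (fst M) *v (f x - oproj V (f x))))"
proof -
  let ?f = "\<lambda>a. f (act2 k a x)"
  let ?w = "\<lambda>a. ?f a - moved_proj V (fst a) *v ?f a"
  let ?I = "\<lambda>a. cadj (matrix_inv (fst a))"
  have x: "x \<in> flags k d \<times> flags k d" using U openXX_subset by blast
  then have V: "vec.subspace V" unfolding V_def using i flags_subspace[of "fst x" k d i] by auto
  interpret P: Vector_Spaces.linear "(*s)" "(*s)" "oproj V" by (rule oproj_linear[OF V])
  note S = openXX_imp_open[OF U] one2_pull[OF U]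
  have f': "smooth_on (pull k U x) ?f" using f U(2) by (simp only: holoXX_def smoothXX_def)
  have df: "dbar_vec ?f one2 M = 0" using f U(2) by (simp only: holoXX_def dbarXX_def)
  have \<Pi>f: "smooth_on (pull k U x) (\<lambda>a. moved_proj V (fst a) *v ?f a)"
    by (rule smooth_on_moved_proj_mult[OF V S _ f']) auto
  have w: "smooth_on (pull k U x) ?w" by (intro smooth_on_diff S f' \<Pi>f)
  have Aw: "smooth_on (pull k U x) (\<lambda>a. cadj A *v ?w a)"
    by (rule smooth_on_matrix_vector_mult[OF S(1) smooth_on_const[OF S(1)] w])
  have I: "smooth_on (pull k U x) ?I" by (rule smooth_on_subset[OF smooth_cadj_matrix_inv_fst]) auto
  have IAw: "smooth_on (pull k U x) (\<lambda>a. ?I a *v (cadj A *v ?w a))"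
    by (rule smooth_on_matrix_vector_mult[OF S(1) I Aw])
  show "smooth_on (pull k U x) T"
    unfolding T_def by (rule smooth_on_moved_proj_mult[OF V S _ IAw]) auto
  note D = smooth_on_imp_differentiable[OF _ S(2)]
  have w1: "?w one2 = f x - oproj V (f x)"
    by (simp add: act2_one[OF x] moved_proj_1[OF V] pmat_mult[OF V])
  have "dbar_vec (\<lambda>a. moved_proj V (fst a) *v ?f a) one2 M = gmat V (fst M) *v f x"
    using dbar_vec_moved_proj[OF V D[OF f'], of M] by (simp add: df act2_one[OF x] P.zero)
  then have dw: "dbar_vec ?w one2 M = - oproj V (cadj (fst M) *v ?w one2)"
    unfolding w1 using dbar_vec_diff[OF D[OF f'] D[OF \<Pi>f], of M] by (simp add: df gmat_mult[OF V])
  have "dbar_vec (\<lambda>a. cadj A *v ?w a) one2 M = - (cadj A *v oproj V (cadj (fst M) *v ?w one2))"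
    using dbar_vec_matrix_mult[OF differentiable_const D[OF w], of "cadj A" M] dw
    by (simp add: vec.neg)
  then have dIAw: "dbar_vec (\<lambda>a. ?I a *v (cadj A *v ?w a)) one2 M =
      - (cadj (fst M) *v (cadj A *v ?w one2)) - cadj A *v oproj V (cadj (fst M) *v ?w one2)"
    using dbar_vec_matrix_mult[OF D[OF I] D[OF Aw], of M]
    by (simp add: dbar_mat_cadj_matrix_inv_fst matrix_vector_minus_left)
  have "dbar_vec T one2 M = gmat V (fst M) *v (cadj A *v ?w one2) +
      oproj V (dbar_vec (\<lambda>a. ?I a *v (cadj A *v ?w a)) one2 M)"
    unfolding T_def using dbar_vec_moved_proj[OF V D[OF IAw], of M] by simp
  then show "dbar_vec T one2 M =
      - oproj V (cadj (fst M) *v oproj V (cadj A *v (f x - oproj V (f x))))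
      - oproj V (cadj A *v oproj V (cadj (fst M) *v (f x - oproj V (f x))))"
    unfolding dIAw w1 by (simp add: gmat_mult[OF V] vec.diff P.diff P.neg)
qed

text \<open>Differentiating along one matrix the form evaluated on the other gives a symmetric
  expression, so the alternating sum vanishes.\<close>

lemma dbar_G_gamma1:
  fixes x :: "'n::finite flag \<times> 'n flag"
  assumes x: "x \<in> flags k d \<times> flags k d" and \<xi>: "\<xi> \<in> E_fib k x" and v: "v \<in> snd x i"
  shows "dbar_G k d (H_bundle k d i) 1 (G_section k d i 1 1) x [\<xi>] [M, M'] v = 0"
proof (rule dbar_G_eqI[OF x _ v])
  fix U and \<Xi>s :: "('n flag \<times> 'n flag \<Rightarrow> 'n efib) list" and s :: "'n flag \<Rightarrow> complex^'n"
  assume U: "openXX k d U" "x \<in> U" and \<Xi>s: "\<forall>\<Xi>\<in>set \<Xi>s. E_sec k d (holoXX k) U \<Xi>" "map (\<lambda>\<Xi>. \<Xi> x) \<Xi>s = [\<xi>]"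
    and s: "H_sec (holoXX k) i U (\<lambda>y. s (snd y))"
  obtain \<Xi> where \<Xi>: "\<Xi>s = [\<Xi>]" "E_sec k d (holoXX k) U \<Xi>" using \<Xi>s by auto
  have "holoXX k U (\<lambda>y. 0 :: complex^'n)"
    using smoothXX_const[OF U(1)] by (simp add: holoXX_def dbarXX_def)
  from E_component_lift[OF i U \<Xi>(2) s this]
  obtain U' f where U': "openXX k d U'" "x \<in> U'" "U' \<subseteq> U" and f: "holoXX k U' f"
    and eq: "\<And>y. y \<in> U' \<Longrightarrow> E_component k i y (\<Xi> y) (s (snd y)) = coset (fst y i) (f y)" by metis
  let ?V = "fst x i"
  let ?T = "\<lambda>M' a. G_section k d i 1 1 (act2 k a x) [\<Xi> (act2 k a x)] [mmult2 M' (minv2 a)] (s (snd (act2 k a x)))"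
  \<comment> \<open>Both matrices are generalized here, so that the formula serves for either term
    of the alternating sum.\<close>
  have dT: "dbar_sec k d (H_bundle k d i) x (?T M') M =
      - oproj ?V (cadj (fst M) *v oproj ?V (cadj (fst M') *v (f x - oproj ?V (f x))))
      - oproj ?V (cadj (fst M') *v oproj ?V (cadj (fst M) *v (f x - oproj ?V (f x))))" for M M'
  proof -
    note D = dbar_gamma1_pullback[OF U'(1,2) f, of "fst M'"]
    have val: "?T M' a = moved_proj ?V (fst a) *v (cadj (matrix_inv (fst a)) *v (cadj (fst M') *v
        (f (act2 k a x) - moved_proj ?V (fst a) *v f (act2 k a x)))) \<and> ?T M' a \<in> fst (act2 k a x) i"
      if a: "a \<in> pull k U' x" for a
    proof -
      let ?y = "act2 k a x"
      have y: "?y \<in> flags k d \<times> flags k d" "?y \<in> U'" using a openXX_subset[OF U'(1)] by auto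
      have V: "vec.subspace (fst ?y i)" using y(1) i by (auto simp: act2_def intro: flags_subspace)
      have "\<Xi> ?y \<in> E_fib k ?y" "s (snd ?y) \<in> snd ?y i"
        using y(2) U'(3) \<Xi>(2) s unfolding E_sec_def H_sec_def by blast+
      moreover have "f ?y \<in> E_component k i ?y (\<Xi> ?y) (s (snd ?y))"
        using eq[OF y(2)] coset_self[OF V] by blast
      ultimately have "?T M' a = gmat (fst ?y i) (fst M' ** matrix_inv (fst a)) *v f ?y"
        using gamma1_eq[OF y(1), of "\<Xi> ?y" "s (snd ?y)" "f ?y" "mmult2 M' (minv2 a)"]
        by (simp add: G_section_def mmult2_def minv2_def)
      then have "?T M' a = oproj (fst ?y i) (cadj (fst M' ** matrix_inv (fst a)) *v (f ?y - oproj (fst ?y i) (f ?y)))"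
        by (simp only: gmat_mult[OF V])
      moreover from this have "?T M' a \<in> fst ?y i" by (simp only: oproj_mem[OF V])
      ultimately show ?thesis
        using oproj_act[OF i x, of a] a by (simp add: cadj_mult matrix_vector_mul_assoc)
    qed
    show ?thesis
      unfolding D(2)[symmetric] by (rule dbar_sec_eqI[OF U'(1,2) D(1)]) (use val in blast)+
  qed
  have "(\<Sum>m<2. (-1) ^ m *s dbar_sec k d (H_bundle k d i) x
         (\<lambda>a. G_section k d i 1 1 (act2 k a x) [\<Xi> (act2 k a x)]
                (map (\<lambda>M. mmult2 M (minv2 a)) (take m [M, M'] @ drop (Suc m) [M, M'])) (s (snd (act2 k a x))))
         ([M, M'] ! m)) =
      dbar_sec k d (H_bundle k d i) x (?T M') M - dbar_sec k d (H_bundle k d i) x (?T M) M'"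
    by (simp add: numeral_2_eq_2)
  also have "\<dots> = 0" unfolding dT by simp
  finally show "(-1) ^ 1 *s (\<Sum>m<length [M, M']. (-1) ^ m *s
       dbar_sec k d (H_bundle k d i) x
         (\<lambda>a. G_section k d i 1 1 (act2 k a x) (map (\<lambda>\<Xi>. \<Xi> (act2 k a x)) \<Xi>s)
                (map (\<lambda>M. mmult2 M (minv2 a)) (take m [M, M'] @ drop (Suc m) [M, M'])) (s (snd (act2 k a x))))
         ([M, M'] ! m)) = 0"
    by (simp add: \<Xi>(1) numeral_2_eq_2)
qed (use \<xi> in simp)

lemma G_section_smooth:
  "G_smooth k d (H_bundle k d i :: ('n::finite, 'n) vbundle) p q (G_section k d i p q)"
  unfolding G_smooth_def
proof (intro conjI ballI allI impI)
  fix x :: "'n flag \<times> 'n flag" assume "x \<in> flags k d \<times> flags k d"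
  then show "G_section k d i p q x \<in> G_fib k (H_bundle k d i) p q x" by (rule G_section_G_fib)
next
  fix U and \<Xi>s :: "('n flag \<times> 'n flag \<Rightarrow> 'n efib) list" and Ms :: "('n cmat \<times> 'n cmat) list"
    and s :: "'n flag \<times> 'n flag \<Rightarrow> complex^'n"
  assume *: "openXX k d U \<and> length \<Xi>s = p \<and> (\<forall>\<Xi>\<in>set \<Xi>s. E_sec k d (smoothXX k) U \<Xi>) \<and>
    length Ms = q \<and> smooth_sec k d (H_bundle k d i) snd U s"
  let ?g = "\<lambda>x. G_section k d i p q x (map (\<lambda>\<Xi>. \<Xi> x) \<Xi>s) Ms (s x)"
  have "\<exists>U'. openXX k d U' \<and> x \<in> U' \<and> U' \<subseteq> U \<and> smoothXX k U' ?g \<and> (\<forall>y\<in>U'. ?g y \<in> fst y i)"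
    if x: "x \<in> U" for x
  proof -
    obtain U' where U': "openXX k d U'" "x \<in> U'" "U' \<subseteq> U" and s: "H_sec (smoothXX k) i U' s"
      using smooth_secD[OF i _ x] * by blast
    have sub: "vec.subspace (fst y i)" if "openXX k d W" "y \<in> W" for W and y :: "'n flag \<times> 'n flag"
    proof -
      have "y \<in> flags k d \<times> flags k d" using openXX_subset[OF that(1)] that(2) by blast
      then show ?thesis using i by (auto intro: flags_subspace)
    qed
    consider "p = 0" "q = 0" | "p = 1" "q = 1" | "\<not> (p = 0 \<and> q = 0)" "\<not> (p = 1 \<and> q = 1)" by auto
    then show ?thesis
    proof cases
      case 1
      have g: "?g = (\<lambda>y. oproj (fst y i) (s y))" using 1 by (simp add: G_section_def gamma0_def)
      have "smoothXX k U' ?g" unfolding g by (rule smoothXX_oproj[OF i U'(1)]) (use s in \<open>simp add: H_sec_def\<close>)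
      moreover have "?g y \<in> fst y i" if "y \<in> U'" for y
        using fun_cong[OF g, of y] oproj_mem[OF sub[OF U'(1) that]] by simp
      ultimately show ?thesis using U' by blast
    next
      case 3
      then have g: "?g = (\<lambda>y. 0)" by (auto simp: G_section_def)
      have "smoothXX k U' ?g" unfolding g by (rule smoothXX_const[OF U'(1)])
      moreover have "?g y \<in> fst y i" if "y \<in> U'" for y
        using fun_cong[OF g, of y] vec.subspace_0[OF sub[OF U'(1) that]] by simp
      ultimately show ?thesis using U' by blast
    next
      case 2
      obtain \<Xi> M where \<Xi>: "\<Xi>s = [\<Xi>]" "E_sec k d (smoothXX k) U' \<Xi>" and M: "Ms = [M]"
        using * 2 E_sec_subset[OF _ U'(3)] by (auto simp: length_Suc_conv)
      have "smoothXX k U' (\<lambda>y. 0 :: complex^'n)" by (rule smoothXX_const[OF U'(1)])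
      from E_component_lift[OF i U'(1,2) \<Xi>(2) s this]
      obtain U'' f where U'': "openXX k d U''" "x \<in> U''" "U'' \<subseteq> U'" and f: "smoothXX k U'' f"
        and eq: "\<And>y. y \<in> U'' \<Longrightarrow> E_component k i y (\<Xi> y) (s y) = coset (fst y i) (f y)" by metis
      \<comment> \<open>\<open>gmat\<close> is unfolded into two projections to the moving space and
        one constant matrix, so that smoothness of \<open>oproj\<close> along \<open>fst y i\<close>
        applies twice.\<close>
      let ?h = "\<lambda>y. oproj (fst y i) (cadj (fst M) *v (f y - oproj (fst y i) (f y)))"
      have g: "?g y = ?h y" if y: "y \<in> U''" for y
      proof -
        note V = sub[OF U''(1) y]
        have "y \<in> flags k d \<times> flags k d" using y openXX_subset[OF U''(1)] by blast
        moreover have "\<Xi> y \<in> E_fib k y" "s y \<in> snd y i"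
          using y U''(3) \<Xi>(2) s unfolding E_sec_def H_sec_def by blast+
        moreover have "f y \<in> E_component k i y (\<Xi> y) (s y)"
          using eq[OF y] coset_self[OF V] by blast
        ultimately have "gamma1 k d i y (\<Xi> y) M (s y) = gmat (fst y i) (fst M) *v f y"
          by (rule gamma1_eq)
        then show ?thesis using 2 by (simp add: G_section_def \<Xi>(1) M gmat_mult[OF V])
      qed
      have h: "smoothXX k U'' ?h"
        by (intro smoothXX_oproj[OF i U''(1)] smoothXX_matrix_mult[OF U''(1)] smoothXX_diff[OF U''(1)] f)
      have "smoothXX k U'' ?g"
        unfolding smoothXX_def
      proof
        fix y assume y: "y \<in> U''"
        show "smooth_on (pull k U'' y) (\<lambda>a. ?g (act2 k a y))"
        proof (rule smooth_on_cong[OF openXX_imp_open[OF U''(1) y]])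
          show "smooth_on (pull k U'' y) (\<lambda>a. ?h (act2 k a y))" using h y unfolding smoothXX_def by (rule bspec)
        qed (rule g[symmetric], simp)
      qed
      moreover have "?g y \<in> fst y i" if "y \<in> U''" for y
        unfolding g[OF that] by (rule oproj_mem[OF sub[OF U''(1) that]])
      moreover have "U'' \<subseteq> U" using U''(3) U'(3) by blast
      ultimately show ?thesis using U''(1,2) by (intro exI[of _ U''] conjI ballI)
    qed
  qed
  then show "smooth_sec k d (H_bundle k d i) fst U ?g" by (rule smooth_secI[OF i])
qed

text \<open>Sorted by bidegree there are only two genuine equations: \<open>\<delta>\<^sub>\<eta>
  \<gamma>\<^sub>1 = \<partial>bar \<gamma>\<^sub>0\<close> in bidegree \<open>(0, 1)\<close> and
  \<open>\<partial>bar \<gamma>\<^sub>1 = 0\<close> in bidegree \<open>(1, 2)\<close>.\<close>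

lemma nabla_eta_G_section:
  fixes x :: "'n::finite flag \<times> 'n flag"
  assumes x: "x \<in> flags k d \<times> flags k d" and args: "(\<xi>s, Ms, v) \<in> args k (H_bundle k d i) p q x"
  shows "nabla_eta k d (H_bundle k d i) (G_section k d i) p q x \<xi>s Ms v = 0"
proof -
  have \<xi>s: "length \<xi>s = p" "set \<xi>s \<subseteq> E_fib k x" and Ms: "length Ms = q" and v: "v \<in> snd x i"
    using args by (auto simp: args_def H_bundle_def)
  consider "q = 0" | "p = 0" "q = 1" | "p = 1" "q = 2"
    | "0 < q" "\<not> (p = 0 \<and> q = 1)" "\<not> (p = 1 \<and> q = 2)" by linarith
  then show ?thesis
  proof cases
    case 1
    then show ?thesis by (simp add: nabla_eta_def delta_eta_def G_section_def)
  next
    case 2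
    then obtain M where M: "Ms = [M]" and "\<xi>s = []" using \<xi>s Ms by (auto simp: length_Suc_conv)
    \<comment> \<open>\<eta> is induced by the identity matrix, so \<open>v\<close> itself
      represents its component at \<open>v\<close>.\<close>
    have "gamma1 k d i x (eta k x) M v = gmat (fst x i) (fst M) *v v"
      by (simp add: eta_eq_lin_sec gamma1_lin_sec[OF x v])
    then show ?thesis
      using 2 dbar_G_gamma0[OF x v, of M] \<open>\<xi>s = []\<close>
      by (simp add: nabla_eta_def delta_eta_def G_section_def[of k d i 1 1] G_section_def[of k d i "Suc 0" "Suc 0"] M)
  next
    case 3
    then obtain \<xi> M M' where "\<xi>s = [\<xi>]" "Ms = [M, M']"
      using \<xi>s(1) Ms by (auto simp: length_Suc_conv numeral_2_eq_2)
    then show ?thesis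
      using 3 dbar_G_gamma1[OF x _ v, of \<xi> M M'] \<xi>s(2)
      by (simp add: nabla_eta_def delta_eta_def G_section_def[of k d i "Suc (Suc 0)"])
  next
    case 4
    have "(G_section k d i p (q - 1) :: ('n, 'n) comp) = (\<lambda>_ _ _ _. 0)"
      using 4 by (intro ext) (auto simp: G_section_def)
    then show ?thesis
      using 4 dbar_G_zero[OF x \<xi>s(2) v, of p Ms]
      by (auto simp: nabla_eta_def delta_eta_def G_section_def[of k d i "Suc p"])
  qed
qed

end

theorem proposition5:
  fixes d :: "nat \<Rightarrow> nat" and k i :: nat
  assumes "1 \<le> k" and "0 < d 1" and "\<And>j. 1 \<le> j \<Longrightarrow> j < k \<Longrightarrow> d j < d (Suc j)"
    and "d k = CARD('n::finite)"
    and "1 \<le> i" and "i \<le> k"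
  shows "is_weight k d (H_bundle k d i :: ('n, 'n) vbundle) (G_section k d i)"
proof -
  interpret flag_setting k i d by unfold_locales (use assms in simp)
  have zero: "G_section k d i p q x \<xi>s Ms v = 0"
    if pq: "p \<noteq> q \<or> flag_dim k d < p" and x: "x \<in> flags k d \<times> flags k d"
      and args: "(\<xi>s, Ms, v) \<in> args k (H_bundle k d i) p q x"
    for p q and x :: "'n flag \<times> 'n flag" and \<xi>s Ms and v :: "complex^'n"
  proof (cases "p = 1 \<and> q = 1")
    case True
    \<comment> \<open>Vanishing above the rank of \<open>E\<close> concerns bidegree
      \<open>(1, 1)\<close> only if that rank is zero. Strict growth of \<open>d\<close> then forces
      \<open>k = 1\<close>, where \<open>fst x i\<close> is the whole space and \<open>gmat\<close>
      vanishes.\<close>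
    then have "flag_dim k d = 0" using pq by simp
    have "k = 1"
    proof (rule ccontr)
      assume "k \<noteq> 1"
      then have "1 \<in> {1..<k}" using assms(1) by simp
      then have "d 1 * (d (Suc 1) - d 1) = 0"
        using \<open>flag_dim k d = 0\<close> by (simp only: flag_dim_def sum_eq_0_iff finite_atLeastLessThan)
      moreover have "d 1 < d (Suc 1)" using \<open>1 \<in> {1..<k}\<close> assms(3)[of 1] by simp
      ultimately show False using assms(2) by simp
    qed
    then have UNIV: "fst x i = UNIV" using x i by (auto simp: flags_def)
    obtain \<xi> M where \<xi>: "\<xi>s = [\<xi>]" "\<xi> \<in> E_fib k x" and M: "Ms = [M]" and v: "v \<in> snd x i"
      using args True by (auto simp: args_def H_bundle_def length_Suc_conv)
    obtain L where "\<xi> = lin_sec k L x" using E_fib_lin_sec[OF x \<xi>(2)] .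
    then show ?thesis
      using True by (simp add: G_section_def \<xi>(1) M gamma1_lin_sec[OF x v] UNIV gmat_UNIV)
  qed (use pq in \<open>auto simp: G_section_def\<close>)
  show ?thesis
    unfolding is_weight_def
  proof (intro conjI allI impI ballI)
    show "G_smooth k d (H_bundle k d i :: ('n, 'n) vbundle) p q (G_section k d i p q)" for p q
      by (rule G_section_smooth)
  next
    fix p q x t
    assume "p \<noteq> q \<or> flag_dim k d < p" "x \<in> flags k d \<times> flags k d"
      "t \<in> args k (H_bundle k d i :: ('n, 'n) vbundle) p q x"
    then show "case t of (\<xi>s, Ms, v) \<Rightarrow> G_section k d i p q x \<xi>s Ms v = 0"
      using zero by (cases t) blast
  next
    fix p q x t
    assume "x \<in> flags k d \<times> flags k d" "t \<in> args k (H_bundle k d i :: ('n, 'n) vbundle) p q x"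
    then show "case t of (\<xi>s, Ms, v) \<Rightarrow>
        nabla_eta k d (H_bundle k d i) (G_section k d i) p q x \<xi>s Ms v = 0"
      using nabla_eta_G_section[of x "fst t" "fst (snd t)" "snd (snd t)" p q] by (simp add: case_prod_unfold)
  next
    fix F :: "'n flag" and v
    assume "F \<in> flags k d" "v \<in> fib (H_bundle k d i) F"
    then show "G_section k d i 0 0 (F, F) [] [] v = v"
      using oproj_ident[OF flags_subspace[OF _ i, of F d]]
      by (simp add: G_section_def gamma0_def H_bundle_def)
  qed
qed

end
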